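(* Let $n\ge2$. A subset $Q\subset\mathbb{CP}^{n+1}$ is the image of a smooth section $\sigma:G^+_2(\mathbb R^{n+2})\to\mathbb{CP}^{n+1}\setminus\mathbb{RP}^{n+1}$ of $\rho_0$ whose image is a complex submanifold if and only if $Q$ is a smooth quadric without real points; moreover each such $Q$ is the image of exactly one such section. Thus $\sigma\mapsto\sigma(G^+_2(\mathbb R^{n+2}))$ is a bijection between sections of $\rho_0$ with holomorphic image and smooth quadrics in $\mathbb{CP}^{n+1}$ without real points.
   Context: $G^+_2(\mathbb R^{n+2})$ is the Grassmannian of oriented 2-planes in $\mathbb R^{n+2}$. $\mathbb{CP}^{n+1}=\mathbb P(\mathbb C^{n+2})$; a point $[z]$ is real if $z$ is a complex multiple of a vector in $\mathbb R^{n+2}$, and $\mathbb{RP}^{n+1}\subset\mathbb{CP}^{n+1}$ is the set of real points, so $\mathbb{CP}^{n+1}\setminus\mathbb{RP}^{n+1}$ consists of the $[z]$ with $\mathrm{Re}(z),\mathrm{Im}(z)$ linearly independent. $\rho_0:\mathbb{CP}^{n+1}\setminus\mathbb{RP}^{n+1}\to G^+_2(\mathbb R^{n+2})$ is $[z]\mapsto\mathbb R\{\mathrm{Re}(z),\mathrm{Im}(z)\}$, oriented by declaring $(\mathrm{Re}(z),\mathrm{Im}(z))$ positively oriented; it is a fibre bundle with fibre the open disk. A smooth quadric is the zero set of a nondegenerate complex quadratic form on $\mathbb C^{n+2}$. A section has holomorphic image if its image is a complex submanifold of $\mathbb{CP}^{n+1}\setminus\mathbb{RP}^{n+1}$. 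*)

theory Defs
  imports "HOL-Analysis.Analysis"
begin

text \<open>A map f is C-infinity on an open set W iff there is a family g of iterated
  directional derivatives (g [] = f, g (v # vs) is the derivative of g vs in direction v),
  all of which exist and are continuous on W.  In finite dimensions this is exactly C-infinity.\<close>
definition smooth_on :: "'a::real_normed_vector set \<Rightarrow> ('a \<Rightarrow> 'b::real_normed_vector) \<Rightarrow> bool" where
  "smooth_on W f \<longleftrightarrow> open W \<and>
     (\<exists>g :: 'a list \<Rightarrow> 'a \<Rightarrow> 'b.
        (\<forall>x\<in>W. g [] x = f x) \<and>
        (\<forall>vs. continuous_on W (g vs)) \<and>
        (\<forall>vs v x. x \<in> W \<longrightarrow> ((\<lambda>t. g vs (x + t *\<^sub>R v)) has_vector_derivative g (v # vs) x) (at 0)))"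

definition proj_point :: "complex^'n \<Rightarrow> (complex^'n) set" where
  "proj_point z = {c *s z | c. c \<noteq> 0}"

definition CP :: "(complex^'n) set set" where
  "CP = {proj_point z | z. z \<noteq> 0}"

definition cvec_of_real :: "real^'n \<Rightarrow> complex^'n" where
  "cvec_of_real x = (\<chi> i. complex_of_real (x $ i))"

definition RP :: "(complex^'n) set set" where
  "RP = {proj_point (c *s cvec_of_real x) | c x. c \<noteq> 0 \<and> x \<noteq> 0}"

definition vRe :: "complex^'n \<Rightarrow> real^'n" where
  "vRe z = (\<chi> i. Re (z $ i))"

definition vIm :: "complex^'n \<Rightarrow> real^'n" where
  "vIm z = (\<chi> i. Im (z $ i))"

definition indep2 :: "real^'n \<Rightarrow> real^'n \<Rightarrow> bool" where
  "indep2 u v \<longleftrightarrow> (\<forall>a b. a *\<^sub>R u + b *\<^sub>R v = 0 \<longrightarrow> a = 0 \<and> b = 0)"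

text \<open>The oriented plane spanned by (u,v), represented as the set of all positively
  oriented bases of it.\<close>
definition oplane :: "real^'n \<Rightarrow> real^'n \<Rightarrow> ((real^'n) \<times> (real^'n)) set" where
  "oplane u v = {(a *\<^sub>R u + b *\<^sub>R v, c *\<^sub>R u + d *\<^sub>R v) | a b c d. a * d - b * c > 0}"

definition Gr2 :: "((real^'n) \<times> (real^'n)) set set" where
  "Gr2 = {oplane u v | u v. indep2 u v}"

definition rho0 :: "(complex^'n) set \<Rightarrow> ((real^'n) \<times> (real^'n)) set" where
  "rho0 p = (let z = (SOME z. z \<noteq> 0 \<and> p = proj_point z) in oplane (vRe z) (vIm z))"

definition smooth_map_CP :: "('a::real_normed_vector) set \<Rightarrow> ('a \<Rightarrow> (complex^'n) set) \<Rightarrow> bool" where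
  "smooth_map_CP W \<Phi> \<longleftrightarrow> (\<forall>x\<in>W. \<exists>W' s. open W' \<and> x \<in> W' \<and> W' \<subseteq> W \<and> smooth_on W' s \<and>
       (\<forall>y\<in>W'. s y \<noteq> (0::complex^'n) \<and> \<Phi> y = proj_point (s y)))"

text \<open>A map sigma on G^+_2 is smooth iff its pull-back to the open set of linearly independent
  pairs (u,v) (which submerses onto G^+_2 via (u,v) \<mapsto> oplane u v) is smooth.\<close>
definition smooth_on_Gr2 :: "(((real^'n) \<times> (real^'n)) set \<Rightarrow> (complex^'n) set) \<Rightarrow> bool" where
  "smooth_on_Gr2 \<sigma> \<longleftrightarrow> smooth_map_CP {(u, v). indep2 u v} (\<lambda>(u, v). \<sigma> (oplane u v))"

definition holomorphic_map_on :: "(complex^'n) set \<Rightarrow> (complex^'n \<Rightarrow> complex^'n) \<Rightarrow> bool" where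
  "holomorphic_map_on U f \<longleftrightarrow> (\<forall>z\<in>U. \<exists>f'. (f has_derivative f') (at z) \<and>
       (\<forall>c w. f' (c *s w) = c *s f' w))"

definition biholomorphic :: "(complex^'n) set \<Rightarrow> (complex^'n) set \<Rightarrow> (complex^'n \<Rightarrow> complex^'n) \<Rightarrow> bool" where
  "biholomorphic U V \<phi> \<longleftrightarrow> open U \<and> open V \<and> bij_betw \<phi> U V \<and>
      holomorphic_map_on U \<phi> \<and> holomorphic_map_on V (inv_into U \<phi>)"

definition complex_subspace :: "(complex^'n) set \<Rightarrow> bool" where
  "complex_subspace L \<longleftrightarrow> subspace L \<and> (\<forall>c x. x \<in> L \<longrightarrow> c *s x \<in> L)"

definition complex_submanifold :: "(complex^'n) set \<Rightarrow> bool" where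
  "complex_submanifold M \<longleftrightarrow> (\<forall>p\<in>M. \<exists>U V \<phi> L. p \<in> U \<and> biholomorphic U V \<phi> \<and>
       complex_subspace L \<and> \<phi> ` (M \<inter> U) = V \<inter> L)"

text \<open>A subset S of CP is a complex submanifold iff its cone (the union of the punctured
  lines) is a complex submanifold of C^N - {0}.\<close>
definition complex_submanifold_CP :: "(complex^'n) set set \<Rightarrow> bool" where
  "complex_submanifold_CP S \<longleftrightarrow> S \<subseteq> CP \<and> complex_submanifold (\<Union>S)"

definition hol_section :: "(((real^'n) \<times> (real^'n)) set \<Rightarrow> (complex^'n) set) \<Rightarrow> bool" where
  "hol_section \<sigma> \<longleftrightarrow> (\<forall>P\<in>Gr2. \<sigma> P \<in> CP - RP \<and> rho0 (\<sigma> P) = P) \<and>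
      smooth_on_Gr2 \<sigma> \<and> complex_submanifold_CP (\<sigma> ` Gr2)"

definition smooth_quadric :: "(complex^'n) set set \<Rightarrow> bool" where
  "smooth_quadric Q \<longleftrightarrow> (\<exists>A :: complex^'n^'n. transpose A = A \<and> det A \<noteq> 0 \<and>
      Q = {proj_point z | z. z \<noteq> 0 \<and> (\<Sum>i\<in>UNIV. \<Sum>j\<in>UNIV. A $ i $ j * z $ i * z $ j) = 0})"

end

theory Submission
  imports Defs "HOL-Complex_Analysis.Conformal_Mappings"
begin

text \<open>
  From a quadric to a section: on the plane spanned by u and v, a nondegenerate form without real zeros restricts to
  a quadratic polynomial in t with no real root. Rotating v to -v through a third dimension
  exchanges the two half planes, and roots never cross the real axis, so exactly one root lies in the upper
  half plane; it is the unique point of the quadric over the oriented plane.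

  From a section to a quadric: write the section as [u + tau(u, v) v] with Im tau > 0. The image being a complex
  submanifold forces the Burgers equation d tau / dv = tau * d tau / du in every direction y, so in a 3-dimensional
  real subspace spanned by u, v, y the image is locally the graph t = T(s) of a holomorphic function, where s = a + b tau
  at the plane spanned by u + a y, v + b y. Hence the oriented planes of a 3-space, a compact
  connected space, carry a maximum principle: a quadratic form divided by the square of a real linear form becomes
  constant once its polar parts at two points are cancelled, which gives a conic through the image. The
  normalized conics of all 3-spaces through a fixed vector v0 agree on real vectors, where they define a function satisfying
  the parallelogram law, that is, a quadratic form.

  No two sections share an image, since rho0 recovers P from the point over P.
\<close>

text \<open>The obstacle is that a section is merely smooth, while a maximum principle needs
  holomorphic functions. The Burgers equation bridges the gap: the derivatives of tau and of s = a +
  b tau are complex multiples of one and the same real-linear map, so tau is holomorphic in s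
  although neither need be holomorphic in a + i b. Over the planes of a real 3-space the image is a
  copy of the sphere of oriented planes; it meets the line \<open>z $ 3 = 0\<close> only over the
  two orientations of one plane, which is why degree two is right. Prescribing the two roots over
  that plane kills the values of the numerator there, a correction linear in \<open>z $ 3\<close>
  kills the derivatives, and the constant value of the quotient supplies the coefficient of
  \<open>(z $ 3)\<^sup>2\<close>. The conics of different 3-spaces never have to be compared: the
  normalized value at a real x is the product of the roots along x + t v0, and these are
  \<open>tau x v0\<close> and \<open>- tau x (- v0)\<close>, which the section alone determines. The
  parallelogram law concerns x and y only, so together with v0 it takes place in a single
  3-space.\<close>

section \<open>Smooth functions\<close>

text \<open>Smoothness by coinduction: a derivative chosen inside \<open>F\<close> is iterated by
  recursion on the list of directions, so no formula for higher derivatives is ever written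
  down.\<close>

lemma smooth_on_family:
  assumes "open W" "f \<in> F"
    and cont: "\<And>h. h \<in> F \<Longrightarrow> continuous_on W h"
    and der: "\<And>h v. h \<in> F \<Longrightarrow> \<exists>h'\<in>F. \<forall>x\<in>W. ((\<lambda>t. h (x + t *\<^sub>R v)) has_vector_derivative h' x) (at 0)"
  shows "smooth_on W f"
proof -
  obtain D where D: "\<And>h v. h \<in> F \<Longrightarrow> D h v \<in> F \<and> (\<forall>x\<in>W. ((\<lambda>t. h (x + t *\<^sub>R v)) has_vector_derivative D h v x) (at 0))"
    using der by metis
  define g where "g = rec_list f (\<lambda>v vs r. D r v)"
  have g: "g [] = f" "\<And>v vs. g (v # vs) = D (g vs) v" by (simp_all add: g_def)
  have F: "g vs \<in> F" for vs by (induction vs) (use assms D g in auto)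
  show ?thesis unfolding smooth_on_def
    using F D cont assms(1) by (intro conjI exI[of _ g]) (auto simp: g)
qed

lemma smooth_on_derivative:
  assumes "smooth_on W f"
  obtains f' where "\<And>x. x \<in> W \<Longrightarrow> ((\<lambda>t. f (x + t *\<^sub>R v)) has_vector_derivative f' x) (at 0)"
    "smooth_on W f'" 
proof -
  from assms obtain g where W: "open W" and g: "\<forall>x\<in>W. g [] x = f x" "\<And>vs. continuous_on W (g vs)"
    "\<And>vs v x. x \<in> W \<Longrightarrow> ((\<lambda>t. g vs (x + t *\<^sub>R v)) has_vector_derivative g (v # vs) x) (at 0)"
    unfolding smooth_on_def by blast
  have "((\<lambda>t. f (x + t *\<^sub>R v)) has_vector_derivative g [v] x) (at 0)" if "x \<in> W" for x
  proof -
    have "\<forall>\<^sub>F t in nhds 0. x + t *\<^sub>R v \<in> W"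
    proof -
      have "isCont (\<lambda>t. x + t *\<^sub>R v) 0" by (intro continuous_intros)
      then have "((\<lambda>t. x + t *\<^sub>R v) \<longlongrightarrow> x) (nhds 0)" using tendsto_at_iff_tendsto_nhds[of "\<lambda>t. x + t *\<^sub>R v" 0] by (simp add: isCont_def)
      then show ?thesis using W that by (auto dest!: topological_tendstoD)
    qed
    then have "\<forall>\<^sub>F t in nhds 0. g [] (x + t *\<^sub>R v) = f (x + t *\<^sub>R v)"
      by eventually_elim (use g in auto)
    then show ?thesis using g(3)[OF that, of "[]" v] g(1) that
      by (subst has_vector_derivative_cong_ev[symmetric, where f="\<lambda>t. g [] (x + t *\<^sub>R v)"]) (auto)
  qed
  \<comment> \<open>The latest direction stands at the head of a list, so the derivatives of
    \<open>g [v]\<close> are indexed by lists that end in \<open>v\<close>.\<close>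
  moreover have "smooth_on W (g [v])"
    unfolding smooth_on_def using W g by (intro conjI exI[of _ "\<lambda>vs. g (vs @ [v])"]) auto
  ultimately show ?thesis using that by blast
qed

lemma smooth_on_continuous:
  fixes f :: "'a::real_normed_vector \<Rightarrow> 'b::real_normed_vector"
  assumes "smooth_on W f" shows "continuous_on W f"
proof -
  from assms obtain g :: "'a list \<Rightarrow> 'a \<Rightarrow> 'b" where g: "\<forall>x\<in>W. g [] x = f x" "\<forall>vs. continuous_on W (g vs)"
    unfolding smooth_on_def by blast
  then have "continuous_on W (g [])" by blast
  then show ?thesis using g continuous_on_cong by force
qed

text \<open>The generators are the operations of the root formula for quadratic polynomials; the
  side conditions keep \<open>inverse\<close> off its pole and \<open>csqrt\<close> off its branch
  cut.\<close>

inductive_set smooth_algebra :: "'a::real_normed_vector set \<Rightarrow> ('a \<Rightarrow> complex) set" for W where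
  base: "smooth_on W f \<Longrightarrow> f \<in> smooth_algebra W"
| add: "f \<in> smooth_algebra W \<Longrightarrow> h \<in> smooth_algebra W \<Longrightarrow> (\<lambda>x. f x + h x) \<in> smooth_algebra W"
| mult: "f \<in> smooth_algebra W \<Longrightarrow> h \<in> smooth_algebra W \<Longrightarrow> (\<lambda>x. f x * h x) \<in> smooth_algebra W"
| inverse: "f \<in> smooth_algebra W \<Longrightarrow> (\<And>x. x \<in> W \<Longrightarrow> f x \<noteq> 0) \<Longrightarrow> (\<lambda>x. inverse (f x)) \<in> smooth_algebra W"
| csqrt: "f \<in> smooth_algebra W \<Longrightarrow> (\<And>x. x \<in> W \<Longrightarrow> f x \<notin> \<real>\<^sub>\<le>\<^sub>0) \<Longrightarrow> (\<lambda>x. csqrt (f x)) \<in> smooth_algebra W"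

lemma smooth_on_const: "open W \<Longrightarrow> smooth_on W (\<lambda>x. c)"
  unfolding smooth_on_def
  by (intro conjI exI[of _ "\<lambda>vs x. if vs = [] then c else 0"]) auto

lemma smooth_on_linear:
  assumes "open W" "bounded_linear f" shows "smooth_on W f"
proof -
  interpret bounded_linear f by fact
  have 1: "((\<lambda>t. f (x + t *\<^sub>R v)) has_vector_derivative f v) (at 0)" for x v
    by (auto intro!: derivative_eq_intros simp: add scaleR)
  let ?g = "\<lambda>vs x. case vs of [] \<Rightarrow> f x | [v] \<Rightarrow> f v | _ \<Rightarrow> 0"
  have "continuous_on W (?g vs)" for vs
    using linear_continuous_on[OF assms(2)] by (cases vs; cases "tl vs") simp_all
  moreover have "((\<lambda>t. ?g vs (x + t *\<^sub>R v)) has_vector_derivative ?g (v # vs) x) (at 0)" for vs v x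
    using 1 by (cases vs; cases "tl vs") simp_all
  ultimately show ?thesis unfolding smooth_on_def
    by (intro conjI assms exI[of _ ?g]) auto
qed

lemma smooth_algebra_const: "open W \<Longrightarrow> (\<lambda>x. c) \<in> smooth_algebra W"
  by (intro smooth_algebra.base smooth_on_const)

text \<open>Each differentiation rule expresses the derivative by operations of the algebra itself,
  so the algebra qualifies as the family of \<open>smooth_on_family\<close>.\<close>

lemma smooth_algebra_step:
  assumes "f \<in> smooth_algebra W" "open W"
  shows "continuous_on W f \<and> (\<forall>v. \<exists>f'\<in>smooth_algebra W. \<forall>x\<in>W. ((\<lambda>t. f (x + t *\<^sub>R v)) has_vector_derivative f' x) (at 0))"
  using assms(1)
proof induction
  case (base f)
  have "\<exists>f'\<in>smooth_algebra W. \<forall>x\<in>W. ((\<lambda>t. f (x + t *\<^sub>R v)) has_vector_derivative f' x) (at 0)" for v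
    by (rule smooth_on_derivative[OF base, of v]) (auto intro: smooth_algebra.base)
  then show ?case using base by (simp add: smooth_on_continuous)
next
  case (add f h)
  have "\<exists>f'\<in>smooth_algebra W. \<forall>x\<in>W. ((\<lambda>t. f (x + t *\<^sub>R v) + h (x + t *\<^sub>R v)) has_vector_derivative f' x) (at 0)" for v
  proof -
    obtain f' h' where "f' \<in> smooth_algebra W" "\<forall>x\<in>W. ((\<lambda>t. f (x + t *\<^sub>R v)) has_vector_derivative f' x) (at 0)"
      "h' \<in> smooth_algebra W" "\<forall>x\<in>W. ((\<lambda>t. h (x + t *\<^sub>R v)) has_vector_derivative h' x) (at 0)" using add by metis
    then show ?thesis
      by (intro bexI[of _ "\<lambda>x. f' x + h' x"] ballI has_vector_derivative_add smooth_algebra.add) auto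
  qed
  then show ?case using add by (auto intro: continuous_intros)
next
  case (mult f h)
  have "\<exists>f'\<in>smooth_algebra W. \<forall>x\<in>W. ((\<lambda>t. f (x + t *\<^sub>R v) * h (x + t *\<^sub>R v)) has_vector_derivative f' x) (at 0)" for v
  proof -
    obtain f' h' where "f' \<in> smooth_algebra W" "\<forall>x\<in>W. ((\<lambda>t. f (x + t *\<^sub>R v)) has_vector_derivative f' x) (at 0)"
      "h' \<in> smooth_algebra W" "\<forall>x\<in>W. ((\<lambda>t. h (x + t *\<^sub>R v)) has_vector_derivative h' x) (at 0)" using mult by metis
    note fh = this
    have 1: "((\<lambda>t. f (x + t *\<^sub>R v) * h (x + t *\<^sub>R v)) has_vector_derivative (f x * h' x + f' x * h x)) (at 0)" if "x \<in> W" for x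
      using has_vector_derivative_mult[OF fh(2)[rule_format, OF that] fh(4)[rule_format, OF that]] by simp
    have 2: "(\<lambda>x. f x * h' x + f' x * h x) \<in> smooth_algebra W"
      using mult fh by (intro smooth_algebra.add smooth_algebra.mult)
    show ?thesis using 1 by (intro bexI[OF _ 2]) auto
  qed
  then show ?case using mult by (auto intro: continuous_intros)
next
  case (inverse f)
  have "\<exists>f'\<in>smooth_algebra W. \<forall>x\<in>W. ((\<lambda>t. Fields.inverse (f (x + t *\<^sub>R v))) has_vector_derivative f' x) (at 0)" for v
  proof -
    obtain f' where f': "f' \<in> smooth_algebra W" "\<forall>x\<in>W. ((\<lambda>t. f (x + t *\<^sub>R v)) has_vector_derivative f' x) (at 0)" 
      using inverse by metis
    have 1: "((\<lambda>t. Fields.inverse (f (x + t *\<^sub>R v))) has_vector_derivative - 1 * f' x * (Fields.inverse (f x) * Fields.inverse (f x))) (at 0)" if "x \<in> W" for x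
    proof -
      have "(Fields.inverse has_field_derivative - (Fields.inverse (f x) * Fields.inverse (f x))) (at (f (x + 0 *\<^sub>R v)))"
        using DERIV_inverse'[OF DERIV_ident, of "f x"] inverse that by simp
      from field_vector_diff_chain_at[OF f'(2)[rule_format, OF that] this]
      show ?thesis by (simp add: o_def)
    qed
    have 2: "(\<lambda>x. - 1 * f' x * (Fields.inverse (f x) * Fields.inverse (f x))) \<in> smooth_algebra W"
      using f' inverse assms by (intro smooth_algebra.mult smooth_algebra.inverse smooth_algebra_const) auto
    show ?thesis using 1 by (intro bexI[OF _ 2]) auto
  qed
  then show ?case using inverse by (auto intro: continuous_intros)
next
  case (csqrt f)
  have nz: "f x \<noteq> 0" if "x \<in> W" for x using csqrt(2)[OF that] by auto
  have "\<exists>f'\<in>smooth_algebra W. \<forall>x\<in>W. ((\<lambda>t. Complex.csqrt (f (x + t *\<^sub>R v))) has_vector_derivative f' x) (at 0)" for v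
  proof -
    obtain f' where f': "f' \<in> smooth_algebra W" "\<forall>x\<in>W. ((\<lambda>t. f (x + t *\<^sub>R v)) has_vector_derivative f' x) (at 0)" 
      using csqrt by metis
    have 1: "((\<lambda>t. Complex.csqrt (f (x + t *\<^sub>R v))) has_vector_derivative f' x * Fields.inverse (2 * Complex.csqrt (f x))) (at 0)" if "x \<in> W" for x
    proof -
      have "(Complex.csqrt has_field_derivative Fields.inverse (2 * Complex.csqrt (f x))) (at (f (x + 0 *\<^sub>R v)))"
        using has_field_derivative_csqrt[of "f x"] csqrt that by simp
      from field_vector_diff_chain_at[OF f'(2)[rule_format, OF that] this]
      show ?thesis by (simp add: o_def)
    qed
    have 2: "(\<lambda>x. f' x * Fields.inverse (2 * Complex.csqrt (f x))) \<in> smooth_algebra W"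
      using f' csqrt assms nz
      by (intro smooth_algebra.mult smooth_algebra.inverse smooth_algebra.csqrt smooth_algebra_const) auto
    show ?thesis using 1 by (intro bexI[OF _ 2]) auto
  qed
  moreover have "continuous_on W (\<lambda>x. Complex.csqrt (f x))"
  proof (intro continuous_on_compose2[OF _ csqrt(3)[THEN conjunct1] order_refl])
    show "continuous_on (f ` W) Complex.csqrt"
      using csqrt(2) by (intro continuous_at_imp_continuous_on ballI continuous_at_csqrt) auto
  qed
  ultimately show ?case by simp
qed

lemma smooth_on_algebra:
  assumes "f \<in> smooth_algebra W" "open W" shows "smooth_on W f"
  by (rule smooth_on_family[OF assms(2,1)]) (use smooth_algebra_step assms(2) in blast)+

lemma has_vector_derivative_vecI:
  fixes f :: "real \<Rightarrow> 'a::real_normed_vector^'n"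
  assumes "\<And>i. ((\<lambda>t. f t $ i) has_vector_derivative f' $ i) (at x)"
  shows "(f has_vector_derivative f') (at x)"
  unfolding has_vector_derivative_def has_derivative_within
proof (intro conjI)
  show "bounded_linear (\<lambda>t. t *\<^sub>R f')" by (rule bounded_linear_scaleR_left)
  have "((\<lambda>y. ((1 / norm (y - x)) *\<^sub>R (f y - (f x + (y - x) *\<^sub>R f'))) $ i) \<longlongrightarrow> 0 $ i) (at x)" for i
    using assms[of i] unfolding has_vector_derivative_def has_derivative_within by simp
  then show "((\<lambda>y. (1 / norm (y - x)) *\<^sub>R (f y - (f x + (y - x) *\<^sub>R f'))) \<longlongrightarrow> 0) (at x)"
    by (rule vec_tendstoI)
qed

lemma smooth_on_vec:
  fixes f :: "'a::real_normed_vector \<Rightarrow> complex^'n"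
  assumes "open W" "\<And>i. smooth_on W (\<lambda>x. f x $ i)"
  shows "smooth_on W f"
proof (rule smooth_on_family[of W f "{h. \<forall>i. smooth_on W (\<lambda>x. h x $ i)}"])
  fix h :: "'a \<Rightarrow> complex^'n" and v assume h: "h \<in> {h. \<forall>i. smooth_on W (\<lambda>x. h x $ i)}"
  define P where "P = (\<lambda>i h'. (\<forall>x\<in>W. ((\<lambda>t. h (x + t *\<^sub>R v) $ i) has_vector_derivative h' x) (at 0)) \<and> smooth_on W h')"
  have "\<exists>h'. P i h'" for i
  proof -
    have "smooth_on W (\<lambda>x. h x $ i)" using h by simp
    then show ?thesis unfolding P_def by (rule smooth_on_derivative[of _ _ v]) auto
  qed
  then obtain h' where "\<And>i. P i (h' i)" using choice[of P] by blast
  then have h': "\<And>i x. x \<in> W \<Longrightarrow> ((\<lambda>t. h (x + t *\<^sub>R v) $ i) has_vector_derivative h' i x) (at 0)"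
    "\<And>i. smooth_on W (h' i)" unfolding P_def by simp_all
  show "\<exists>h'\<in>{h. \<forall>i. smooth_on W (\<lambda>x. h x $ i)}. \<forall>x\<in>W. ((\<lambda>t. h (x + t *\<^sub>R v)) has_vector_derivative h' x) (at 0)"
  proof (intro bexI[of _ "\<lambda>x. \<chi> i. h' i x"] ballI)
    fix x assume "x \<in> W"
    then show "((\<lambda>t. h (x + t *\<^sub>R v)) has_vector_derivative (\<chi> i. h' i x)) (at 0)"
      using h'(1) by (intro has_vector_derivative_vecI) simp
  qed (simp add: h'(2))
next
  fix h :: "'a \<Rightarrow> complex^'n" assume h: "h \<in> {h. \<forall>i. smooth_on W (\<lambda>x. h x $ i)}"
  then have "continuous_on W (\<lambda>x. \<chi> i. h x $ i)"
    by (intro continuous_on_vec_lambda) (auto intro: smooth_on_continuous)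
  then show "continuous_on W h" by simp
qed (use assms in auto)

lemma smooth_on_vec_nth:
  fixes f :: "'a::real_normed_vector \<Rightarrow> complex^'n"
  assumes "smooth_on W f"
  shows "smooth_on W (\<lambda>x. f x $ i)"
proof -
  from assms obtain g where W: "open W" and g: "\<forall>x\<in>W. g [] x = f x" "\<And>vs. continuous_on W (g vs)"
    "\<And>vs v x. x \<in> W \<Longrightarrow> ((\<lambda>t. g vs (x + t *\<^sub>R v)) has_vector_derivative g (v # vs) x) (at 0)"
    unfolding smooth_on_def by blast
  show ?thesis unfolding smooth_on_def using W g
    by (intro conjI exI[of _ "\<lambda>vs x. g vs x $ i"])
       (auto intro!: continuous_intros bounded_linear.has_vector_derivative[OF bounded_linear_vec_nth])
qed

section \<open>Points over an oriented plane\<close>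

lemma cv_nth [simp]: "cvec_of_real x $ i = complex_of_real (x $ i)"
  by (simp add: cvec_of_real_def)

lemma vRe_nth [simp]: "vRe z $ i = Re (z $ i)" and vIm_nth [simp]: "vIm z $ i = Im (z $ i)"
  by (simp_all add: vRe_def vIm_def)

lemma cv_eq_0_iff [simp]: "cvec_of_real x = 0 \<longleftrightarrow> x = 0"
  by (simp add: vec_eq_iff)

lemma cv_0 [simp]: "cvec_of_real 0 = 0" by simp

lemma cv_add: "cvec_of_real (x + y) = cvec_of_real x + cvec_of_real y"
  and cv_scaleR: "cvec_of_real (r *\<^sub>R x) = complex_of_real r *s cvec_of_real x"
  and cv_minus: "cvec_of_real (- x) = - cvec_of_real x"
  by (simp_all add: vec_eq_iff)

lemma cvec_decompose: "z = cvec_of_real (vRe z) + \<i> *s cvec_of_real (vIm z)"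
  by (simp add: vec_eq_iff complex_eq_iff)

lemma indep2_nz: "indep2 u v \<Longrightarrow> u \<noteq> 0 \<and> v \<noteq> 0"
  unfolding indep2_def by (metis add_0 add.right_neutral scaleR_zero_right scaleR_zero_left scale_one zero_neq_one)

lemma indep2D: "indep2 u v \<Longrightarrow> a *\<^sub>R u + b *\<^sub>R v = 0 \<Longrightarrow> a = 0 \<and> b = 0"
  by (simp add: indep2_def)

lemma indep2_complex:
  assumes "indep2 u v" "\<alpha> *s cvec_of_real u + \<beta> *s cvec_of_real v = 0"
  shows "\<alpha> = 0" "\<beta> = 0"
proof -
  have "Re \<alpha> *\<^sub>R u + Re \<beta> *\<^sub>R v = 0" "Im \<alpha> *\<^sub>R u + Im \<beta> *\<^sub>R v = 0"
    using assms(2) by (simp_all add: vec_eq_iff complex_eq_iff)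
  then show "\<alpha> = 0" "\<beta> = 0" using indep2D[OF assms(1)] by (auto simp: complex_eq_iff)
qed

lemma indep2_complex_eq:
  assumes "indep2 u v" "\<alpha> *s cvec_of_real u + \<beta> *s cvec_of_real v = \<alpha>' *s cvec_of_real u + \<beta>' *s cvec_of_real v"
  shows "\<alpha> = \<alpha>'" "\<beta> = \<beta>'"
  using indep2_complex[OF assms(1), of "\<alpha> - \<alpha>'" "\<beta> - \<beta>'"] assms(2)
  by (simp_all add: vec.scale_left_diff_distrib algebra_simps)

lemma indep2_combine:
  assumes "indep2 u v" "a * d - b * c \<noteq> 0"
  shows "indep2 (a *\<^sub>R u + b *\<^sub>R v) (c *\<^sub>R u + d *\<^sub>R v)"
  unfolding indep2_def
proof (intro allI impI)
  fix r s assume "r *\<^sub>R (a *\<^sub>R u + b *\<^sub>R v) + s *\<^sub>R (c *\<^sub>R u + d *\<^sub>R v) = 0"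
  then have "(r * a + s * c) *\<^sub>R u + (r * b + s * d) *\<^sub>R v = 0" by (simp add: algebra_simps)
  from indep2D[OF assms(1) this] have e: "r * a + s * c = 0" "r * b + s * d = 0" by auto
  have "r * (a * d - b * c) = d * (r * a + s * c) - c * (r * b + s * d)" 
    "s * (a * d - b * c) = a * (r * b + s * d) - b * (r * a + s * c)" by (simp_all add: algebra_simps)
  then have "r * (a * d - b * c) = 0" "s * (a * d - b * c) = 0" unfolding e by simp_all
  then show "r = 0 \<and> s = 0" using assms(2) by (simp del: right_minus_eq)
qed

lemma indep2_minus: "indep2 u v \<Longrightarrow> indep2 u (- v)"
  using indep2_combine[of u v 1 "-1" 0 0] by simp

lemma oplane_self: "(u, v) \<in> oplane u v"
  unfolding oplane_def by (intro CollectI exI[of _ 1] exI[of _ 0]) (auto intro: exI[of _ 0] exI[of _ 1])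

lemma oplane_sub:
  assumes "a * d - b * c > 0"
  shows "oplane (a *\<^sub>R u + b *\<^sub>R v) (c *\<^sub>R u + d *\<^sub>R v) \<subseteq> oplane u v"
proof
  fix p assume "p \<in> oplane (a *\<^sub>R u + b *\<^sub>R v) (c *\<^sub>R u + d *\<^sub>R v)"
  then obtain a' b' c' d' where p: "a' * d' - b' * c' > 0"
    "p = (a' *\<^sub>R (a *\<^sub>R u + b *\<^sub>R v) + b' *\<^sub>R (c *\<^sub>R u + d *\<^sub>R v), c' *\<^sub>R (a *\<^sub>R u + b *\<^sub>R v) + d' *\<^sub>R (c *\<^sub>R u + d *\<^sub>R v))"
    unfolding oplane_def by auto
  have "p = ((a' * a + b' * c) *\<^sub>R u + (a' * b + b' * d) *\<^sub>R v, (c' * a + d' * c) *\<^sub>R u + (c' * b + d' * d) *\<^sub>R v)"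
    by (simp add: p(2) algebra_simps)
  moreover have "(a' * a + b' * c) * (c' * b + d' * d) - (a' * b + b' * d) * (c' * a + d' * c) = (a' * d' - b' * c') * (a * d - b * c)"
    by (simp add: algebra_simps)
  ultimately show "p \<in> oplane u v" unfolding oplane_def using p(1) assms
    by (intro CollectI exI[of _ "a' * a + b' * c"] exI[of _ "a' * b + b' * d"] exI[of _ "c' * a + d' * c"] exI[of _ "c' * b + d' * d"] conjI) auto
qed

lemma oplane_combine:
  assumes "a * d - b * c > 0"
  shows "oplane (a *\<^sub>R u + b *\<^sub>R v) (c *\<^sub>R u + d *\<^sub>R v) = oplane u v"
proof
  define D where "D = a * d - b * c"
  have D: "D > 0" using assms D_def by simp
  let ?u = "a *\<^sub>R u + b *\<^sub>R v" and ?v = "c *\<^sub>R u + d *\<^sub>R v"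
  have "(d / D) *\<^sub>R ?u + (- b / D) *\<^sub>R ?v = ((d * a - b * c) / D) *\<^sub>R u + ((d * b - b * d) / D) *\<^sub>R v"
    by (simp add: algebra_simps diff_divide_distrib)
  also have "\<dots> = u" using D by (simp add: D_def mult.commute)
  finally have "(d / D) *\<^sub>R ?u + (- b / D) *\<^sub>R ?v = u" .
  moreover have "(- c / D) *\<^sub>R ?u + (a / D) *\<^sub>R ?v = ((a * c - a * c) / D) *\<^sub>R u + ((a * d - b * c) / D) *\<^sub>R v"
    by (simp add: algebra_simps diff_divide_distrib)
  then have "(- c / D) *\<^sub>R ?u + (a / D) *\<^sub>R ?v = v" using D by (simp add: D_def)
  moreover have "(d / D) * (a / D) - (- b / D) * (- c / D) > 0"
  proof -
    have "(d / D) * (a / D) - (- b / D) * (- c / D) = D / (D * D)"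
      by (simp add: D_def diff_divide_distrib algebra_simps)
    then show ?thesis using D by simp
  qed
  ultimately show "oplane u v \<subseteq> oplane ?u ?v"
    using oplane_sub[of "d / D" "a / D" "- b / D" "- c / D" ?u ?v] D by simp
qed (rule oplane_sub[OF assms])

lemma oplane_eqE:
  assumes "oplane u v = oplane u' v'"
  obtains a b c d where "a * d - b * c > 0" "u' = a *\<^sub>R u + b *\<^sub>R v" "v' = c *\<^sub>R u + d *\<^sub>R v"
proof -
  have "(u', v') \<in> oplane u v" using assms oplane_self by metis
  then show ?thesis using that unfolding oplane_def by blast
qed

lemma proj_point_eq_iff: "proj_point z = proj_point w \<longleftrightarrow> (\<exists>c. c \<noteq> 0 \<and> w = c *s z)"
proof
  assume "proj_point z = proj_point w"
  moreover have "w \<in> proj_point w" unfolding proj_point_def by (auto intro!: exI[of _ 1])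
  ultimately show "\<exists>c. c \<noteq> 0 \<and> w = c *s z" unfolding proj_point_def by blast
next
  assume "\<exists>c. c \<noteq> 0 \<and> w = c *s z"
  then obtain c where c: "c \<noteq> 0" "w = c *s z" by blast
  have "d *s z \<in> proj_point w" if "d \<noteq> 0" for d
    unfolding proj_point_def using c that by (intro CollectI exI[of _ "d / c"]) auto
  moreover have "d *s w \<in> proj_point z" if "d \<noteq> 0" for d
    unfolding proj_point_def using c that by (intro CollectI exI[of _ "d * c"]) auto
  ultimately show "proj_point z = proj_point w" unfolding proj_point_def by blast
qed

lemma proj_point_scale: "c \<noteq> 0 \<Longrightarrow> proj_point (c *s z) = proj_point z"
  by (metis proj_point_eq_iff)

lemma in_proj_point: "w \<in> proj_point z \<longleftrightarrow> (\<exists>c. c \<noteq> 0 \<and> w = c *s z)"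
  unfolding proj_point_def by auto

lemma proj_point_self: "z \<in> proj_point z"
  unfolding in_proj_point by (intro exI[of _ 1]) simp

text \<open>The representative picked by \<open>SOME\<close> differs from \<open>z\<close> by a
  factor \<open>c\<close>, which acts on the pair of real and imaginary parts by a matrix of
  determinant |c|^2 > 0.\<close>

lemma rho0_proj_point:
  assumes "z \<noteq> 0"
  shows "rho0 (proj_point z) = oplane (vRe z) (vIm z)"
proof -
  define w where "w = (SOME w. w \<noteq> 0 \<and> proj_point z = proj_point w)"
  have "w \<noteq> 0 \<and> proj_point z = proj_point w" unfolding w_def by (rule someI[of _ z]) (use assms in auto)
  then obtain c where c: "c \<noteq> 0" "w = c *s z" using proj_point_eq_iff by metis
  have "vRe w = Re c *\<^sub>R vRe z + (- Im c) *\<^sub>R vIm z" "vIm w = Im c *\<^sub>R vRe z + Re c *\<^sub>R vIm z"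
    by (simp_all add: c vec_eq_iff)
  moreover have "Re c * Re c - (- Im c) * Im c > 0"
    using c(1) complex_neq_0[of c] by (simp add: power2_eq_square)
  ultimately have "oplane (vRe w) (vIm w) = oplane (vRe z) (vIm z)" using oplane_combine by metis
  then show ?thesis unfolding rho0_def Let_def w_def[symmetric] by simp
qed

lemma proj_point_RP_iff:
  assumes "z \<noteq> 0"
  shows "proj_point z \<in> RP \<longleftrightarrow> \<not> indep2 (vRe z) (vIm z)"
proof
  assume "proj_point z \<in> RP"
  then obtain c x where "c \<noteq> 0" "x \<noteq> 0" "proj_point z = proj_point (c *s cvec_of_real x)"
    unfolding RP_def by blast
  then obtain d where d: "z = d *s cvec_of_real x" by (metis proj_point_eq_iff vec.scale_scale)
  show "\<not> indep2 (vRe z) (vIm z)"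
  proof
    assume i: "indep2 (vRe z) (vIm z)"
    have "Im d *\<^sub>R vRe z + (- Re d) *\<^sub>R vIm z = 0" by (simp add: d vec_eq_iff)
    from indep2D[OF i this] have "d = 0" by (simp add: complex_eq_iff)
    then show False using d assms by simp
  qed
next
  assume "\<not> indep2 (vRe z) (vIm z)"
  then obtain a b where ab: "a *\<^sub>R vRe z + b *\<^sub>R vIm z = 0" "a \<noteq> 0 \<or> b \<noteq> 0" unfolding indep2_def by blast
  \<comment> \<open>With c = b + i a, the given relation says that the imaginary part of
    \<open>c *s z\<close> vanishes.\<close>
  define c where "c = Complex b a"
  have c: "c \<noteq> 0" using ab by (auto simp: c_def complex_eq_iff)
  define x where "x = vRe (c *s z)"
  have "vIm (c *s z) = 0" using ab(1) by (simp add: c_def vec_eq_iff algebra_simps)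
  then have z: "c *s z = cvec_of_real x" using cvec_decompose[of "c *s z"] by (simp add: x_def)
  then have "x \<noteq> 0" using c assms by (metis cv_eq_0_iff vec.scale_eq_0_iff)
  moreover have "proj_point z = proj_point (1 *s cvec_of_real x)" using z c proj_point_scale by (metis vec.scale_one)
  ultimately show "proj_point z \<in> RP" unfolding RP_def using one_neq_zero by blast
qed

text \<open>With \<open>point_above_plane\<close> and \<open>proj_point_affine_eq\<close> this
  identifies the fibre of \<open>rho0\<close> over an oriented plane with the upper half plane, once
  a positive basis is fixed.\<close>

lemma above_plane_point:
  assumes "indep2 u v" "Im t > 0"
  defines "z \<equiv> cvec_of_real u + t *s cvec_of_real v"
  shows "z \<noteq> 0" "proj_point z \<in> CP - RP" "rho0 (proj_point z) = oplane u v"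
proof -
  show z: "z \<noteq> 0" using indep2_complex[OF assms(1), of 1 t] by (auto simp: z_def)
  have "vRe z = 1 *\<^sub>R u + Re t *\<^sub>R v" "vIm z = 0 *\<^sub>R u + Im t *\<^sub>R v" by (simp_all add: z_def vec_eq_iff)
  then show "rho0 (proj_point z) = oplane u v" "proj_point z \<in> CP - RP"
    using rho0_proj_point[OF z] oplane_combine[of 1 "Im t" "Re t" 0 u v] indep2_combine[OF assms(1), of 1 "Im t" "Re t" 0]
     assms(2) proj_point_RP_iff[OF z] z by (auto simp: CP_def)
qed

lemma point_above_plane:
  assumes "indep2 u v" "p \<in> CP - RP" "rho0 p = oplane u v"
  obtains t where "Im t > 0" "p = proj_point (cvec_of_real u + t *s cvec_of_real v)"
proof -
  from assms obtain z where z: "z \<noteq> 0" "p = proj_point z" by (auto simp: CP_def)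
  then have "oplane u v = oplane (vRe z) (vIm z)" using assms(3) rho0_proj_point by metis
  then obtain a b c d where D: "a * d - b * c > 0" "vRe z = a *\<^sub>R u + b *\<^sub>R v" "vIm z = c *\<^sub>R u + d *\<^sub>R v"
    using oplane_eqE by metis
  \<comment> \<open>The coordinates of \<open>z\<close> with respect to \<open>u\<close> and
    \<open>v\<close> are a + i c and b + i d; dividing by the former normalizes the point, and the
    imaginary part of the quotient is the determinant over |k|^2.\<close>
  define k where "k = Complex a c"
  have k: "k \<noteq> 0" using D(1) by (auto simp: k_def complex_eq_iff)
  define t where "t = Complex b d / k"
  have "z = k *s (cvec_of_real u + t *s cvec_of_real v)"
  proof -
    have "z = (a *\<^sub>R 1 + c *\<^sub>R \<i>) *s cvec_of_real u + (b *\<^sub>R 1 + d *\<^sub>R \<i>) *s cvec_of_real v"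
      by (subst cvec_decompose) (simp add: D vec_eq_iff complex_eq_iff)
    also have "(a *\<^sub>R 1 + c *\<^sub>R \<i>) = k" by (simp add: k_def complex_eq_iff)
    also have "(b *\<^sub>R 1 + d *\<^sub>R \<i>) = k * t" using k by (simp add: t_def complex_eq_iff)
    finally show ?thesis by (simp add: vec.scale_right_distrib)
  qed
  moreover have "Im t > 0"
  proof -
    have "Im t = (a * d - b * c) / ((Re k)\<^sup>2 + (Im k)\<^sup>2)" by (simp add: t_def k_def Im_divide algebra_simps)
    moreover have "(Re k)\<^sup>2 + (Im k)\<^sup>2 > 0" using k by (metis complex_neq_0)
    ultimately show ?thesis using D(1) by simp
  qed
  ultimately show ?thesis using that z(2) k proj_point_scale by metis
qed

lemma proj_point_affine_eq:
  assumes "indep2 u v" "proj_point (cvec_of_real u + s *s cvec_of_real v) = proj_point (cvec_of_real u + t *s cvec_of_real v)"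
  shows "s = t"
proof -
  obtain c where "cvec_of_real u + t *s cvec_of_real v = c *s (cvec_of_real u + s *s cvec_of_real v)"
    using assms(2) proj_point_eq_iff by metis
  then have "1 *s cvec_of_real u + t *s cvec_of_real v = c *s cvec_of_real u + (c * s) *s cvec_of_real v"
    by (simp add: vec.scale_right_distrib)
  from indep2_complex_eq[OF assms(1) this] show ?thesis by simp
qed

lemma oplane_in_Gr2: "indep2 u v \<Longrightarrow> oplane u v \<in> Gr2"
  unfolding Gr2_def by blast

lemma Gr2E: 
  assumes "P \<in> Gr2" obtains u v where "indep2 u v" "P = oplane u v"
  using assms unfolding Gr2_def by blast

section \<open>Quadrics without real points\<close>

definition qb :: "complex^'n^'n \<Rightarrow> complex^'n \<Rightarrow> complex^'n \<Rightarrow> complex" where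
  "qb A z w = (\<Sum>i\<in>UNIV. \<Sum>j\<in>UNIV. A $ i $ j * z $ i * w $ j)"

lemma qb_add_left: "qb A (x + y) z = qb A x z + qb A y z"
  and qb_add_right: "qb A z (x + y) = qb A z x + qb A z y"
  by (simp_all add: qb_def algebra_simps sum.distrib)

lemma qb_scale_left: "qb A (c *s x) y = c * qb A x y"
  and qb_scale_right: "qb A x (c *s y) = c * qb A x y"
  by (simp_all add: qb_def sum_distrib_left mult_ac)

lemma qb_minus_left: "qb A (- x) y = - qb A x y"
  and qb_minus_right: "qb A x (- y) = - qb A x y"
  by (simp_all add: qb_def sum_negf)

lemma qb_diff_left: "qb A (x - y) z = qb A x z - qb A y z"
  and qb_diff_right: "qb A z (x - y) = qb A z x - qb A z y"
  by (simp_all add: qb_def algebra_simps sum_subtractf)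

lemma qb_sym:
  assumes "transpose A = A" shows "qb A x y = qb A y x"
proof -
  have A: "A $ i $ j = A $ j $ i" for i j using assms by (metis transpose_def vec_lambda_beta)
  have "qb A y x = (\<Sum>j\<in>UNIV. \<Sum>i\<in>UNIV. A $ i $ j * y $ i * x $ j)"
    unfolding qb_def by (rule sum.swap)
  also have "\<dots> = qb A x y" unfolding qb_def
    by (intro sum.cong refl) (metis A mult.assoc mult.commute)
  finally show ?thesis by simp
qed

lemmas qb_linear = qb_add_left qb_add_right qb_scale_left qb_scale_right qb_minus_left qb_minus_right qb_diff_left qb_diff_right

lemma qb_expand:
  assumes "transpose A = A"
  shows "qb A (u + t *s v) (u + t *s v) = qb A u u + 2 * t * qb A u v + t\<^sup>2 * qb A v v"
  using qb_sym[OF assms, of v u] by (simp add: qb_linear power2_eq_square algebra_simps)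

lemma qb_nondegenerate:
  assumes "transpose A = A" "det A \<noteq> 0" "z \<noteq> 0"
  obtains w where "qb A z w = 1"
proof -
  have "A *v z \<noteq> 0"
    using assms(2,3) by (metis invertible_det_nz invertible_left_inverse matrix_left_invertible_ker)
  then obtain i where i: "(A *v z) $ i \<noteq> 0" by (auto simp: vec_eq_iff)
  have "qb A (axis i 1) z = (A *v z) $ i"
    unfolding qb_def matrix_vector_mult_def axis_def
    by (simp add: if_distrib if_distribR sum.delta cong: if_cong) (simp add: if_distrib if_distribR sum.If_cases)
  then have "qb A z (inverse ((A *v z) $ i) *s axis i 1) = 1"
    using i by (simp add: qb_scale_right qb_sym[OF assms(1), of z])
  then show ?thesis using that by blast
qed

lemma bounded_bilinear_qb: "bounded_bilinear (qb A)"
proof -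
  have s: "r *\<^sub>R x = complex_of_real r *s x" for r and x :: "complex^'n" by (simp add: vec_eq_iff scaleR_conv_of_real[where 'a=complex])
  show ?thesis unfolding bilinear_conv_bounded_bilinear[symmetric] bilinear_def
    by (auto intro!: linearI simp: qb_linear s scaleR_conv_of_real[where 'a=complex])
qed

text \<open>The right-hand side is continuous in \<open>d\<close>, whereas \<open>csqrt\<close>
  itself jumps across the negative real axis.\<close>

lemma csqrt_Im_squared: "(Im (csqrt d))\<^sup>2 = (cmod d - Re d) / 2"
proof -
  define w where "w = csqrt d"
  have d: "d = w\<^sup>2" by (simp add: w_def)
  have "(Im w)\<^sup>2 = (cmod (w\<^sup>2) - Re (w\<^sup>2)) / 2" by (simp add: norm_power cmod_power2 Re_power2)
  then show ?thesis using d w_def by metis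
qed

lemma nonvanishing_sign:
  fixes f :: "real \<Rightarrow> real"
  assumes "continuous_on {0..1} f" "\<And>s. s \<in> {0..1} \<Longrightarrow> f s \<noteq> 0" "f 0 > 0" "s \<in> {0..1}"
  shows "f s > 0"
proof (rule ccontr)
  assume "\<not> f s > 0"
  then have "\<exists>x\<ge>0. x \<le> s \<and> f x = 0"
    using assms by (intro IVT2') (auto intro: continuous_on_subset)
  then show False using assms by fastforce
qed

text \<open>The roots given by \<open>csqrt\<close> may jump along the path, so only symmetric
  functions of them are followed: the sum \<open>S\<close>, and the product \<open>X\<close> of
  their imaginary parts up to the factor 4. \<open>D\<close> is the square of the difference of the
  roots.\<close>

lemma quadratic_roots_separated:
  fixes a b c :: "real \<Rightarrow> complex"
  assumes cont: "continuous_on {0..1} a" "continuous_on {0..1} b" "continuous_on {0..1} c"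
    and c: "\<And>s. s \<in> {0..1} \<Longrightarrow> c s \<noteq> 0"
    and nz: "\<And>s t. s \<in> {0..1} \<Longrightarrow> a s + 2 * of_real t * b s + (of_real t)\<^sup>2 * c s \<noteq> 0"
    and ends: "a 1 = a 0" "c 1 = c 0" "b 1 = - b 0"
  obtains t1 t2 where "Im t1 > 0" "Im t2 < 0" 
    "\<And>t. a 0 + 2 * t * b 0 + t\<^sup>2 * c 0 = c 0 * (t - t1) * (t - t2)"
proof -
  define S where "S s = - 2 * b s / c s" for s
  define D where "D s = 4 * ((b s)\<^sup>2 - a s * c s) / (c s)\<^sup>2" for s
  define r1 where "r1 s = (S s + csqrt (D s)) / 2" for s
  define r2 where "r2 s = (S s - csqrt (D s)) / 2" for s
  have fact: "a s + 2 * t * b s + t\<^sup>2 * c s = c s * (t - r1 s) * (t - r2 s)" if "s \<in> {0..1}" for s t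
  proof -
    have "(t - r1 s) * (t - r2 s) = t\<^sup>2 - t * S s + ((S s)\<^sup>2 - (csqrt (D s))\<^sup>2) / 4"
      unfolding r1_def r2_def by (simp add: field_simps power2_eq_square)
    also have "\<dots> = t\<^sup>2 - t * S s + ((S s)\<^sup>2 - D s) / 4" by simp
    also have "(S s)\<^sup>2 - D s = 4 * a s / c s"
      unfolding S_def D_def using c[OF that] by (simp add: field_simps power2_eq_square)
    finally have "c s * ((t - r1 s) * (t - r2 s)) = c s * t\<^sup>2 - t * (c s * S s) + a s"
      using c[OF that] by (simp add: field_simps)
    also have "c s * S s = - 2 * b s" unfolding S_def using c[OF that] by simp
    finally show ?thesis by (simp add: algebra_simps)
  qed
  have Imr: "Im (r1 s) \<noteq> 0 \<and> Im (r2 s) \<noteq> 0" if "s \<in> {0..1}" for s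
  proof (intro conjI notI)
    assume "Im (r1 s) = 0" then have "r1 s = of_real (Re (r1 s))" by (simp add: complex_eq_iff)
    then show False using fact[OF that, of "r1 s"] nz[OF that, of "Re (r1 s)"] by simp
  next
    assume "Im (r2 s) = 0" then have "r2 s = of_real (Re (r2 s))" by (simp add: complex_eq_iff)
    then show False using fact[OF that, of "r2 s"] nz[OF that, of "Re (r2 s)"] by simp
  qed
  \<comment> \<open>Four times the product of the imaginary parts of the two roots, as a continuous function of the coefficients.\<close>
  define X where "X s = (Im (S s))\<^sup>2 - (cmod (D s) - Re (D s)) / 2" for s
  have X: "X s = 4 * Im (r1 s) * Im (r2 s)" for s
    unfolding X_def csqrt_Im_squared[symmetric] r1_def r2_def by (simp add: power2_eq_square field_simps)
  have contS: "continuous_on {0..1} S" and contD: "continuous_on {0..1} D"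
    unfolding S_def D_def using c cont by (auto intro!: continuous_intros)
  then have contX: "continuous_on {0..1} X" unfolding X_def by (auto intro!: continuous_intros)
  have "\<not> X 0 > 0"
  proof
    \<comment> \<open>Two roots on the same side stay on one side for all s, so the imaginary part
      of their sum never vanishes; yet \<open>ends\<close> makes the sum change sign.\<close>
    assume "X 0 > 0"
    then have "X s > 0" if "s \<in> {0..1}" for s
      using nonvanishing_sign[OF contX _ _ that] X Imr by simp
    then have "Im (S s) \<noteq> 0" if "s \<in> {0..1}" for s
      using that complex_Re_le_cmod[of "D s"] unfolding X_def by fastforce
    moreover have "Im (S 1) = - Im (S 0)" by (simp add: S_def ends)
    moreover have "continuous_on {0..1} (\<lambda>s. Im (S s))" "continuous_on {0..1} (\<lambda>s. - Im (S s))"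
      using contS by (auto intro!: continuous_intros)
    ultimately show False
      using nonvanishing_sign[of "\<lambda>s. Im (S s)" 1] nonvanishing_sign[of "\<lambda>s. - Im (S s)" 1]
      by (smt (verit) atLeastAtMost_iff)
  qed
  then have "Im (r1 0) * Im (r2 0) < 0" using X Imr[of 0] by (simp add: not_less mult_le_0_iff mult_less_0_iff) linarith
  then consider "Im (r1 0) > 0" "Im (r2 0) < 0" | "Im (r2 0) > 0" "Im (r1 0) < 0" by (auto simp: mult_less_0_iff)
  then show ?thesis
  proof cases
    case 1 then show ?thesis using that[of "r1 0" "r2 0"] fact[of 0] by simp
  next
    case 2 then show ?thesis using that[of "r2 0" "r1 0"] fact[of 0] by (simp add: mult_ac)
  qed
qed

definition indep3 :: "real^'n \<Rightarrow> real^'n \<Rightarrow> real^'n \<Rightarrow> bool" where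
  "indep3 u v y \<longleftrightarrow> (\<forall>a b c. a *\<^sub>R u + b *\<^sub>R v + c *\<^sub>R y = 0 \<longrightarrow> a = 0 \<and> b = 0 \<and> c = 0)"

lemma indep3D: "indep3 u v y \<Longrightarrow> a *\<^sub>R u + b *\<^sub>R v + c *\<^sub>R y = 0 \<Longrightarrow> a = 0 \<and> b = 0 \<and> c = 0"
  unfolding indep3_def by blast

lemma indep3_indep2: assumes "indep3 u v y" shows "indep2 u v"
  unfolding indep2_def using indep3D[OF assms, of _ _ 0] by auto

lemma span2: "x \<in> span {u, v} \<longleftrightarrow> (\<exists>a b. x = a *\<^sub>R u + b *\<^sub>R v)"
  by (auto simp: span_breakdown_eq algebra_simps)

lemma indep3I:
  assumes "indep2 u v" "y \<notin> span {u, v}" shows "indep3 u v y"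
  unfolding indep3_def
proof (intro allI impI)
  fix a b c assume e: "a *\<^sub>R u + b *\<^sub>R v + c *\<^sub>R y = 0"
  have "c = 0"
  proof (rule ccontr)
    assume "c \<noteq> 0"
    have "c *\<^sub>R y = (- a) *\<^sub>R u + (- b) *\<^sub>R v" using e by (simp add: algebra_simps add_eq_0_iff)
    then have "inverse c *\<^sub>R (c *\<^sub>R y) = (inverse c * - a) *\<^sub>R u + (inverse c * - b) *\<^sub>R v" by (simp only: scaleR_add_right scaleR_scaleR)
    then have "y = (inverse c * - a) *\<^sub>R u + (inverse c * - b) *\<^sub>R v" using \<open>c \<noteq> 0\<close> by simp
    then show False using assms(2) span2 by blast
  qed
  then show "a = 0 \<and> b = 0 \<and> c = 0" using indep2D[OF assms(1), of a b] e by simp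
qed

lemma exists_indep3:
  fixes u v :: "real^'n"
  assumes "CARD('n) \<ge> 3" "indep2 u v" obtains y where "indep3 u v y"
proof -
  have "dim (span {u, v}) \<le> card {u, v}" by (simp add: dim_le_card')
  also have "\<dots> \<le> 2" by (simp add: card_insert_if)
  finally have "dim (span {u, v}) < DIM(real^'n)" using assms(1) by simp
  then have "span {u, v} \<noteq> UNIV" by (metis dim_UNIV dim_span less_irrefl)
  then obtain y where "y \<notin> span {u, v}" by blast
  then show ?thesis using that indep3I assms(2) by blast
qed

lemma continuous_on_cv [continuous_intros]:
  assumes "continuous_on X f" shows "continuous_on X (\<lambda>x. cvec_of_real (f x))"
  unfolding cvec_of_real_def using assms by (intro continuous_intros)

lemma real_point_free_roots:
  fixes A :: "complex^'n^'n"
  assumes sym: "transpose A = A" and real: "\<And>x. x \<noteq> 0 \<Longrightarrow> qb A (cvec_of_real x) (cvec_of_real x) \<noteq> 0"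
    and uv: "indep2 u v" and n: "CARD('n) \<ge> 3"
  obtains t1 t2 where "Im t1 > 0" "Im t2 < 0"
    "\<And>t. qb A (cvec_of_real u + t *s cvec_of_real v) (cvec_of_real u + t *s cvec_of_real v)
        = qb A (cvec_of_real v) (cvec_of_real v) * (t - t1) * (t - t2)"
proof -
  obtain y where y: "indep3 u v y" using exists_indep3 n uv by blast
  \<comment> \<open>A half turn from \<open>v\<close> to \<open>- v\<close> in the plane of
    \<open>v\<close> and \<open>y\<close>. It stays independent of \<open>u\<close>, so the form has
    no real zero along the way; at the end \<open>b\<close> has changed sign while \<open>a\<close>
    and \<open>c\<close> have returned.\<close>
  define p where "p s = cos (pi * s) *\<^sub>R v + sin (pi * s) *\<^sub>R y" for s
  define a where "a s = qb A (cvec_of_real u) (cvec_of_real u)" for s :: real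
  define b where "b s = qb A (cvec_of_real u) (cvec_of_real (p s))" for s
  define c where "c s = qb A (cvec_of_real (p s)) (cvec_of_real (p s))" for s
  have up: "r *\<^sub>R u + t *\<^sub>R p s \<noteq> 0" if "r \<noteq> 0 \<or> t \<noteq> 0" for r t s
  proof
    assume "r *\<^sub>R u + t *\<^sub>R p s = 0"
    then have "r *\<^sub>R u + (t * cos (pi * s)) *\<^sub>R v + (t * sin (pi * s)) *\<^sub>R y = 0" by (simp add: p_def algebra_simps)
    from indep3D[OF y this] have "r = 0" "t * cos (pi * s) = 0" "t * sin (pi * s) = 0" by auto
    then show False using that sin_cos_squared_add[of "pi * s"] by (cases "t = 0") auto
  qed
  have contp: "continuous_on X p" for X unfolding p_def by (intro continuous_intros)
  have exp: "qb A (cvec_of_real u + t *s cvec_of_real (p s)) (cvec_of_real u + t *s cvec_of_real (p s)) = a s + 2 * t * b s + t\<^sup>2 * c s" for t s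
    unfolding a_def b_def c_def by (rule qb_expand[OF sym])
  have p0: "p 0 = v" "p 1 = - v" by (simp_all add: p_def)
  show ?thesis
  proof (rule quadratic_roots_separated[of a b c])
    show "continuous_on {0..1} a" unfolding a_def by simp
    show "continuous_on {0..1} b" "continuous_on {0..1} c" unfolding b_def c_def
      by (intro bounded_bilinear.continuous_on[OF bounded_bilinear_qb] continuous_intros contp)+
    show "c s \<noteq> 0" for s unfolding c_def using real[of "p s"] up[of 0 1] by simp
    show "a s + 2 * of_real t * b s + (of_real t)\<^sup>2 * c s \<noteq> 0" for s t
      unfolding exp[symmetric] using real[of "u + t *\<^sub>R p s"] up[of 1 t s] by (simp add: cv_add cv_scaleR)
    show "a 1 = a 0" "c 1 = c 0" "b 1 = - b 0" 
      by (simp_all add: a_def b_def c_def p0 cv_minus qb_linear)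
  qed (use that exp[of _ 0] in \<open>simp add: p0 c_def\<close>)
qed

lemma smooth_algebra_sum:
  assumes "open W" "finite I" "\<And>i. i \<in> I \<Longrightarrow> f i \<in> smooth_algebra W"
  shows "(\<lambda>x. \<Sum>i\<in>I. f i x) \<in> smooth_algebra W"
  using assms(2,3)
proof (induction I rule: finite_induct)
  case empty then show ?case using smooth_algebra_const[OF assms(1), of 0] by simp
next
  case (insert i I)
  then show ?case using smooth_algebra.add[of "f i" W "\<lambda>x. \<Sum>i\<in>I. f i x"] by simp
qed

lemma smooth_algebra_coord:
  assumes "open W"
  shows "(\<lambda>x. complex_of_real (fst x $ i)) \<in> smooth_algebra (W :: ((real^'n) \<times> (real^'n)) set)"
    "(\<lambda>x. complex_of_real (snd x $ i)) \<in> smooth_algebra (W :: ((real^'n) \<times> (real^'n)) set)"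
  by (intro smooth_algebra.base smooth_on_linear assms bounded_linear_compose[OF bounded_linear_of_real]
      bounded_linear_compose[OF bounded_linear_vec_nth] bounded_linear_fst bounded_linear_snd)+

lemma smooth_algebra_qb:
  assumes "open W" "\<And>i. (\<lambda>x. f x $ i) \<in> smooth_algebra W" "\<And>i. (\<lambda>x. g x $ i) \<in> smooth_algebra W"
  shows "(\<lambda>x. qb A (f x) (g x)) \<in> smooth_algebra W"
  unfolding qb_def
  by (intro smooth_algebra_sum smooth_algebra.mult smooth_algebra_const assms finite)

text \<open>Linear dependence is the equality case of the Cauchy-Schwarz inequality, hence a closed
  condition.\<close>

lemma open_indep2: "open {(u :: real^'n, v). indep2 u v}"
proof -
  have "{(u :: real^'n, v). indep2 u v} = {p. (norm (fst p) * norm (snd p)) \<noteq> \<bar>fst p \<bullet> snd p\<bar>}"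
  proof (intro set_eqI iffI)
    fix p :: "(real^'n) \<times> (real^'n)" assume "p \<in> {(u, v). indep2 u v}"
    then have i: "indep2 (fst p) (snd p)" by auto
    have "\<bar>fst p \<bullet> snd p\<bar> \<noteq> norm (fst p) * norm (snd p)"
    proof
      assume "\<bar>fst p \<bullet> snd p\<bar> = norm (fst p) * norm (snd p)"
      then have "norm (fst p) *\<^sub>R snd p = norm (snd p) *\<^sub>R fst p \<or> norm (fst p) *\<^sub>R snd p = - norm (snd p) *\<^sub>R fst p"
        using norm_cauchy_schwarz_abs_eq by blast
      then have "(- norm (snd p)) *\<^sub>R fst p + norm (fst p) *\<^sub>R snd p = 0 \<or> norm (snd p) *\<^sub>R fst p + norm (fst p) *\<^sub>R snd p = 0" by auto
      then show False using indep2D[OF i] indep2_nz[OF i] by fastforce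
    qed
    then show "p \<in> {p. (norm (fst p) * norm (snd p)) \<noteq> \<bar>fst p \<bullet> snd p\<bar>}" by simp
  next
    fix p :: "(real^'n) \<times> (real^'n)" assume p: "p \<in> {p. (norm (fst p) * norm (snd p)) \<noteq> \<bar>fst p \<bullet> snd p\<bar>}"
    have "indep2 (fst p) (snd p)"
    proof (rule ccontr)
      assume "\<not> indep2 (fst p) (snd p)"
      then obtain a b where ab: "a *\<^sub>R fst p + b *\<^sub>R snd p = 0" "a \<noteq> 0 \<or> b \<noteq> 0" unfolding indep2_def by blast
      from ab(2) show False
      proof
        assume "a \<noteq> 0"
        then have "a *\<^sub>R (fst p + (b / a) *\<^sub>R snd p) = 0" using ab(1) by (simp add: scaleR_add_right)
        then have "fst p = (- b / a) *\<^sub>R snd p" using \<open>a \<noteq> 0\<close> by (simp add: eq_neg_iff_add_eq_0)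
        then show False using p by (simp add: abs_mult norm_mult dot_square_norm power2_eq_square)
      next
        assume "b \<noteq> 0"
        then have "b *\<^sub>R (snd p + (a / b) *\<^sub>R fst p) = 0" using ab(1) by (simp add: scaleR_add_right add.commute)
        then have "snd p = (- a / b) *\<^sub>R fst p" using \<open>b \<noteq> 0\<close> by (simp add: eq_neg_iff_add_eq_0)
        then show False using p by (simp add: abs_mult norm_mult dot_square_norm power2_eq_square)
      qed
    qed
    then show "p \<in> {(u, v). indep2 u v}" by (auto simp: case_prod_beta)
  qed
  also have "open \<dots>" by (intro open_Collect_neq continuous_intros)
  finally show ?thesis .
qed

section \<open>The section determined by a quadric without real points\<close>

locale point_free_quadric =
  fixes A :: "complex^'n^'n"
  assumes sym: "transpose A = A" and det: "det A \<noteq> 0" and card: "CARD('n) \<ge> 3"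
    and real: "\<And>x. x \<noteq> 0 \<Longrightarrow> qb A (cvec_of_real x) (cvec_of_real x) \<noteq> 0"
begin

definition "quad = {proj_point z | z. z \<noteq> 0 \<and> qb A z z = 0}"

lemma in_quad: "z \<noteq> 0 \<Longrightarrow> proj_point z \<in> quad \<longleftrightarrow> qb A z z = 0"
proof
  assume "proj_point z \<in> quad"
  then obtain w where "qb A w w = 0" "proj_point w = proj_point z" unfolding quad_def by blast
  then show "qb A z z = 0" using proj_point_eq_iff[of w z] by (auto simp: qb_linear)
qed (auto simp: quad_def)

lemma union_quad: "\<Union>quad = {z. z \<noteq> 0 \<and> qb A z z = 0}"
proof (intro set_eqI iffI)
  fix z assume "z \<in> \<Union>quad"
  then obtain w where "w \<noteq> 0" "qb A w w = 0" "z \<in> proj_point w" unfolding quad_def by blast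
  then show "z \<in> {z. z \<noteq> 0 \<and> qb A z z = 0}" by (auto simp: in_proj_point qb_linear)
next
  fix z assume "z \<in> {z. z \<noteq> 0 \<and> qb A z z = 0}"
  then show "z \<in> \<Union>quad" unfolding quad_def using proj_point_self by blast
qed

text \<open>The nonvanishing discriminant, the second conclusion, is what later makes the root
  depend smoothly on the basis.\<close>

lemma upper_root:
  assumes "indep2 u v"
  obtains t where "Im t > 0" "\<And>s. Im s > 0 \<Longrightarrow> proj_point (cvec_of_real u + s *s cvec_of_real v) \<in> quad \<longleftrightarrow> s = t"
    "(qb A (cvec_of_real u) (cvec_of_real v))\<^sup>2 - qb A (cvec_of_real u) (cvec_of_real u) * qb A (cvec_of_real v) (cvec_of_real v) \<noteq> 0"
proof -
  let ?a = "qb A (cvec_of_real u) (cvec_of_real u)" and ?b = "qb A (cvec_of_real u) (cvec_of_real v)"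
    and ?c = "qb A (cvec_of_real v) (cvec_of_real v)"
  obtain t1 t2 where t: "Im t1 > 0" "Im t2 < 0"
    "\<And>t. qb A (cvec_of_real u + t *s cvec_of_real v) (cvec_of_real u + t *s cvec_of_real v) = ?c * (t - t1) * (t - t2)"
    using real_point_free_roots[OF sym real assms card] by blast
  have c: "?c \<noteq> 0" using real indep2_nz[OF assms] by blast
  have e: "?a + 2 * t * ?b + t\<^sup>2 * ?c = ?c * (t - t1) * (t - t2)" for t
    using t(3) qb_expand[OF sym] by metis
  have "?a = ?c * t1 * t2" using e[of 0] by simp
  moreover have "2 * ?b = - ?c * (t1 + t2)" using e[of 1] calculation by (simp add: algebra_simps eq_neg_iff_add_eq_0)
  \<comment> \<open>By Vieta the discriminant becomes a multiple of (t1 - t2)^2, and the two roots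
    lie in opposite half planes.\<close>
  moreover have "4 * (?b\<^sup>2 - ?a * ?c) = (2 * ?b)\<^sup>2 - 4 * ?a * ?c" by (simp add: power2_eq_square algebra_simps)
  ultimately have "4 * (?b\<^sup>2 - ?a * ?c) = (- ?c * (t1 + t2))\<^sup>2 - 4 * (?c * t1 * t2) * ?c" by (simp only:)
  also have "\<dots> = ?c\<^sup>2 * (t1 - t2)\<^sup>2" by (simp add: power2_eq_square algebra_simps)
  also have "\<dots> \<noteq> 0" using c t by auto
  finally have "?b\<^sup>2 - ?a * ?c \<noteq> 0" by auto
  moreover have "proj_point (cvec_of_real u + s *s cvec_of_real v) \<in> quad \<longleftrightarrow> s = t1" if "Im s > 0" for s
    using in_quad[OF above_plane_point(1)[OF assms that]] t c that by (auto simp: t(3))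
  ultimately show ?thesis using that t(1) by blast
qed

definition "sec P = (THE p. p \<in> quad \<and> p \<in> CP - RP \<and> rho0 p = P)"

lemma sec_unique:
  assumes "indep2 u v"
  shows "\<exists>!p. p \<in> quad \<and> p \<in> CP - RP \<and> rho0 p = oplane u v"
proof -
  obtain t where t: "Im t > 0" "\<And>s. Im s > 0 \<Longrightarrow> proj_point (cvec_of_real u + s *s cvec_of_real v) \<in> quad \<longleftrightarrow> s = t"
    using upper_root[OF assms] by blast
  show ?thesis
  proof (rule ex1I[of _ "proj_point (cvec_of_real u + t *s cvec_of_real v)"])
    show "proj_point (cvec_of_real u + t *s cvec_of_real v) \<in> quad \<and> proj_point (cvec_of_real u + t *s cvec_of_real v) \<in> CP - RP \<and> rho0 (proj_point (cvec_of_real u + t *s cvec_of_real v)) = oplane u v"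
      using above_plane_point[OF assms t(1)] t by blast
    fix p assume p: "p \<in> quad \<and> p \<in> CP - RP \<and> rho0 p = oplane u v"
    then obtain s where "Im s > 0" "p = proj_point (cvec_of_real u + s *s cvec_of_real v)"
      using point_above_plane[OF assms] by blast
    then show "p = proj_point (cvec_of_real u + t *s cvec_of_real v)" using t(2) p by blast
  qed
qed

lemma sec:
  assumes "P \<in> Gr2"
  shows "sec P \<in> quad" "sec P \<in> CP - RP" "rho0 (sec P) = P"
proof -
  from assms obtain u v where "indep2 u v" "P = oplane u v" by (rule Gr2E)
  then have "sec P \<in> quad \<and> sec P \<in> CP - RP \<and> rho0 (sec P) = P"
    using theI'[OF sec_unique] unfolding sec_def by blast
  then show "sec P \<in> quad" "sec P \<in> CP - RP" "rho0 (sec P) = P" by auto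
qed

lemma sec_eq:
  assumes "indep2 u v" "Im t > 0" "qb A (cvec_of_real u + t *s cvec_of_real v) (cvec_of_real u + t *s cvec_of_real v) = 0"
  shows "sec (oplane u v) = proj_point (cvec_of_real u + t *s cvec_of_real v)"
  using sec_unique[OF assms(1)] sec[OF oplane_in_Gr2[OF assms(1)]] above_plane_point[OF assms(1,2)] in_quad assms(3) by blast

lemma quad_no_real: "quad \<inter> RP = {}"
proof (rule ccontr)
  assume "quad \<inter> RP \<noteq> {}"
  then obtain c x where cx: "c \<noteq> 0" "x \<noteq> 0" "proj_point (c *s cvec_of_real x) \<in> quad" unfolding RP_def by blast
  then show False using real[of x] in_quad[of "c *s cvec_of_real x"] by (auto simp: qb_linear)
qed

lemma sec_image: "sec ` Gr2 = quad"
proof (intro equalityI subsetI)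
  fix p assume p: "p \<in> quad"
  then obtain z where z: "z \<noteq> 0" "p = proj_point z" unfolding quad_def by blast
  then have "p \<in> CP - RP" using p quad_no_real by (auto simp: CP_def)
  then have "indep2 (vRe z) (vIm z)" using z proj_point_RP_iff by auto
  then have i: "indep2 (vRe z) (vIm z)" .
  have "sec (oplane (vRe z) (vIm z)) = p" unfolding sec_def
    by (rule the1_equality[OF sec_unique[OF i]]) (use p z \<open>p \<in> CP - RP\<close> rho0_proj_point in auto)
  then show "p \<in> sec ` Gr2" using oplane_in_Gr2[OF i] by blast
qed (use sec in blast)

text \<open>Near a given basis the point is obtained by the quadratic formula with one fixed branch
  of the square root; being in the upper half plane is an open condition, so this branch keeps
  giving the right root.\<close>

lemma sec_smooth: "smooth_on_Gr2 sec"
  unfolding smooth_on_Gr2_def smooth_map_CP_def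
proof
  fix x :: "(real^'n) \<times> (real^'n)" assume x: "x \<in> {(u, v). indep2 u v}"
  define a where "a x = qb A (cvec_of_real (fst x)) (cvec_of_real (fst x))" for x :: "(real^'n) \<times> (real^'n)"
  define b where "b x = qb A (cvec_of_real (fst x)) (cvec_of_real (snd x))" for x :: "(real^'n) \<times> (real^'n)"
  define c where "c x = qb A (cvec_of_real (snd x)) (cvec_of_real (snd x))" for x :: "(real^'n) \<times> (real^'n)"
  have alg: "a \<in> smooth_algebra W" "b \<in> smooth_algebra W" "c \<in> smooth_algebra W" if "open W" for W
    unfolding a_def b_def c_def using that by (intro smooth_algebra_qb; simp add: smooth_algebra_coord)+
  define d where "d x = (b x)\<^sup>2 - a x * c x" for x
  have i: "indep2 (fst x) (snd x)" using x by auto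
  obtain t where t: "Im t > 0" "\<And>s. Im s > 0 \<Longrightarrow> proj_point (cvec_of_real (fst x) + s *s cvec_of_real (snd x)) \<in> quad \<longleftrightarrow> s = t" "d x \<noteq> 0"
    using upper_root[OF i] unfolding d_def a_def b_def c_def by metis
  have cnz: "c y \<noteq> 0" if "indep2 (fst y) (snd y)" for y unfolding c_def using real indep2_nz[OF that] by blast
  have exp: "qb A (cvec_of_real (fst y) + s *s cvec_of_real (snd y)) (cvec_of_real (fst y) + s *s cvec_of_real (snd y)) = a y + 2 * s * b y + s\<^sup>2 * c y" for s y
    unfolding a_def b_def c_def by (rule qb_expand[OF sym])
  have "a x + 2 * t * b x + t\<^sup>2 * c x = 0"
    using t(1,2) in_quad[OF above_plane_point(1)[OF i t(1)]] exp by metis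
  define w where "w = b x + t * c x"
  have w: "w\<^sup>2 = d x"
  proof -
    have "w\<^sup>2 - d x = c x * (a x + 2 * t * b x + t\<^sup>2 * c x)" by (simp add: w_def d_def power2_eq_square algebra_simps)
    then show ?thesis using \<open>a x + 2 * t * b x + t\<^sup>2 * c x = 0\<close> by simp
  qed
  \<comment> \<open>\<open>w * csqrt (d y / d x)\<close> is the square root of \<open>d y\<close>
    that equals \<open>w\<close> at \<open>x\<close>, and \<open>w\<close> is the sign for which the
    root at \<open>x\<close> is \<open>t\<close>. The quotient is 1 at \<open>x\<close>;
    \<open>W0\<close> keeps its real part positive and thus off the cut.\<close>
  define r where "r y = (w * csqrt (d y / d x) - b y) / c y" for y
  have rx: "r x = t" unfolding r_def w_def using t(3) cnz[OF i] by simp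
  define W0 where "W0 = {y. indep2 (fst y) (snd y)} \<inter> {y. Re (d y / d x) > 0}"
  have contabc: "continuous_on UNIV a" "continuous_on UNIV b" "continuous_on UNIV c"
    using smooth_algebra_step[OF _ open_UNIV] alg[OF open_UNIV] by blast+
  have W0: "open W0"
  proof -
    have "open {y :: (real^'n) \<times> (real^'n). indep2 (fst y) (snd y)}" using open_indep2 by (simp add: case_prod_beta')
    moreover have "open {y. Re (d y / d x) > 0}" unfolding d_def
      by (intro open_Collect_less continuous_intros contabc)
        (use t(3) in \<open>simp add: d_def\<close>)
    ultimately show ?thesis unfolding W0_def by blast
  qed
  have ralg: "r \<in> smooth_algebra W" if "open W" "W \<subseteq> W0" for W
  proof -
    have "(\<lambda>y. (w * csqrt (((b y * b y) + (-1) * (a y * c y)) * inverse (d x)) + (-1) * b y) * inverse (c y)) \<in> smooth_algebra W"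
    proof (intro smooth_algebra.mult smooth_algebra.add smooth_algebra.csqrt smooth_algebra.inverse smooth_algebra_const alg that t(3))
      fix y assume "y \<in> W"
      then have y: "y \<in> W0" using that by blast
      then show "c y \<noteq> 0" using cnz by (auto simp: W0_def)
      have "(b y * b y + (-1) * (a y * c y)) * inverse (d x) = d y / d x" 
        by (simp add: d_def power2_eq_square field_simps)
      then show "(b y * b y + (-1) * (a y * c y)) * inverse (d x) \<notin> \<real>\<^sub>\<le>\<^sub>0" 
        using y by (auto simp: W0_def complex_nonpos_Reals_iff)
    qed
    then show ?thesis by (simp add: r_def[abs_def] d_def power2_eq_square field_simps)
  qed
  define W where "W = {y \<in> W0. Im (r y) > 0}"
  have W: "open W"
  proof -
    have "continuous_on W0 r" using smooth_algebra_step[OF ralg[OF W0 order_refl] W0] by blast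
    then have "continuous_on W0 (\<lambda>y. Im (r y))" by (intro continuous_intros)
    then have "open ((\<lambda>y. Im (r y)) -` {0<..} \<inter> W0)" using W0 by (metis continuous_on_open_vimage open_greaterThan)
    moreover have "(\<lambda>y. Im (r y)) -` {0<..} \<inter> W0 = W" unfolding W_def by auto
    ultimately show ?thesis by simp
  qed
  define s where "s y = cvec_of_real (fst y) + r y *s cvec_of_real (snd y)" for y
  have "smooth_on W s"
  proof (rule smooth_on_vec[OF W])
    fix i
    have "(\<lambda>x. complex_of_real (fst x $ i) + r x * complex_of_real (snd x $ i)) \<in> smooth_algebra W"
      using W ralg[OF W] by (intro smooth_algebra.add smooth_algebra.mult smooth_algebra_coord) (auto simp: W_def)
    then show "smooth_on W (\<lambda>x. s x $ i)" unfolding s_def using smooth_on_algebra[OF _ W] by simp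
  qed
  moreover have "s y \<noteq> 0 \<and> (case y of (u, v) \<Rightarrow> sec (oplane u v)) = proj_point (s y)" if "y \<in> W" for y
  proof -
    have y: "indep2 (fst y) (snd y)" "Re (d y / d x) > 0" "Im (r y) > 0" using that by (auto simp: W_def W0_def)
    have "(c y * r y + b y)\<^sup>2 = d y" unfolding r_def using cnz[OF y(1)] w t(3) by (simp add: power_mult_distrib)
    moreover have "c y * (a y + 2 * r y * b y + (r y)\<^sup>2 * c y) = (c y * r y + b y)\<^sup>2 - d y"
      by (simp add: d_def power2_eq_square algebra_simps)
    ultimately have "a y + 2 * r y * b y + (r y)\<^sup>2 * c y = 0" using cnz[OF y(1)] by simp
    then show ?thesis using sec_eq[OF y(1,3)] exp[of y "r y"] above_plane_point(1)[OF y(1,3)]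
      unfolding s_def by (simp add: case_prod_beta)
  qed
  moreover have "x \<in> W" using rx t i by (simp add: W_def W0_def)
  moreover have "W \<subseteq> {(u, v). indep2 u v}" by (auto simp: W_def W0_def)
  ultimately show "\<exists>W' s. open W' \<and> x \<in> W' \<and> W' \<subseteq> {(u, v). indep2 u v} \<and> smooth_on W' s \<and>
       (\<forall>y\<in>W'. s y \<noteq> 0 \<and> (case y of (u, v) \<Rightarrow> sec (oplane u v)) = proj_point (s y))"
    using W by blast
qed

end

text \<open>Along an isotropic direction e with qb A p e = 1 the form is affine, so replacing the
  coordinate lam by the value of the form is a birational chart with explicit inverse.\<close>
lemma complex_submanifold_quadric_cone:
  fixes A :: "complex^'n^'n"
  assumes sym: "transpose A = A" and det: "det A \<noteq> 0"
  shows "complex_submanifold {z. z \<noteq> 0 \<and> qb A z z = 0}"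
  unfolding complex_submanifold_def
proof
  let ?q = "\<lambda>z. qb A z z"
  fix p assume p: "p \<in> {z. z \<noteq> 0 \<and> qb A z z = 0}"
  then obtain f where f: "qb A p f = 1" using qb_nondegenerate[OF sym det] by blast
  \<comment> \<open>Since \<open>p\<close> is isotropic, subtracting a multiple of \<open>p\<close>
    leaves the pairing with \<open>p\<close> equal to 1 and can be tuned to make \<open>e\<close>
    isotropic.\<close>
  define e where "e = f - (?q f / 2) *s p"
  have pe: "qb A p e = 1" and ee: "?q e = 0"
    using p f qb_sym[OF sym, of f p] by (simp_all add: e_def qb_linear)
  define lam where "lam z = qb A z p" for z
  have lam: "lam e = 1" "lam (x + y) = lam x + lam y" "lam (x - y) = lam x - lam y" "lam (c *s x) = c * lam x" for x y c
    using pe qb_sym[OF sym, of e p] by (simp_all add: lam_def qb_linear)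
  have qaff: "?q (z + t *s e) = ?q z + 2 * t * qb A z e" for z t
    using qb_expand[OF sym, of z t e] ee by simp
  define U where "U = {z. qb A z e \<noteq> 0}"
  define \<phi> where "\<phi> z = z + (?q z - lam z) *s e" for z
  \<comment> \<open>\<open>\<phi>\<close> moves along \<open>e\<close> so that \<open>lam\<close> of
    the image is the value of the form. Its inverse starts from the point of the
    \<open>e\<close>-line with \<open>lam\<close> equal to 0 and solves the affine equation, of
    slope \<open>2 * qb A w e\<close>, for the parameter at which the form takes the value
    \<open>lam w\<close>.\<close>
  define \<psi> where "\<psi> w = w + ((lam w - ?q (w - lam w *s e)) * inverse (2 * qb A w e) - lam w) *s e" for w
  have U\<phi>: "qb A (z + t *s e) e = qb A z e" for z t by (simp add: qb_linear ee)
  have \<psi>\<phi>: "\<psi> (\<phi> z) = z" if "z \<in> U" for z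
  proof -
    have l: "lam (\<phi> z) = ?q z" by (simp add: \<phi>_def lam)
    have y: "\<phi> z - ?q z *s e = z + (- lam z) *s e" by (simp add: \<phi>_def vec.scale_left_diff_distrib)
    have z: "qb A (\<phi> z) e = qb A z e" unfolding \<phi>_def by (rule U\<phi>)
    have "(?q z - (?q z + 2 * (- lam z) * qb A z e)) * inverse (2 * qb A z e) - ?q z = lam z - ?q z"
      using that by (simp add: U_def field_simps)
    then have "\<psi> (\<phi> z) = \<phi> z + (lam z - ?q z) *s e"
      unfolding \<psi>_def l y qaff z by simp
    then show ?thesis by (simp add: \<phi>_def vec.scale_left_diff_distrib)
  qed
  have \<phi>\<psi>: "\<phi> (\<psi> w) = w" if "w \<in> U" for w
  proof -
    define y where "y = w + (- lam w) *s e"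
    define t where "t = (lam w - ?q y) * inverse (2 * qb A w e)"
    have \<psi>w: "\<psi> w = y + t *s e" 
      by (simp add: \<psi>_def y_def t_def vec.scale_left_diff_distrib)
    have "lam y = 0" by (simp add: y_def lam)
    then have "lam (\<psi> w) = t" by (simp add: \<psi>w lam)
    moreover have "?q (\<psi> w) = lam w"
    proof -
      have "qb A y e = qb A w e" unfolding y_def by (rule U\<phi>)
      then show ?thesis unfolding \<psi>w qaff t_def using that by (simp add: U_def field_simps)
    qed
    ultimately show ?thesis unfolding \<phi>_def \<psi>w by (simp add: y_def vec.scale_left_diff_distrib)
  qed
  have \<phi>U: "\<phi> z \<in> U \<longleftrightarrow> z \<in> U" for z unfolding U_def \<phi>_def mem_Collect_eq by (simp only: U\<phi>)
  have \<psi>U: "\<psi> z \<in> U \<longleftrightarrow> z \<in> U" for z unfolding U_def \<psi>_def mem_Collect_eq by (simp only: U\<phi>)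
  have inj: "inj_on \<phi> U" using \<psi>\<phi> by (metis inj_onI)
  have img: "\<phi> ` U = U" using \<phi>\<psi> \<phi>U \<psi>U by (metis (no_types, lifting) image_iff subsetI subset_antisym)
  have inv: "inv_into U \<phi> w = \<psi> w" if "w \<in> U" for w
    using that \<phi>\<psi> \<psi>U inj by (metis inv_into_f_f)
  interpret qb: bounded_bilinear "qb A" by (rule bounded_bilinear_qb)
  have linlam: "bounded_linear lam" unfolding lam_def by (rule qb.bounded_linear_left)
  note lin = linlam[THEN bounded_linear.has_derivative]
  have smult: "bounded_bilinear (\<lambda>c (x :: complex^'n). c *s x)"
  proof -
    have "(r *\<^sub>R c) *s x = r *\<^sub>R (c *s x)" "c *s (r *\<^sub>R x) = r *\<^sub>R (c *s x)" for r c and x :: "complex^'n"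
      by (simp_all add: vec_eq_iff)
    then show ?thesis unfolding bilinear_conv_bounded_bilinear[symmetric] bilinear_def
      by (auto intro!: linearI simp: vec.scale_left_distrib vec.scale_right_distrib)
  qed
  have openU: "open U" unfolding U_def
    by (intro open_Collect_neq continuous_intros linear_continuous_on qb.bounded_linear_left)
  have hol\<phi>: "holomorphic_map_on U \<phi>" unfolding holomorphic_map_on_def
  proof (intro ballI exI conjI allI)
    fix z assume "z \<in> U"
    let ?d = "\<lambda>h. h + (qb A z h + qb A h z - lam h) *s e"
    show "(\<phi> has_derivative ?d) (at z)" unfolding \<phi>_def
      by (rule has_derivative_eq_rhs, rule has_derivative_add[OF has_derivative_ident bounded_bilinear.FDERIV[OF smult has_derivative_diff[OF qb.FDERIV[OF has_derivative_ident has_derivative_ident] lin[OF has_derivative_ident]] has_derivative_const]])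
        (simp add: fun_eq_iff qb.zero_right bounded_bilinear.zero_right[OF smult])
    show "?d (c *s w) = c *s ?d w" for c w by (simp add: qb_linear lam algebra_simps vec.scale_right_distrib)
  qed
  have hol\<psi>: "holomorphic_map_on U \<psi>" unfolding holomorphic_map_on_def
  proof (intro ballI)
    fix w assume w: "w \<in> U"
    let ?y = "w - lam w *s e"
    let ?dy = "\<lambda>h. h - lam h *s e"
    have dy: "((\<lambda>w. w - lam w *s e) has_derivative ?dy) (at w)"
      by (rule has_derivative_eq_rhs, rule has_derivative_diff[OF has_derivative_ident bounded_bilinear.FDERIV[OF smult lin[OF has_derivative_ident] has_derivative_const]])
        (simp add: fun_eq_iff qb.zero_right bounded_bilinear.zero_right[OF smult])
    let ?dn = "\<lambda>h. lam h - (qb A ?y (?dy h) + qb A (?dy h) ?y)"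
    have dn: "((\<lambda>w. lam w - ?q (w - lam w *s e)) has_derivative ?dn) (at w)"
      by (rule has_derivative_eq_rhs, rule has_derivative_diff[OF lin[OF has_derivative_ident] qb.FDERIV[OF dy dy]])
        (simp add: fun_eq_iff qb.zero_right bounded_bilinear.zero_right[OF smult])
    have dd: "((\<lambda>w. 2 * qb A w e) has_derivative (\<lambda>h. 2 * qb A h e)) (at w)"
      by (rule has_derivative_eq_rhs, rule has_derivative_mult_right[OF qb.FDERIV[OF has_derivative_ident has_derivative_const]])
        (simp add: fun_eq_iff qb.zero_right bounded_bilinear.zero_right[OF smult])
    have nz: "2 * qb A w e \<noteq> 0" using w by (simp add: U_def)
    let ?D = "2 * qb A w e" and ?N = "lam w - ?q ?y"
    let ?d = "\<lambda>h. h + (?N * - (inverse ?D * (2 * qb A h e) * inverse ?D) + ?dn h * inverse ?D - lam h) *s e"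
    have "(\<psi> has_derivative ?d) (at w)" unfolding \<psi>_def
      by (rule has_derivative_eq_rhs, rule has_derivative_add[OF has_derivative_ident bounded_bilinear.FDERIV[OF smult has_derivative_diff[OF has_derivative_mult[OF dn Deriv.has_derivative_inverse[OF nz dd]] lin[OF has_derivative_ident]] has_derivative_const]])
        (simp add: fun_eq_iff qb.zero_right bounded_bilinear.zero_right[OF smult])
    moreover have "?d (c *s h) = c *s ?d h" for c h
    proof -
      have a: "?dy (c *s h) = c *s ?dy h" by (simp add: lam vec.scale_right_diff_distrib)
      have dnc: "?dn (c *s h) = c * ?dn h" unfolding a unfolding qb_scale_left qb_scale_right lam(4)
        by (simp only: right_diff_distrib distrib_left)
      have alg: "n * - (i * (2 * (c * q)) * i) + c * r * i - c * l = c * (n * - (i * (2 * q) * i) + r * i - l)"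
        for n i q r l :: complex by (simp add: algebra_simps)
      have "?N * - (inverse ?D * (2 * qb A (c *s h) e) * inverse ?D) + ?dn (c *s h) * inverse ?D - lam (c *s h)
         = c * (?N * - (inverse ?D * (2 * qb A h e) * inverse ?D) + ?dn h * inverse ?D - lam h)"
        unfolding dnc unfolding qb_scale_left[of A c h e] lam(4)[of c h] by (rule alg)
      then show ?thesis by (simp only: vec.scale_right_distrib vec.scale_scale)
    qed
    ultimately show "\<exists>f'. (\<psi> has_derivative f') (at w) \<and> (\<forall>c w. f' (c *s w) = c *s f' w)" by blast
  qed
  have "holomorphic_map_on U (inv_into U \<phi>)" unfolding holomorphic_map_on_def
  proof
    fix w assume w: "w \<in> U"
    obtain f' where d: "(\<psi> has_derivative f') (at w)" and f': "\<forall>c w. f' (c *s w) = c *s f' w"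
      using hol\<psi> w unfolding holomorphic_map_on_def by blast
    have "(inv_into U \<phi> has_derivative f') (at w)"
      by (rule has_derivative_transform_within_open[OF d openU w]) (simp add: inv)
    then show "\<exists>f'. (inv_into U \<phi> has_derivative f') (at w) \<and> (\<forall>c w. f' (c *s w) = c *s f' w)" using f' by blast
  qed
  then have "biholomorphic U U \<phi>"
    unfolding biholomorphic_def using openU hol\<phi> inj img by (simp add: bij_betw_def)
  moreover have "complex_subspace {z. lam z = 0}" unfolding complex_subspace_def
    using linear_subspace_kernel[OF bounded_linear.linear[OF linlam]] by (simp add: lam)
  moreover have "\<phi> ` ({z. z \<noteq> 0 \<and> qb A z z = 0} \<inter> U) = U \<inter> {z. lam z = 0}"
  proof -
    have l: "lam (\<phi> z) = ?q z" for z by (simp add: \<phi>_def lam)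
    have nz: "z \<noteq> 0" if "z \<in> U" for z using that by (auto simp: U_def qb.zero_left)
    show ?thesis
    proof (intro equalityI subsetI)
      fix w assume "w \<in> U \<inter> {z. lam z = 0}"
      then have "\<phi> (\<psi> w) = w" "\<psi> w \<in> U" "lam (\<phi> (\<psi> w)) = 0" using \<phi>\<psi> \<psi>U by auto
      then show "w \<in> \<phi> ` ({z. z \<noteq> 0 \<and> qb A z z = 0} \<inter> U)" unfolding l using nz by (intro image_eqI[of _ _ "\<psi> w"]) auto
    qed (auto simp: l \<phi>U)
  qed
  moreover have "p \<in> U" using pe by (simp add: U_def)
  ultimately show "\<exists>U V \<phi> L. p \<in> U \<and> biholomorphic U V \<phi> \<and> complex_subspace L \<and> \<phi> ` ({z. z \<noteq> 0 \<and> qb A z z = 0} \<inter> U) = V \<inter> L" by blast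
qed

lemma (in point_free_quadric) hol_section_sec: "hol_section sec"
  unfolding hol_section_def complex_submanifold_CP_def sec_image union_quad
  using sec sec_smooth complex_submanifold_quadric_cone[OF sym det] by (auto simp: quad_def CP_def)

lemma hol_section_exists:
  fixes Q :: "(complex^'n) set set"
  assumes "smooth_quadric Q" "Q \<inter> RP = {}" "CARD('n) \<ge> 3"
  shows "\<exists>\<sigma>. hol_section \<sigma> \<and> \<sigma> ` Gr2 = Q"
proof -
  obtain A :: "complex^'n^'n" where A: "transpose A = A" "det A \<noteq> 0" "Q = {proj_point z | z. z \<noteq> 0 \<and> qb A z z = 0}"
    using assms(1) unfolding smooth_quadric_def qb_def by blast
  interpret point_free_quadric A
  proof
    fix x :: "real^'n" assume x: "x \<noteq> 0"
    show "qb A (cvec_of_real x) (cvec_of_real x) \<noteq> 0"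
    proof
      assume "qb A (cvec_of_real x) (cvec_of_real x) = 0"
      then have "proj_point (1 *s cvec_of_real x) \<in> Q" unfolding A(3) using x by auto
      moreover have "proj_point (1 *s cvec_of_real x) \<in> RP" unfolding RP_def using x one_neq_zero by blast
      ultimately show False using assms(2) by blast
    qed
  qed (use A assms in auto)
  show ?thesis using hol_section_sec sec_image unfolding A(3) quad_def by blast
qed

lemma hol_section_determined_by_image:
  assumes "hol_section \<sigma>" "hol_section \<tau>" "\<tau> ` Gr2 = \<sigma> ` Gr2" "P \<in> Gr2"
  shows "\<tau> P = \<sigma> P"
proof -
  obtain P' where P': "P' \<in> Gr2" "\<tau> P = \<sigma> P'" using assms by blast
  then have "P = P'" using assms unfolding hol_section_def by metis
  then show ?thesis using P' by simp
qed

section \<open>The Burgers equation of a section\<close>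

lemma has_vector_derivative_quotient:
  assumes "(f has_vector_derivative d) (at (0::real))"
  shows "((\<lambda>r. (f r - f 0) /\<^sub>R r) \<longlongrightarrow> d) (at 0)"
proof -
  have "((\<lambda>r. norm (f r - f 0 - r *\<^sub>R d) / norm r) \<longlongrightarrow> 0) (at 0)"
    using assms unfolding has_vector_derivative_def has_derivative_iff_norm by simp
  moreover have "\<forall>\<^sub>F r in at 0. norm (f r - f 0 - r *\<^sub>R d) / norm r = norm ((f r - f 0) /\<^sub>R r - d)"
  proof -
    have "norm (f r - f 0 - r *\<^sub>R d) / norm r = norm ((f r - f 0) /\<^sub>R r - d)" if "r \<noteq> 0" for r
    proof -
      have "(f r - f 0) /\<^sub>R r - d = (f r - f 0 - r *\<^sub>R d) /\<^sub>R r" using that by (simp add: scaleR_diff_right)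
      then show ?thesis by (simp add: divide_inverse_commute)
    qed
    then show ?thesis by (auto simp: eventually_at_filter)
  qed
  ultimately have "((\<lambda>r. norm ((f r - f 0) /\<^sub>R r - d)) \<longlongrightarrow> 0) (at 0)" using tendsto_cong by fast
  then show ?thesis using Lim_null tendsto_norm_zero_iff by blast
qed

text \<open>\<open>E\<close> is the preimage of the model subspace \<open>L\<close> under the
  derivative of a chart. Velocities of curves in \<open>M\<close> land in \<open>L\<close> because
  \<open>L\<close> is closed, and \<open>E\<close> is proper unless \<open>M\<close> contains a
  neighbourhood of \<open>p\<close>.\<close>

lemma tangent_space:
  fixes M :: "(complex^'n) set"
  assumes "complex_submanifold M" "p \<in> M" and ni: "\<forall>U. open U \<longrightarrow> p \<in> U \<longrightarrow> \<not> U \<subseteq> M"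
  shows "\<exists>E. (\<forall>x\<in>E. \<forall>y\<in>E. x + y \<in> E) \<and> (\<forall>c. \<forall>x\<in>E. c *s x \<in> E) \<and> E \<noteq> UNIV \<and>
    (\<forall>\<gamma> d. \<gamma> 0 = p \<longrightarrow> (\<forall>\<^sub>F r in at 0. \<gamma> r \<in> M) \<longrightarrow> (\<gamma> has_vector_derivative d) (at (0::real)) \<longrightarrow> d \<in> E)"
proof -
  obtain U V \<phi> L where pU: "p \<in> U" and bi: "biholomorphic U V \<phi>" and L: "complex_subspace L"
    and im: "\<phi> ` (M \<inter> U) = V \<inter> L"
    using assms(1,2) unfolding complex_submanifold_def by blast
  have oU: "open U" and oV: "open V" and bij: "bij_betw \<phi> U V" using bi unfolding biholomorphic_def by auto
  obtain f' where f': "(\<phi> has_derivative f') (at p)" "\<And>c w. f' (c *s w) = c *s f' w"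
    using bi pU unfolding biholomorphic_def holomorphic_map_on_def by blast
  have pV: "\<phi> p \<in> V" using bij pU by (auto simp: bij_betw_def)
  obtain g' where g': "(inv_into U \<phi> has_derivative g') (at (\<phi> p))"
    using bi pV unfolding biholomorphic_def holomorphic_map_on_def by blast
  have lin: "linear f'" using f'(1) has_derivative_bounded_linear bounded_linear.linear by blast
  \<comment> \<open>The chain rule for the chart followed by its inverse makes the derivative of the
    chart injective, hence bijective in finite dimension.\<close>
  have "((\<lambda>x. x) has_derivative (\<lambda>h. g' (f' h))) (at p)"
    by (rule has_derivative_transform_within_open[OF has_derivative_compose[OF f'(1) g'] oU pU])
      (use bij in \<open>simp add: bij_betw_def\<close>)
  then have "(\<lambda>h. g' (f' h)) = (\<lambda>h. h)" by (rule has_derivative_unique) (rule has_derivative_ident)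
  then have inj: "inj f'" by (metis injI)
  then have surj: "surj f'" using lin linear_injective_imp_surjective by blast
  define E where "E = {x. f' x \<in> L}"
  have subL: "subspace L" using L unfolding complex_subspace_def by blast
  show ?thesis
  proof (intro exI[of _ E] conjI ballI allI impI)
    show "x + y \<in> E" if "x \<in> E" "y \<in> E" for x y
      using that lin subL by (simp add: E_def linear_add subspace_add)
    show "c *s x \<in> E" if "x \<in> E" for c x
      using that f'(2) L by (simp add: E_def complex_subspace_def)
    show "E \<noteq> UNIV"
    proof
      \<comment> \<open>Surjectivity of the derivative then forces \<open>L\<close> to be
        everything, and the whole chart domain lies in \<open>M\<close>.\<close>
      assume "E = UNIV"
      then have "L = UNIV" using surj unfolding E_def by (metis UNIV_eq_I UNIV_I mem_Collect_eq surjD)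
      then have "\<phi> ` (M \<inter> U) = \<phi> ` U" using im bij by (simp add: bij_betw_def)
      then have "M \<inter> U = U" using bij inj_on_image_eq_iff[of \<phi> U "M \<inter> U" U] by (simp add: bij_betw_def)
      then show False using ni oU pU by blast
    qed
    fix \<gamma> :: "real \<Rightarrow> complex^'n" and d
    assume \<gamma>: "\<gamma> 0 = p" "\<forall>\<^sub>F r in at 0. \<gamma> r \<in> M" "(\<gamma> has_vector_derivative d) (at 0)"
    have "isCont \<gamma> 0" using \<gamma>(3) has_vector_derivative_continuous by blast
    then have "\<forall>\<^sub>F r in at 0. \<gamma> r \<in> U"
      using oU pU \<gamma>(1) by (simp add: isCont_def topological_tendstoD)
    with \<gamma>(2) have ev: "\<forall>\<^sub>F r in at 0. \<phi> (\<gamma> r) \<in> L" by eventually_elim (use im in blast)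
    have pL: "\<phi> p \<in> L" using im assms(2) pU by blast
    have "((\<lambda>r. \<phi> (\<gamma> r)) has_derivative (\<lambda>h. f' (h *\<^sub>R d))) (at 0)"
      using has_derivative_compose[OF \<gamma>(3)[unfolded has_vector_derivative_def], of \<phi> f'] f'(1) \<gamma>(1) by simp
    then have "((\<lambda>r. \<phi> (\<gamma> r)) has_vector_derivative f' d) (at 0)"
      unfolding has_vector_derivative_def by (simp add: linear_scale[OF lin])
    from has_vector_derivative_quotient[OF this]
    have "((\<lambda>r. (\<phi> (\<gamma> r) - \<phi> p) /\<^sub>R r) \<longlongrightarrow> f' d) (at 0)" using \<gamma>(1) by simp
    moreover have "\<forall>\<^sub>F r in at 0. (\<phi> (\<gamma> r) - \<phi> p) /\<^sub>R r \<in> L"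
      using ev by eventually_elim (use subL pL in \<open>simp add: subspace_diff subspace_scale\<close>)
    ultimately have "f' d \<in> L"
      using Lim_in_closed_set[OF closed_subspace[OF subL] _ trivial_limit_at] by fast
    then show "d \<in> E" by (simp add: E_def)
  qed
qed

lemma smooth_on_cong:
  assumes "smooth_on W f" "\<And>x. x \<in> W \<Longrightarrow> f x = h x" shows "smooth_on W h"
proof -
  obtain g where W: "open W" and g: "\<forall>x\<in>W. g [] x = f x" and
    r: "\<forall>vs. continuous_on W (g vs)"
      "\<forall>vs v x. x \<in> W \<longrightarrow> ((\<lambda>t. g vs (x + t *\<^sub>R v)) has_vector_derivative g (v # vs) x) (at 0)"
    using assms(1) unfolding smooth_on_def by (elim exE conjE)
  have "\<forall>x\<in>W. g [] x = h x" using g assms(2) by simp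
  then show ?thesis unfolding smooth_on_def using W r by (intro conjI exI[of _ g]) auto
qed

lemma smooth_on_subset:
  assumes "smooth_on W f" "open W'" "W' \<subseteq> W" shows "smooth_on W' f"
proof -
  obtain g where g: "\<forall>x\<in>W. g [] x = f x" "\<forall>vs. continuous_on W (g vs)"
    "\<forall>vs v x. x \<in> W \<longrightarrow> ((\<lambda>t. g vs (x + t *\<^sub>R v)) has_vector_derivative g (v # vs) x) (at 0)"
    using assms(1) unfolding smooth_on_def by (elim exE conjE)
  have "\<forall>vs. continuous_on W' (g vs)" using g(2) assms(3) continuous_on_subset by blast
  then show ?thesis unfolding smooth_on_def using g assms by (intro conjI exI[of _ g]) auto
qed

text \<open>Dual vectors turn the coordinates on a plane into inner products, which stay defined for
  nearby planes.\<close>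

lemma indep2_dual:
  assumes "indep2 u v"
  obtains p q where "u \<bullet> p = 1" "v \<bullet> p = 0" "u \<bullet> q = 0" "v \<bullet> q = 1"
proof -
  have dual: "\<exists>p. u \<bullet> p = 1 \<and> v \<bullet> p = 0" if "indep2 u v" for u v :: "real^'n"
  proof -
    define w where "w = (v \<bullet> v) *\<^sub>R u + (- (u \<bullet> v)) *\<^sub>R v"
    have "w \<noteq> 0" using indep2D[OF that, of "v \<bullet> v" "- (u \<bullet> v)"] indep2_nz[OF that] unfolding w_def by fastforce
    moreover have "v \<bullet> w = 0" by (simp add: w_def inner_diff_right inner_commute algebra_simps)
    moreover have "w \<bullet> w = (v \<bullet> v) * (u \<bullet> w)" using \<open>v \<bullet> w = 0\<close>
      by (subst (1) w_def) (simp add: inner_diff_left)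
    ultimately have "u \<bullet> w \<noteq> 0" by (metis inner_eq_zero_iff mult_zero_right)
    then show ?thesis using \<open>v \<bullet> w = 0\<close> by (intro exI[of _ "w /\<^sub>R (u \<bullet> w)"]) simp
  qed
  have "indep2 v u" using assms unfolding indep2_def by (metis add.commute)
  then show ?thesis using dual[OF assms] dual[of v u] that by blast
qed

text \<open>The complex-linear extension of the inner product with \<open>p\<close>, without
  conjugation.\<close>

definition cdot :: "complex^'n \<Rightarrow> real^'n \<Rightarrow> complex" where
  "cdot z p = (\<Sum>i\<in>UNIV. z $ i * complex_of_real (p $ i))"

lemma cdot_simps: "cdot (x + y) p = cdot x p + cdot y p" "cdot (c *s x) p = c * cdot x p"
  "cdot (cvec_of_real w) p = complex_of_real (w \<bullet> p)"
  by (simp_all add: cdot_def algebra_simps sum.distrib sum_distrib_left inner_vec_def)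

section \<open>The half-plane coordinate tau of a section and its differential equation\<close>

locale holomorphic_section =
  fixes \<sigma> :: "((real^'n) \<times> (real^'n)) set \<Rightarrow> (complex^'n) set"
  assumes hol_section: "hol_section \<sigma>"
begin

definition "M = \<Union>(\<sigma> ` Gr2)"

lemma section_point: "P \<in> Gr2 \<Longrightarrow> \<sigma> P \<in> CP - RP \<and> rho0 (\<sigma> P) = P"
  using hol_section unfolding hol_section_def by blast

lemma in_M_iff: "z \<noteq> 0 \<Longrightarrow> z \<in> M \<longleftrightarrow> proj_point z \<in> \<sigma> ` Gr2"
proof
  assume "z \<in> M"
  then obtain P where P: "P \<in> Gr2" "z \<in> \<sigma> P" unfolding M_def by blast
  then obtain w where "\<sigma> P = proj_point w" using section_point[OF P(1)] unfolding CP_def by blast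
  then have "\<sigma> P = proj_point z" using P(2) by (metis in_proj_point proj_point_scale)
  then show "proj_point z \<in> \<sigma> ` Gr2" using P(1) by blast
next
  assume "proj_point z \<in> \<sigma> ` Gr2"
  then show "z \<in> M" unfolding M_def using proj_point_self by blast
qed

lemma M_scale: "z \<in> M \<Longrightarrow> c \<noteq> 0 \<Longrightarrow> c *s z \<in> M"
proof -
  assume z: "z \<in> M" and c: "c \<noteq> 0"
  then obtain P where P: "P \<in> Gr2" "z \<in> \<sigma> P" unfolding M_def by blast
  then obtain w where "\<sigma> P = proj_point w" using section_point[OF P(1)] unfolding CP_def by blast
  then have "c *s z \<in> \<sigma> P" using P(2) c by (auto simp: in_proj_point intro: exI[of _ "c * d" for d])
  then show "c *s z \<in> M" unfolding M_def using P(1) by blast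
qed

definition "tau u v = (SOME t. Im t > 0 \<and> \<sigma> (oplane u v) = proj_point (cvec_of_real u + t *s cvec_of_real v))"

lemma tau: 
  assumes "indep2 u v"
  shows "Im (tau u v) > 0" "\<sigma> (oplane u v) = proj_point (cvec_of_real u + tau u v *s cvec_of_real v)"
    "cvec_of_real u + tau u v *s cvec_of_real v \<in> M"
proof -
  have "\<exists>t. Im t > 0 \<and> \<sigma> (oplane u v) = proj_point (cvec_of_real u + t *s cvec_of_real v)"
    using section_point[OF oplane_in_Gr2[OF assms]] point_above_plane[OF assms] by metis
  from someI_ex[OF this] show 1: "Im (tau u v) > 0" "\<sigma> (oplane u v) = proj_point (cvec_of_real u + tau u v *s cvec_of_real v)"
    unfolding tau_def by auto
  show "cvec_of_real u + tau u v *s cvec_of_real v \<in> M"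
    unfolding M_def using oplane_in_Gr2[OF assms] 1(2) proj_point_self by blast
qed

lemma tau_unique:
  assumes "indep2 u v" "Im t > 0" "cvec_of_real u + t *s cvec_of_real v \<in> M"
  shows "t = tau u v"
proof -
  let ?p = "proj_point (cvec_of_real u + t *s cvec_of_real v)"
  have "?p \<in> \<sigma> ` Gr2" using in_M_iff[OF above_plane_point(1)[OF assms(1,2)]] assms(3) by blast
  then obtain P where P: "P \<in> Gr2" "?p = \<sigma> P" by blast
  then have "P = oplane u v" using section_point above_plane_point(3)[OF assms(1,2)] by metis
  then show ?thesis using P(2) tau(2)[OF assms(1)] proj_point_affine_eq[OF assms(1)] by metis
qed

text \<open>Both bases describe one point of the image, so the two values of \<open>tau\<close> are
  related by a Moebius transformation, here cleared of denominators.\<close>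

lemma tau_base:
  assumes "indep2 u v" "a * d - b * c > 0"
  defines "t \<equiv> tau (a *\<^sub>R u + b *\<^sub>R v) (c *\<^sub>R u + d *\<^sub>R v)"
  shows "(of_real a + t * of_real c) * tau u v = of_real b + t * of_real d"
proof -
  let ?u = "a *\<^sub>R u + b *\<^sub>R v" and ?v = "c *\<^sub>R u + d *\<^sub>R v"
  have i: "indep2 ?u ?v" using indep2_combine assms by (metis less_irrefl)
  have "proj_point (cvec_of_real u + tau u v *s cvec_of_real v) = proj_point (cvec_of_real ?u + t *s cvec_of_real ?v)"
    using tau(2)[OF i] tau(2)[OF assms(1)] oplane_combine[OF assms(2), of u v] unfolding t_def by simp
  then obtain k where k: "cvec_of_real ?u + t *s cvec_of_real ?v = k *s (cvec_of_real u + tau u v *s cvec_of_real v)"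
    using proj_point_eq_iff by metis
  have "(of_real a + t * of_real c) *s cvec_of_real u + (of_real b + t * of_real d) *s cvec_of_real v
      = k *s cvec_of_real u + (k * tau u v) *s cvec_of_real v"
    using k by (simp add: cv_add cv_scaleR vec.scale_right_distrib vec.scale_left_distrib algebra_simps)
  from indep2_complex_eq[OF assms(1) this] show ?thesis by simp
qed

lemma tau_smooth:
  assumes "indep2 u v"
  obtains W where "open W" "(u, v) \<in> W" "W \<subseteq> {(u, v). indep2 u v}" "smooth_on W (\<lambda>x. tau (fst x) (snd x))"
proof -
  have "smooth_on_Gr2 \<sigma>" using hol_section unfolding hol_section_def by blast
  have uv: "(u, v) \<in> {(u, v). indep2 u v}" using assms by simp
  from bspec[OF \<open>smooth_on_Gr2 \<sigma>\<close>[unfolded smooth_on_Gr2_def smooth_map_CP_def] uv] obtain W' s where W': "open W'" "(u, v) \<in> W'" "W' \<subseteq> {(u, v). indep2 u v}" "smooth_on W' s"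
    and s': "\<forall>y\<in>W'. s y \<noteq> 0 \<and> (case y of (u, v) \<Rightarrow> \<sigma> (oplane u v)) = proj_point (s y)"
    by (elim exE conjE)
  have s: "s y \<noteq> 0 \<and> \<sigma> (oplane (fst y) (snd y)) = proj_point (s y)" if "y \<in> W'" for y
    using s' that by (simp add: case_prod_beta)
  obtain p q where pq: "u \<bullet> p = 1" "v \<bullet> p = 0" "u \<bullet> q = 0" "v \<bullet> q = 1" using indep2_dual[OF assms] by metis
  define D where "D y = (fst y \<bullet> p) * (snd y \<bullet> q) - (fst y \<bullet> q) * (snd y \<bullet> p)" for y
  define W where "W = W' \<inter> {y. D y \<noteq> 0}"
  have W: "open W" unfolding W_def D_def by (intro open_Int W' open_Collect_neq continuous_intros)
  \<comment> \<open>Cramer's rule: a local lift is \<open>s y = c *s (u + tau *s v)\<close> with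
    unknown \<open>c\<close>, and pairing with \<open>p\<close> and \<open>q\<close> yields two
    linear equations. Numerator and denominator both carry the factor \<open>c * D\<close>, which
    cancels.\<close>
  define den where "den y = cdot (s y) p * of_real (snd y \<bullet> q) + -1 * (cdot (s y) q * of_real (snd y \<bullet> p))" for y
  define num where "num y = cdot (s y) q * of_real (fst y \<bullet> p) + -1 * (cdot (s y) p * of_real (fst y \<bullet> q))" for y
  have key: "den y \<noteq> 0 \<and> num y * inverse (den y) = tau (fst y) (snd y)" if y: "y \<in> W" for y
  proof -
    let ?t = "tau (fst y) (snd y)"
    have i: "indep2 (fst y) (snd y)" using y W'(3) by (auto simp: W_def)
    then obtain c where c: "c \<noteq> 0" "s y = c *s (cvec_of_real (fst y) + ?t *s cvec_of_real (snd y))"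
      using s[of y] y tau(2)[OF i] proj_point_eq_iff unfolding W_def by (metis Int_iff)
    have "den y = c * of_real (D y)" unfolding den_def c(2) D_def
      by (simp add: cdot_simps algebra_simps)
    moreover have "num y = c * ?t * of_real (D y)" unfolding num_def c(2) D_def
      by (simp add: cdot_simps algebra_simps)
    ultimately show ?thesis using c y by (simp add: W_def field_simps)
  qed
  have cs: "(\<lambda>y. cdot (s y) r) \<in> smooth_algebra W" for r unfolding cdot_def
    by (intro smooth_algebra_sum smooth_algebra.mult smooth_algebra_const W finite smooth_algebra.base smooth_on_vec_nth
        smooth_on_subset[OF W'(4)]) (simp_all add: W_def)
  have ip: "(\<lambda>y. complex_of_real (fst y \<bullet> r)) \<in> smooth_algebra W" "(\<lambda>y. complex_of_real (snd y \<bullet> r)) \<in> smooth_algebra W" for r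
    by (intro smooth_algebra.base smooth_on_linear W bounded_linear_compose[OF bounded_linear_of_real]
      bounded_linear_compose[OF bounded_linear_inner_left] bounded_linear_fst bounded_linear_snd)+
  have "(\<lambda>y. num y * inverse (den y)) \<in> smooth_algebra W"
  proof (intro smooth_algebra.mult smooth_algebra.inverse)
    show "num \<in> smooth_algebra W" "den \<in> smooth_algebra W" unfolding num_def[abs_def] den_def[abs_def]
      by (intro smooth_algebra.add smooth_algebra.mult smooth_algebra_const cs ip W)+
  qed (use key in auto)
  then have "smooth_on W (\<lambda>y. num y * inverse (den y))" using smooth_on_algebra W by blast
  then have "smooth_on W (\<lambda>y. tau (fst y) (snd y))"
    by (rule smooth_on_cong) (use key in auto)
  moreover have "(u, v) \<in> W" using W'(2) pq by (simp add: W_def D_def)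
  moreover have "W \<subseteq> {(u, v). indep2 u v}" using W'(3) by (auto simp: W_def)
  ultimately show ?thesis using that W by blast
qed

lemma isCont_tau:
  assumes "indep2 u v" shows "isCont (\<lambda>x. tau (fst x) (snd x)) (u, v)"
proof -
  obtain W where W: "open W" "(u, v) \<in> W" "smooth_on W (\<lambda>x. tau (fst x) (snd x))"
    by (rule tau_smooth[OF assms])
  show ?thesis using smooth_on_continuous[OF W(3)] W(1,2) by (simp add: continuous_on_eq_continuous_at)
qed

text \<open>Varying \<open>u\<close> and varying \<open>v\<close> in direction \<open>y\<close> give
  two tangent vectors of the cone. If the equation failed, a complex combination of them would put
  \<open>v\<close>, and then every vector, into the tangent space, which is proper.\<close>

lemma burgers:
  fixes u v y :: "real^'n" and p :: "real^'n \<Rightarrow> complex" and q :: complex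
  assumes uv: "indep2 u v"
    and p: "\<And>y. ((\<lambda>r. tau (u + r *\<^sub>R y) v) has_vector_derivative p y) (at 0)"
    and q: "((\<lambda>r. tau u (v + r *\<^sub>R y)) has_vector_derivative q) (at 0)"
  shows "q = tau u v * p y"
proof (rule ccontr)
  assume ne: "q \<noteq> tau u v * p y"
  let ?t = "tau u v"
  let ?w = "cvec_of_real u + ?t *s cvec_of_real v"
  have c1: "complex_submanifold M" using hol_section unfolding hol_section_def complex_submanifold_CP_def M_def by blast
  have c2: "?w \<in> M" by (rule tau(3)[OF uv])
  \<comment> \<open>The cone has no interior at this point: on the line in direction
    \<open>v\<close>, \<open>tau_unique\<close> admits only one point of the upper half
    plane.\<close>
  have c3: "\<not> U \<subseteq> M" if U: "open U" "?w \<in> U" for U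
  proof
    assume sub: "U \<subseteq> M"
    have "((\<lambda>r. ?w + complex_of_real r *s cvec_of_real v) \<longlongrightarrow> ?w) (at 0)"
      by (rule vec_tendstoI) (auto intro!: tendsto_eq_intros)
    then have "\<forall>\<^sub>F r in at 0. ?w + complex_of_real r *s cvec_of_real v \<in> U" using U by (simp add: topological_tendstoD)
    moreover have "\<forall>\<^sub>F r in at (0::real). r \<noteq> 0" by (simp add: eventually_at_filter)
    ultimately have "\<forall>\<^sub>F r in at (0::real). False"
    proof eventually_elim
      case (elim r)
      then have "cvec_of_real u + (?t + of_real r) *s cvec_of_real v \<in> M" using sub by (auto simp: vec.scale_left_distrib add.assoc)
      then have "?t + of_real r = ?t" using tau_unique[OF uv, of "?t + of_real r"] tau(1)[OF uv] by simp
      then show ?case using elim by simp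
    qed
    then show False by (simp add: trivial_limit_at)
  qed
  have "\<forall>U. open U \<longrightarrow> ?w \<in> U \<longrightarrow> \<not> U \<subseteq> M" using c3 by blast
  from tangent_space[OF c1 c2 this] obtain E where E0: "\<forall>x\<in>E. \<forall>y\<in>E. x + y \<in> E" "\<forall>c. \<forall>x\<in>E. c *s x \<in> E" "E \<noteq> UNIV"
    "\<forall>\<gamma> d. \<gamma> 0 = ?w \<longrightarrow> (\<forall>\<^sub>F r in at 0. \<gamma> r \<in> M) \<longrightarrow> (\<gamma> has_vector_derivative d) (at (0::real)) \<longrightarrow> d \<in> E"
    by (elim exE conjE)
  have E: "\<And>x y. x \<in> E \<Longrightarrow> y \<in> E \<Longrightarrow> x + y \<in> E" "\<And>c x. x \<in> E \<Longrightarrow> c *s x \<in> E" "E \<noteq> UNIV"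
    "\<And>\<gamma> d. \<gamma> 0 = ?w \<Longrightarrow> \<forall>\<^sub>F r in at 0. \<gamma> r \<in> M \<Longrightarrow> (\<gamma> has_vector_derivative d) (at (0::real)) \<Longrightarrow> d \<in> E"
    using E0 by simp_all
  have ind: "\<forall>\<^sub>F r in at 0. indep2 (u + r *\<^sub>R y1) (v + r *\<^sub>R y2)" for y1 y2
  proof -
    have "isCont (\<lambda>r. (u + r *\<^sub>R y1, v + r *\<^sub>R y2)) 0" by (intro continuous_intros)
    then have "((\<lambda>r. (u + r *\<^sub>R y1, v + r *\<^sub>R y2)) \<longlongrightarrow> (u, v)) (at 0)" by (simp add: isCont_def)
    then have "\<forall>\<^sub>F r in at 0. (u + r *\<^sub>R y1, v + r *\<^sub>R y2) \<in> {(u, v). indep2 u v}"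
      using topological_tendstoD[OF _ open_indep2] uv by blast
    then show ?thesis by simp
  qed
  have wE: "?w \<in> E"
  proof (rule E(4)[of "\<lambda>r. (1 + of_real r) *s ?w"])
    have "\<forall>\<^sub>F r in at (0::real). r > -1" 
      using order_tendstoD(1)[of "\<lambda>r. r" 0 "at (0::real)" "-1"] by simp
    then show "\<forall>\<^sub>F r in at 0. (1 + complex_of_real r) *s ?w \<in> M"
    proof eventually_elim
      case (elim r)
      then have "1 + complex_of_real r \<noteq> 0" by (auto simp: complex_eq_iff)
      then show ?case by (rule M_scale[OF tau(3)[OF uv]])
    qed
    show "((\<lambda>r. (1 + complex_of_real r) *s ?w) has_vector_derivative ?w) (at 0)"
      by (intro has_vector_derivative_vecI) (auto intro!: derivative_eq_intros)
  qed simp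
  have pE: "cvec_of_real y + p y *s cvec_of_real v \<in> E" for y
  proof (rule E(4)[of "\<lambda>r. cvec_of_real (u + r *\<^sub>R y) + tau (u + r *\<^sub>R y) v *s cvec_of_real v"])
    show "\<forall>\<^sub>F r in at 0. cvec_of_real (u + r *\<^sub>R y) + tau (u + r *\<^sub>R y) v *s cvec_of_real v \<in> M"
      using ind[of y 0] by eventually_elim (use tau in simp)
    show "((\<lambda>r. cvec_of_real (u + r *\<^sub>R y) + tau (u + r *\<^sub>R y) v *s cvec_of_real v) has_vector_derivative cvec_of_real y + p y *s cvec_of_real v) (at 0)"
      by (intro has_vector_derivative_vecI) (auto intro!: derivative_eq_intros p)
  qed simp
  have qE: "?t *s cvec_of_real y + q *s cvec_of_real v \<in> E"
  proof (rule E(4)[of "\<lambda>r. cvec_of_real u + tau u (v + r *\<^sub>R y) *s cvec_of_real (v + r *\<^sub>R y)"])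
    show "\<forall>\<^sub>F r in at 0. cvec_of_real u + tau u (v + r *\<^sub>R y) *s cvec_of_real (v + r *\<^sub>R y) \<in> M"
      using ind[of 0 y] by eventually_elim (use tau in simp)
    show "((\<lambda>r. cvec_of_real u + tau u (v + r *\<^sub>R y) *s cvec_of_real (v + r *\<^sub>R y)) has_vector_derivative ?t *s cvec_of_real y + q *s cvec_of_real v) (at 0)"
      by (intro has_vector_derivative_vecI) (auto intro!: derivative_eq_intros q)
  qed simp
  \<comment> \<open>The vector \<open>y\<close> cancels when \<open>?t\<close> times the first
    tangent vector is subtracted from the second, leaving a multiple of \<open>v\<close>; this is
    where complex linearity of the tangent space enters.\<close>
  have "(q - ?t * p y) *s cvec_of_real v = (?t *s cvec_of_real y + q *s cvec_of_real v) + (- ?t) *s (cvec_of_real y + p y *s cvec_of_real v)"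
    by (simp add: vec_eq_iff algebra_simps)
  then have "(q - ?t * p y) *s cvec_of_real v \<in> E" by (simp only: E(1)[OF qE E(2)[OF pE]])
  moreover define k where "k = q - ?t * p y"
  ultimately have "k *s cvec_of_real v \<in> E" by (simp only:)
  then have kE: "inverse k *s (k *s cvec_of_real v) \<in> E" by (rule E(2))
  have "k \<noteq> 0" using ne k_def by simp
  then have vE: "cvec_of_real v \<in> E" using kE by simp
  have yE: "cvec_of_real y \<in> E" for y
  proof -
    have "cvec_of_real y = (cvec_of_real y + p y *s cvec_of_real v) + (- p y) *s cvec_of_real v" by simp
    then show ?thesis using E(1)[OF pE E(2)[OF vE]] by metis
  qed
  have "z \<in> E" for z using E(1)[OF yE E(2)[OF yE]] cvec_decompose by metis
  then show False using E(3) by blast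
qed

end

context holomorphic_section
begin

text \<open>The two partial derivatives are continuous, which gives a total derivative;
  \<open>burgers\<close> replaces the second by \<open>tau\<close> times the first, so a single
  function \<open>p\<close> describes it.\<close>

lemma local_tau:
  fixes u v y :: "real^'n"
  assumes uv: "indep2 u v"
  defines "t \<equiv> \<lambda>\<zeta>. tau (u + Re \<zeta> *\<^sub>R y) (v + Im \<zeta> *\<^sub>R y)"
  shows "\<exists>U p. open U \<and> 0 \<in> U \<and> continuous_on U p \<and> (\<forall>\<zeta>\<in>U. indep2 (u + Re \<zeta> *\<^sub>R y) (v + Im \<zeta> *\<^sub>R y)) \<and>
     (\<forall>\<zeta>\<in>U. (t has_derivative (\<lambda>h. p \<zeta> * (of_real (Re h) + t \<zeta> * of_real (Im h)))) (at \<zeta>))"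
proof -
  obtain W where W: "open W" "(u, v) \<in> W" "W \<subseteq> {(u, v). indep2 u v}" "smooth_on W (\<lambda>x. tau (fst x) (snd x))"
    by (rule tau_smooth[OF uv])
  let ?F = "\<lambda>x. tau (fst x) (snd x)"
  obtain f1 where f1: "\<And>x. x \<in> W \<Longrightarrow> ((\<lambda>r. ?F (x + r *\<^sub>R (y, 0))) has_vector_derivative f1 x) (at 0)" "smooth_on W f1"
    by (rule smooth_on_derivative[OF W(4), of "(y, 0)"]) auto
  obtain f2 where f2: "\<And>x. x \<in> W \<Longrightarrow> ((\<lambda>r. ?F (x + r *\<^sub>R (0, y))) has_vector_derivative f2 x) (at 0)" "smooth_on W f2"
    by (rule smooth_on_derivative[OF W(4), of "(0, y)"]) auto
  have f12: "f2 x = ?F x * f1 x" if x: "x \<in> W" for x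
  proof -
    have i: "indep2 (fst x) (snd x)" using W(3) x by auto
    have d: "((\<lambda>r. tau (fst x + r *\<^sub>R y') (snd x)) has_vector_derivative vector_derivative (\<lambda>r. tau (fst x + r *\<^sub>R y') (snd x)) (at 0)) (at 0)" for y'
    proof -
      obtain f where f: "\<And>x. x \<in> W \<Longrightarrow> ((\<lambda>r. ?F (x + r *\<^sub>R (y', 0))) has_vector_derivative f x) (at 0)"
        by (rule smooth_on_derivative[OF W(4), of "(y', 0)"]) auto
      from f[OF x] have "((\<lambda>r. tau (fst x + r *\<^sub>R y') (snd x)) has_vector_derivative f x) (at 0)" by simp
      then show ?thesis using vector_derivative_at by fastforce
    qed
    have q: "((\<lambda>r. tau (fst x) (snd x + r *\<^sub>R y)) has_vector_derivative f2 x) (at 0)" using f2(1)[OF x] by simp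
    have "f2 x = ?F x * vector_derivative (\<lambda>r. tau (fst x + r *\<^sub>R y) (snd x)) (at 0)"
      by (rule burgers[OF i d q])
    also have "vector_derivative (\<lambda>r. tau (fst x + r *\<^sub>R y) (snd x)) (at 0) = f1 x"
      using f1(1)[OF x] by (intro vector_derivative_at) simp
    finally show ?thesis .
  qed
  define K where "K a b = (u + a *\<^sub>R y, v + b *\<^sub>R y)" for a b
  have contK: "continuous_on X (\<lambda>(a, b). K a b)" for X
    unfolding K_def case_prod_beta by (intro continuous_intros)
  define O2 where "O2 = (\<lambda>(a, b). K a b) -` W"
  have O2: "open O2" unfolding O2_def using W(1) contK by (metis open_vimage)
  define U where "U = (\<lambda>\<zeta>. (Re \<zeta>, Im \<zeta>)) -` O2"
  have U: "open U" unfolding U_def by (intro open_vimage O2 continuous_intros)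
  have inU: "\<zeta> \<in> U \<longleftrightarrow> K (Re \<zeta>) (Im \<zeta>) \<in> W" for \<zeta> by (simp add: U_def O2_def)
  define T where "T a b = ?F (K a b)" for a b
  have shift: "((\<lambda>x. f (x - a)) has_vector_derivative d) (at a)" if "(f has_vector_derivative d) (at 0)" for f :: "real \<Rightarrow> complex" and d a
  proof -
    have "((\<lambda>x. x - a) has_vector_derivative 1) (at a)"
      unfolding has_vector_derivative_def by (auto intro!: derivative_eq_intros)
    from vector_diff_chain_at[OF this, of f d] show ?thesis using that by (simp add: o_def)
  qed
  have part1: "((\<lambda>a. T a b) has_vector_derivative f1 (K a b)) (at a)" if "K a b \<in> W" for a b
  proof -
    have "((\<lambda>x. ?F (K a b + (x - a) *\<^sub>R (y, 0))) has_vector_derivative f1 (K a b)) (at a)"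
      by (rule shift[OF f1(1)[OF that]])
    also have "(\<lambda>x. ?F (K a b + (x - a) *\<^sub>R (y, 0))) = (\<lambda>x. T x b)"
      unfolding T_def K_def by (simp add: scaleR_diff_left)
    finally show ?thesis .
  qed
  have part2: "((\<lambda>b. T a b) has_vector_derivative f2 (K a b)) (at b)" if "K a b \<in> W" for a b
  proof -
    have "((\<lambda>x. ?F (K a b + (x - b) *\<^sub>R (0, y))) has_vector_derivative f2 (K a b)) (at b)"
      by (rule shift[OF f2(1)[OF that]])
    also have "(\<lambda>x. ?F (K a b + (x - b) *\<^sub>R (0, y))) = (\<lambda>x. T a x)"
      unfolding T_def K_def by (simp add: scaleR_diff_left)
    finally show ?thesis .
  qed
  have total: "((\<lambda>(a, b). T a b) has_derivative (\<lambda>(h, k). h *\<^sub>R f1 (K a b) + k *\<^sub>R f2 (K a b))) (at (a, b))"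
    if ab: "K a b \<in> W" for a b
  proof -
    have "(a, b) \<in> O2" using ab by (simp add: O2_def)
    from open_prod_elim[OF O2 this] obtain X Y where XY': "open X" "open Y" "(a, b) \<in> X \<times> Y" "X \<times> Y \<subseteq> O2" .
    then have XY: "open X" "open Y" "a \<in> X" "b \<in> Y" "X \<times> Y \<subseteq> O2" by auto
    obtain e where e: "e > 0" "ball b e \<subseteq> Y" using XY openE by blast
    have sub: "K a' b' \<in> W" if "a' \<in> X" "b' \<in> ball b e" for a' b'
    proof -
      have "(a', b') \<in> O2" using XY(5) e(2) that by blast
      then show ?thesis by (simp add: O2_def)
    qed
    have cont: "continuous (at (a, b) within X \<times> ball b e) (\<lambda>(x, y). blinfun_scaleR_left (f2 (K x y)))"
    proof -
      have "continuous_on O2 (\<lambda>p. f2 (case p of (a, b) \<Rightarrow> K a b))"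
        by (rule continuous_on_compose2[OF smooth_on_continuous[OF f2(2)] contK]) (auto simp: O2_def)
      then have "continuous_on O2 (\<lambda>p. blinfun_scaleR_left (f2 (case p of (a, b) \<Rightarrow> K a b)))"
        by (rule bounded_linear.continuous_on[OF bounded_linear_blinfun_scaleR_left])
      then have "continuous (at (a, b)) (\<lambda>p. blinfun_scaleR_left (f2 (case p of (a, b) \<Rightarrow> K a b)))"
        using O2 ab by (simp add: continuous_on_eq_continuous_at O2_def)
      then show ?thesis by (simp add: case_prod_beta' continuous_at_imp_continuous_at_within)
    qed
    have "((\<lambda>(x, y). T x y) has_derivative (\<lambda>(tx, ty). tx *\<^sub>R f1 (K a b) + blinfun_apply (blinfun_scaleR_left (f2 (K a b))) ty)) (at (a, b) within X \<times> ball b e)"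
    proof (rule has_derivative_partialsI)
      show "((\<lambda>x. T x b) has_derivative (\<lambda>tx. tx *\<^sub>R f1 (K a b))) (at a within X)"
        using part1[OF ab] unfolding has_vector_derivative_def by (rule has_derivative_at_withinI)
      show "((\<lambda>y. T x y) has_derivative blinfun_apply (blinfun_scaleR_left (f2 (K x y)))) (at y within ball b e)"
        if "x \<in> X" "y \<in> ball b e" for x y
        using part2[OF sub[OF that]] unfolding has_vector_derivative_def blinfun_scaleR_left.rep_eq
        by (rule has_derivative_at_withinI)
    qed (use cont e in auto)
    moreover have "at (a, b) within X \<times> ball b e = at (a, b)"
      using XY e by (intro at_within_open) (auto simp: open_Times)
    ultimately show ?thesis by (simp add: blinfun_scaleR_left.rep_eq)
  qed
  have "(t has_derivative (\<lambda>h. f1 (K (Re \<zeta>) (Im \<zeta>)) * (of_real (Re h) + t \<zeta> * of_real (Im h)))) (at \<zeta>)" if "\<zeta> \<in> U" for \<zeta>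
  proof -
    have KW: "K (Re \<zeta>) (Im \<zeta>) \<in> W" using that inU by blast
    have "((\<lambda>\<zeta>. (Re \<zeta>, Im \<zeta>)) has_derivative (\<lambda>h. (Re h, Im h))) (at \<zeta>)"
      by (intro has_derivative_Pair derivative_intros has_derivative_ident) 
    from has_derivative_compose[OF this total[OF KW]]
    have "((\<lambda>\<zeta>. T (Re \<zeta>) (Im \<zeta>)) has_derivative (\<lambda>h. Re h *\<^sub>R f1 (K (Re \<zeta>) (Im \<zeta>)) + Im h *\<^sub>R f2 (K (Re \<zeta>) (Im \<zeta>)))) (at \<zeta>)"
      by simp
    moreover have "T (Re z) (Im z) = t z" for z by (simp add: T_def K_def t_def)
    ultimately show ?thesis using f12[OF KW] by (simp add: scaleR_conv_of_real algebra_simps K_def t_def)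
  qed
  moreover have "continuous_on U (\<lambda>\<zeta>. f1 (K (Re \<zeta>) (Im \<zeta>)))"
  proof (rule continuous_on_compose2[OF smooth_on_continuous[OF f1(2)]])
    show "continuous_on U (\<lambda>\<zeta>. K (Re \<zeta>) (Im \<zeta>))" unfolding K_def by (intro continuous_intros)
  qed (use inU in auto)
  moreover have "0 \<in> U" using W(2) by (simp add: inU K_def)
  moreover have "\<forall>\<zeta>\<in>U. indep2 (u + Re \<zeta> *\<^sub>R y) (v + Im \<zeta> *\<^sub>R y)"
    using W(3) by (auto simp: inU K_def)
  ultimately show ?thesis using U by (intro exI[of _ U] exI[of _ "\<lambda>\<zeta>. f1 (K (Re \<zeta>) (Im \<zeta>))"]) blast
qed

end

text \<open>If t satisfies the inviscid Burgers equation, then t is a holomorphic function of the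
  characteristic coordinate Re z + t z * Im z.\<close>
lemma burgers_chart:
  fixes t p :: "complex \<Rightarrow> complex"
  assumes U: "open U" "0 \<in> U" and p: "continuous_on U p" and Im: "\<And>z. z \<in> U \<Longrightarrow> Im (t z) > 0"
    and der: "\<And>z. z \<in> U \<Longrightarrow> (t has_derivative (\<lambda>h. p z * (of_real (Re h) + t z * of_real (Im h)))) (at z)"
  defines "f \<equiv> \<lambda>z. of_real (Re z) + t z * of_real (Im z)"
  shows "\<exists>r T. r > (0::real) \<and> T holomorphic_on ball (0::complex) r \<and>
     (\<forall>\<rho>. 0 < \<rho> \<longrightarrow> \<rho> \<le> r \<longrightarrow> (\<exists>U'. open U' \<and> 0 \<in> U' \<and> U' \<subseteq> U \<and>
       (\<forall>z\<in>U'. f z \<in> ball 0 \<rho> \<and> T (f z) = t z) \<and> (\<forall>s\<in>ball (0::complex) \<rho>. \<exists>z\<in>U'. f z = s)))"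
proof -
  \<comment> \<open>The derivatives of \<open>f\<close> and \<open>t\<close> at \<open>z\<close> are
    \<open>J z\<close> and \<open>p z\<close> times the same real-linear map
    \<open>Re h + t z * Im h\<close>. Hence \<open>t\<close> as a function of \<open>f\<close> has
    the complex derivative \<open>p z / J z\<close>.\<close>
  define J where "J z = (1 + of_real (Im z) * p z)" for z
  have contt: "continuous_on U t"
    using der U by (meson continuous_at_imp_continuous_on has_derivative_continuous)
  have derf: "(f has_derivative (\<lambda>h. J z * (of_real (Re h) + t z * of_real (Im h)))) (at z)" if "z \<in> U" for z
    unfolding f_def J_def
    by (rule has_derivative_eq_rhs, (rule derivative_intros has_derivative_ident der[OF that])+)
      (auto simp: algebra_simps)
  define D where "D z = Blinfun (\<lambda>h. J z * (of_real (Re h) + t z * of_real (Im h)))" for z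
  have D: "blinfun_apply (D z) = (\<lambda>h. J z * (of_real (Re h) + t z * of_real (Im h)))" for z
    unfolding D_def by (rule bounded_linear_Blinfun_apply)
      (intro bounded_linear_mult_right[THEN bounded_linear_compose] bounded_linear_add bounded_linear_compose[OF bounded_linear_of_real] bounded_linear_Re bounded_linear_Im
        bounded_linear_compose[OF bounded_linear_mult_right])
  have contD: "continuous_on U D"
    by (rule continuous_on_blinfun_componentwise) (auto simp: D J_def intro!: continuous_intros p contt)
  \<comment> \<open>At 0 the factor \<open>J\<close> is 1, and \<open>Re h + t 0 * Im h\<close> is
    inverted by taking imaginary parts, as \<open>Im (t 0)\<close> is positive.\<close>
  define invf where "invf = Blinfun (\<lambda>k. Complex (Re k - Re (t 0) * Im k / Im (t 0)) (Im k / Im (t 0)))"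
  have "bounded_linear (\<lambda>k. Complex (Re k - Re (t 0) * Im k / Im (t 0)) (Im k / Im (t 0)))"
    unfolding linear_conv_bounded_linear[symmetric] by (rule linearI) (auto simp: complex_eq_iff field_simps add_divide_distrib)
  then have invf: "blinfun_apply invf = (\<lambda>k. Complex (Re k - Re (t 0) * Im k / Im (t 0)) (Im k / Im (t 0)))"
    unfolding invf_def by (rule bounded_linear_Blinfun_apply)
  have inv: "invf o\<^sub>L D 0 = id_blinfun"
    using Im[OF U(2)] by (intro blinfun_eqI) (simp add: D invf J_def complex_eq_iff)
  have der': "(f has_derivative blinfun_apply (D z)) (at z)" if "z \<in> U" for z
    unfolding D by (rule derf[OF that])
  obtain U' V g g' where IFT: "open U'" "U' \<subseteq> U" "0 \<in> U'" "open V" "f 0 \<in> V" "homeomorphism U' V f g"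
    "\<And>y. y \<in> V \<Longrightarrow> (g has_derivative (g' y)) (at y)"
    "\<And>y. y \<in> V \<Longrightarrow> g' y = inv (blinfun_apply (D (g y)))"
    "\<And>y. y \<in> V \<Longrightarrow> bij (blinfun_apply (D (g y)))"
    by (rule inverse_function_theorem[OF U(1) der' contD U(2) inv]) blast+
  have f0: "f 0 = 0" by (simp add: f_def)
  then obtain r where r: "r > 0" "ball 0 r \<subseteq> V" using IFT(4,5) openE by metis
  define T where "T s = t (g s)" for s
  have gU: "g s \<in> U' \<and> f (g s) = s" if "s \<in> V" for s
    using IFT(6) that unfolding homeomorphism_def by blast
  have gf: "g (f z) = z \<and> f z \<in> V" if "z \<in> U'" for z
    using IFT(6) that unfolding homeomorphism_def by blast
  have "T field_differentiable (at s)" if s: "s \<in> ball 0 r" for s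
  proof -
    have sV: "s \<in> V" using s r by blast
    define z where "z = g s"
    have zU: "z \<in> U" using gU[OF sV] IFT(2) by (auto simp: z_def)
    have bij: "bij (blinfun_apply (D z))" using IFT(9)[OF sV] by (simp add: z_def)
    have J: "J z \<noteq> 0"
    proof
      assume "J z = 0"
      then have "blinfun_apply (D z) 1 = blinfun_apply (D z) 0" by (simp add: D)
      then show False using bij by (metis bij_is_inj inj_eq zero_neq_one)
    qed
    have "(T has_derivative (\<lambda>k. p z * (of_real (Re (g' s k)) + t z * of_real (Im (g' s k))))) (at s)"
      unfolding T_def using has_derivative_compose[OF IFT(7)[OF sV] der[OF zU, unfolded z_def]] by (simp add: z_def)
    moreover have "p z * (of_real (Re (g' s k)) + t z * of_real (Im (g' s k))) = p z / J z * k" for k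
    proof -
      have "blinfun_apply (D z) (g' s k) = k"
        using IFT(8)[OF sV] bij by (simp add: z_def bij_is_surj surj_f_inv_f)
      then have "J z * (of_real (Re (g' s k)) + t z * of_real (Im (g' s k))) = k" by (simp add: D)
      then show ?thesis using J by (metis nonzero_mult_div_cancel_left times_divide_eq_left times_divide_eq_right)
    qed
    then have "(\<lambda>k. p z * (of_real (Re (g' s k)) + t z * of_real (Im (g' s k)))) = (*) (p z / J z)"
      by (intro ext)
    ultimately have "(T has_field_derivative p z / J z) (at s)"
      unfolding has_field_derivative_def by (simp only:)
    then show ?thesis unfolding field_differentiable_def by blast
  qed
  then have "T holomorphic_on ball 0 r"
    by (meson field_differentiable_at_within holomorphic_on_def)
  \<comment> \<open>Every smaller disc is provided with its own domain mapped onto it, so that a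
    later argument may shrink the disc to avoid zeros of a denominator.\<close>
  moreover have "\<exists>U'. open U' \<and> 0 \<in> U' \<and> U' \<subseteq> U \<and>
       (\<forall>z\<in>U'. f z \<in> ball 0 \<rho> \<and> T (f z) = t z) \<and> (\<forall>s\<in>ball (0::complex) \<rho>. \<exists>z\<in>U'. f z = s)"
    if \<rho>: "0 < \<rho>" "\<rho> \<le> r" for \<rho>
  proof (intro exI[of _ "U' \<inter> f -` ball 0 \<rho>"] conjI)
    have "continuous_on U' f" using IFT(6) unfolding homeomorphism_def by blast
    then show "open (U' \<inter> f -` ball 0 \<rho>)" using IFT(1) by (metis Int_commute continuous_on_open_vimage open_ball)
    show "0 \<in> U' \<inter> f -` ball 0 \<rho>" using IFT(3) \<rho> f0 by simp
    show "U' \<inter> f -` ball 0 \<rho> \<subseteq> U" using IFT(2) by blast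
    show "\<forall>z\<in>U' \<inter> f -` ball 0 \<rho>. f z \<in> ball 0 \<rho> \<and> T (f z) = t z" using gf by (auto simp: T_def)
    show "\<forall>s\<in>ball (0::complex) \<rho>. \<exists>z\<in>U' \<inter> f -` ball 0 \<rho>. f z = s"
    proof
      fix s :: complex assume s: "s \<in> ball 0 \<rho>"
      then have "s \<in> V" using r(2) \<rho> by (meson subset_ball subsetD)
      then show "\<exists>z\<in>U' \<inter> f -` ball 0 \<rho>. f z = s" using gU[of s] s by (intro bexI[of _ "g s"]) auto
    qed
  qed
  ultimately show ?thesis using r(1) by blast
qed

section \<open>A maximum principle for functions of oriented planes\<close>

text \<open>Two proper subspaces do not cover the space: if vectors outside each one lie in the
  other, their sum lies in neither.\<close>

lemma exists_outside_two_spans: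
  fixes u v v' :: "real^'n"
  assumes "CARD('n) \<ge> 3" "indep2 u v" "indep2 u v'"
  obtains x where "indep3 u v x" "indep3 u v' x"
proof -
  obtain x1 x2 where x: "indep3 u v x1" "indep3 u v' x2" using exists_indep3 assms by metis
  have n: "x1 \<notin> span {u, v}" "x2 \<notin> span {u, v'}"
  proof -
    have aux: "x \<notin> span {u, w}" if i: "indep3 u w x" for x w :: "real^'n"
    proof
      assume "x \<in> span {u, w}"
      then obtain a b where "x = a *\<^sub>R u + b *\<^sub>R w" using span2 by blast
      then have "a *\<^sub>R u + b *\<^sub>R w + (-1) *\<^sub>R x = 0" by simp
      from indep3D[OF i this] show False by simp
    qed
    show "x1 \<notin> span {u, v}" "x2 \<notin> span {u, v'}" using aux x by blast+
  qed
  show ?thesis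
  proof (cases "x1 \<in> span {u, v'}")
    case False then show ?thesis using that x(1) indep3I[OF assms(3)] by blast
  next
    case x1: True
    show ?thesis
    proof (cases "x2 \<in> span {u, v}")
      case False then show ?thesis using that x(2) indep3I[OF assms(2)] by blast
    next
      case True
      have "x1 + x2 \<notin> span {u, v}" using True n(1) by (metis add_diff_cancel_right' span_diff)
      moreover have "x1 + x2 \<notin> span {u, v'}" using x1 n(2) by (metis add_diff_cancel_left' span_diff)
      ultimately show ?thesis using that indep3I assms by blast
    qed
  qed
qed

text \<open>The condition that \<open>F\<close> descends to oriented planes. Functions are kept on
  pairs of vectors, whose topology is at hand, rather than on \<open>Gr2\<close>.\<close>

definition plane_invariant :: "((real^'n) \<times> (real^'n) \<Rightarrow> 'b) \<Rightarrow> bool" where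
  "plane_invariant F \<longleftrightarrow> (\<forall>u v a b c d. indep2 u v \<longrightarrow> a * d - b * c > 0 \<longrightarrow>
     F (a *\<^sub>R u + b *\<^sub>R v, c *\<^sub>R u + d *\<^sub>R v) = F (u, v))"

lemma plane_invariantD:
  "plane_invariant F \<Longrightarrow> indep2 u v \<Longrightarrow> a * d - b * c > 0 \<Longrightarrow> F (a *\<^sub>R u + b *\<^sub>R v, c *\<^sub>R u + d *\<^sub>R v) = F (u, v)"
  unfolding plane_invariant_def by blast

text \<open>The Stiefel manifold of orthonormal pairs: a compact set with a basis of every oriented
  plane, standing in for compactness of the Grassmannian.\<close>

definition frames :: "((real^'n) \<times> (real^'n)) set" where
  "frames = {x. norm (fst x) = 1 \<and> norm (snd x) = 1 \<and> fst x \<bullet> snd x = 0}"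

lemma compact_frames: "compact (frames :: ((real^'n) \<times> (real^'n)) set)"
proof -
  have "frames \<subseteq> cball (0 :: (real^'n) \<times> (real^'n)) 2"
  proof
    fix x :: "(real^'n) \<times> (real^'n)" assume "x \<in> frames"
    then have "norm x \<le> norm (fst x) + norm (snd x)" "norm (fst x) = 1" "norm (snd x) = 1"
      using norm_Pair_le[of "fst x" "snd x"] by (auto simp: frames_def)
    then show "x \<in> cball 0 2" by simp
  qed
  moreover have "closed (frames :: ((real^'n) \<times> (real^'n)) set)"
    unfolding frames_def by (intro closed_Collect_conj closed_Collect_eq continuous_intros)
  ultimately show ?thesis using compact_eq_bounded_closed bounded_cball bounded_subset by blast
qed

lemma frames_indep2: "x \<in> frames \<Longrightarrow> indep2 (fst x) (snd x)"
  unfolding indep2_def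
proof (intro allI impI)
  fix a b assume x: "x \<in> frames" and e: "a *\<^sub>R fst x + b *\<^sub>R snd x = 0"
  have o: "fst x \<bullet> fst x = 1" "snd x \<bullet> snd x = 1" "fst x \<bullet> snd x = 0" "snd x \<bullet> fst x = 0"
    using x by (auto simp: frames_def norm_eq_1 inner_commute)
  have "fst x \<bullet> (a *\<^sub>R fst x + b *\<^sub>R snd x) = a" "snd x \<bullet> (a *\<^sub>R fst x + b *\<^sub>R snd x) = b"
    by (simp_all add: inner_add_right o)
  then show "a = 0 \<and> b = 0" unfolding e by simp
qed

text \<open>Gram-Schmidt is a triangular change of basis with positive diagonal, so it preserves the
  oriented plane.\<close>

lemma plane_invariant_frame:
  assumes "plane_invariant F" "indep2 u v"
  obtains x where "x \<in> frames" "F (u, v) = F x"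
proof -
  define w where "w = v - ((u \<bullet> v) / (u \<bullet> u)) *\<^sub>R u"
  have u: "u \<noteq> 0" using indep2_nz[OF assms(2)] by blast
  have w: "w \<noteq> 0"
  proof
    assume "w = 0"
    then have "(- ((u \<bullet> v) / (u \<bullet> u))) *\<^sub>R u + 1 *\<^sub>R v = 0" by (simp add: w_def)
    from indep2D[OF assms(2) this] show False by simp
  qed
  have uw: "u \<bullet> w = 0" using u by (simp add: w_def inner_diff_right)
  let ?x = "((1 / norm u) *\<^sub>R u + 0 *\<^sub>R v, (- ((u \<bullet> v) / (u \<bullet> u)) / norm w) *\<^sub>R u + (1 / norm w) *\<^sub>R v)"
  have x: "?x = (u /\<^sub>R norm u, w /\<^sub>R norm w)" by (simp add: w_def scaleR_diff_right divide_inverse_commute)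
  have "F ?x = F (u, v)"
    by (rule plane_invariantD[OF assms]) (use u w in simp)
  moreover have "?x \<in> frames" unfolding x using u w uw by (simp add: frames_def)
  ultimately show ?thesis using that by metis
qed

text \<open>Any two bases of planes are joined by moves that replace one basis vector at a time along a segment,
  so it suffices to follow F along segments.\<close>
lemma plane_invariant_locally_constant:
  fixes F :: "(real^'n) \<times> (real^'n) \<Rightarrow> complex"
  assumes n: "CARD('n) \<ge> 3" and inv: "plane_invariant F"
    and cont: "\<And>u v. indep2 u v \<Longrightarrow> isCont F (u, v)"
    and loc: "\<And>u v. indep2 u v \<Longrightarrow> F (u, v) = C \<Longrightarrow> \<forall>\<^sub>F x in nhds (u, v). F x = C"
    and start: "indep2 u0 v0" "F (u0, v0) = C" and "indep2 u v"
  shows "F (u, v) = C"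
proof -
  have move1: "F (u, v + y) = C" if F: "F (u, v) = C" and i: "indep3 u v y" for u v y
  proof -
    have ib: "indep2 u (v + b *\<^sub>R y)" for b :: real
      unfolding indep2_def
    proof (intro allI impI)
      fix r s assume "r *\<^sub>R u + s *\<^sub>R (v + b *\<^sub>R y) = 0"
      then have "r *\<^sub>R u + s *\<^sub>R v + (s * b) *\<^sub>R y = 0" by (simp add: scaleR_add_right add.assoc)
      from indep3D[OF i this] show "r = 0 \<and> s = 0" by blast
    qed
    \<comment> \<open>Along the full line through the segment, the set where \<open>F\<close> equals
      \<open>C\<close> is closed by \<open>cont\<close> and open by \<open>loc\<close>, hence all of
      the real line.\<close>
    define g where "g b = F (u, v + b *\<^sub>R y)" for b :: real
    have pc: "isCont (\<lambda>b. (u, v + b *\<^sub>R y)) b" for b :: real by (intro continuous_intros)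
    have "isCont g b" for b unfolding g_def
      using isCont_o2[OF pc cont[OF ib]] by simp
    then have gc: "continuous_on UNIV g" by (simp add: continuous_on_eq_continuous_at)
    have "closed (g -` {C})" using gc by (intro closed_vimage) auto
    moreover have "open (g -` {C})"
    proof (subst open_subopen, intro ballI)
      fix b assume "b \<in> g -` {C}"
      then have "\<forall>\<^sub>F x in nhds (u, v + b *\<^sub>R y). F x = C" using loc[OF ib] by (simp add: g_def)
      moreover have "((\<lambda>b. (u, v + b *\<^sub>R y)) \<longlongrightarrow> (u, v + b *\<^sub>R y)) (nhds b)"
        using pc[of b] tendsto_at_iff_tendsto_nhds[of "\<lambda>b. (u, v + b *\<^sub>R y)" b] by (simp add: isCont_def)
      ultimately have "\<forall>\<^sub>F b' in nhds b. F (u, v + b' *\<^sub>R y) = C"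
        unfolding filterlim_iff by blast
      then show "\<exists>T. open T \<and> b \<in> T \<and> T \<subseteq> g -` {C}" unfolding eventually_nhds g_def by blast
    qed
    moreover have "0 \<in> g -` {C}" using F by (simp add: g_def)
    ultimately have "g -` {C} = UNIV" using clopen[of "g -` {C}"] by blast
    then have "g 1 = C" by blast
    then show ?thesis by (simp add: g_def)
  qed
  have move2: "F (u, v') = C" if F: "F (u, v) = C" and i: "indep2 u v" "indep3 u v v'" for u v v'
  proof -
    have "indep3 u v (v' - v)" unfolding indep3_def
    proof (intro allI impI)
      fix a b c assume "a *\<^sub>R u + b *\<^sub>R v + c *\<^sub>R (v' - v) = 0"
      then have "a *\<^sub>R u + (b - c) *\<^sub>R v + c *\<^sub>R v' = 0" by (simp add: algebra_simps)
      from indep3D[OF i(2) this] show "a = 0 \<and> b = 0 \<and> c = 0" by auto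
    qed
    from move1[OF F this] show ?thesis by simp
  qed
  have move3: "F (u, v') = C" if F: "F (u, v) = C" and i: "indep2 u v" "indep2 u v'" for u v v'
  proof -
    obtain x where x: "indep3 u v x" "indep3 u v' x" by (rule exists_outside_two_spans[OF n i])
    have perm: "indep3 u x v'" unfolding indep3_def
    proof (intro allI impI)
      fix a b c assume "a *\<^sub>R u + b *\<^sub>R x + c *\<^sub>R v' = 0"
      then have "a *\<^sub>R u + c *\<^sub>R v' + b *\<^sub>R x = 0" by (simp add: algebra_simps)
      from indep3D[OF x(2) this] show "a = 0 \<and> b = 0 \<and> c = 0" by auto
    qed
    show ?thesis using move2[OF move2[OF F i(1) x(1)] indep3_indep2[OF perm] perm] .
  qed
  \<comment> \<open>Quarter and half turns inside a plane preserve its orientation; they let the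
    moves, which change only the second vector, act on the first one too.\<close>
  have rot: "F (- v, u) = F (u, v)" "F (- u, - v) = F (u, v)" if "indep2 u v" for u v
    using plane_invariantD[OF inv that, of 0 0 "-1" 1] plane_invariantD[OF inv that, of "-1" "-1" 0 0] by simp_all
  show ?thesis
  proof (cases "indep2 u0 u")
    case True
    then have "F (u0, u) = C" using move3 start by blast
    then have "F (- u, u0) = C" using rot(1)[OF True] by simp
    moreover have i: "indep2 (- u) u0" "indep2 (- u) (- v)"
      using indep2_combine[OF True, of 0 0 "-1" 1] indep2_combine[OF \<open>indep2 u v\<close>, of "-1" "-1" 0 0] by simp_all
    ultimately have "F (- u, - v) = C" using move3 by blast
    then show ?thesis using rot(2)[OF \<open>indep2 u v\<close>] by simp
  next
    case False
    then obtain a b where ab: "a *\<^sub>R u0 + b *\<^sub>R u = 0" "a \<noteq> 0 \<or> b \<noteq> 0" unfolding indep2_def by blast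
    have nz: "u0 \<noteq> 0" "u \<noteq> 0" using indep2_nz start assms by blast+
    then have "a \<noteq> 0" "b \<noteq> 0" using ab by auto
    define l where "l = - a / b"
    have l: "l \<noteq> 0" using \<open>a \<noteq> 0\<close> \<open>b \<noteq> 0\<close> by (simp add: l_def)
    have "b *\<^sub>R (u - l *\<^sub>R u0) = 0" using ab(1) \<open>b \<noteq> 0\<close> by (simp add: l_def algebra_simps)
    then have u: "u = l *\<^sub>R u0" using \<open>b \<noteq> 0\<close> by simp
    \<comment> \<open>Scaling by \<open>l\<close> and \<open>1 / l\<close> has determinant 1, so the
      oriented plane is kept even for negative \<open>l\<close>.\<close>
    have "F (l *\<^sub>R u0 + 0 *\<^sub>R v0, 0 *\<^sub>R u0 + (1 / l) *\<^sub>R v0) = F (u0, v0)"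
      by (rule plane_invariantD[OF inv start(1)]) (use l in simp)
    then have "F (u, (1 / l) *\<^sub>R v0) = C" using start u by simp
    moreover have "indep2 u ((1 / l) *\<^sub>R v0)"
      using indep2_combine[OF start(1), of l "1 / l" 0 0] l u by simp
    ultimately show ?thesis using move3 \<open>indep2 u v\<close> by blast
  qed
qed

text \<open>The maximum of the modulus over \<open>frames\<close> is a maximum over all bases, so
  \<open>loc\<close> applies wherever \<open>F\<close> takes the maximizing value; that value
  therefore propagates to every plane.\<close>

lemma plane_invariant_constant:
  fixes F :: "(real^'n) \<times> (real^'n) \<Rightarrow> complex" and u0 v0 :: "real^'n"
  assumes n: "CARD('n) \<ge> 3" and inv: "plane_invariant F"
    and cont: "\<And>u v. indep2 u v \<Longrightarrow> isCont F (u, v)"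
    and loc: "\<And>u v. indep2 u v \<Longrightarrow> (\<forall>u' v'. indep2 u' v' \<longrightarrow> cmod (F (u', v')) \<le> cmod (F (u, v))) \<Longrightarrow>
      \<forall>\<^sub>F x in nhds (u, v). F x = F (u, v)"
    and ex: "indep2 u0 v0"
  shows "\<exists>C. \<forall>u v. indep2 u v \<longrightarrow> F (u, v) = C"
proof -
  have "frames \<noteq> ({} :: ((real^'n) \<times> (real^'n)) set)" using plane_invariant_frame[OF inv ex] by blast
  moreover have "continuous_on frames (\<lambda>x. cmod (F x))"
  proof (intro continuous_intros continuous_at_imp_continuous_on ballI)
    fix x :: "(real^'n) \<times> (real^'n)" assume "x \<in> frames"
    then show "isCont F x" using cont[OF frames_indep2] by simp
  qed
  ultimately obtain m where m: "m \<in> frames" "\<forall>x\<in>frames. cmod (F x) \<le> cmod (F m)"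
    using continuous_attains_sup[OF compact_frames] by blast
  have max: "cmod (F (u, v)) \<le> cmod (F m)" if "indep2 u v" for u v
    using plane_invariant_frame[OF inv that] m by metis
  have im: "indep2 (fst m) (snd m)" using frames_indep2 m by blast
  have "F (u, v) = F m" if "indep2 u v" for u v
  proof (rule plane_invariant_locally_constant[OF n inv cont _ im _ that])
    fix u v assume "indep2 u v" "F (u, v) = F m"
    then show "\<forall>\<^sub>F x in nhds (u, v). F x = F m" using loc[of u v] max by simp
  qed simp_all
  then show ?thesis by blast
qed

section \<open>Graph coordinates near a plane of 3-space and the maximum principle in them\<close>

lemma indep3_coordinates:
  fixes u v y :: "real^3"
  assumes "indep3 u v y"
  obtains cd :: "real^3 \<Rightarrow> real^3" where "linear cd" "\<forall>x. x = cd x $ 1 *\<^sub>R u + cd x $ 2 *\<^sub>R v + cd x $ 3 *\<^sub>R y"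
    "cd u $ 1 = 1" "cd u $ 2 = 0" "cd u $ 3 = 0" "cd v $ 1 = 0" "cd v $ 2 = 1" "cd v $ 3 = 0"
proof -
  define f where "f c = c $ 1 *\<^sub>R u + c $ 2 *\<^sub>R v + c $ 3 *\<^sub>R y" for c :: "real^3"
  have lin: "linear f" unfolding f_def by (rule linearI) (auto simp: algebra_simps)
  have "inj f"
  proof (subst linear_injective_0[OF lin], intro allI impI)
    fix c assume "f c = 0"
    then have "c $ 1 = 0" "c $ 2 = 0" "c $ 3 = 0" using indep3D[OF assms] unfolding f_def by blast+
    then show "c = 0" by (simp add: vec_eq_iff forall_3)
  qed
  then obtain cd where cd: "linear cd" "\<And>x. cd (f x) = x" "\<And>x. f (cd x) = x"
    using linear_injective_isomorphism[OF lin] by blast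
  have "f (axis 1 1) = u" "f (axis 2 1) = v" by (simp_all add: f_def axis_def)
  then have "cd u = axis 1 1" "cd v = axis 2 1" using cd(2) by metis+
  then show ?thesis using that[OF cd(1)] cd(3) unfolding f_def by (simp add: axis_def)
qed

text \<open>The affine chart of the Grassmannian: a plane close to that of \<open>u\<close> and
  \<open>v\<close> is a graph over it in direction \<open>y\<close>, and \<open>\<zeta>\<close>
  records the two slopes.\<close>

lemma nearby_planes:
  fixes u v y :: "real^3"
  assumes "indep3 u v y"
  shows "\<exists>\<zeta> :: (real^3) \<times> (real^3) \<Rightarrow> complex. isCont \<zeta> (u, v) \<and> \<zeta> (u, v) = 0 \<and>
    (\<forall>\<^sub>F x in nhds (u, v). \<exists>a b c d. a * d - b * c > 0 \<and>
      x = (a *\<^sub>R (u + Re (\<zeta> x) *\<^sub>R y) + b *\<^sub>R (v + Im (\<zeta> x) *\<^sub>R y), c *\<^sub>R (u + Re (\<zeta> x) *\<^sub>R y) + d *\<^sub>R (v + Im (\<zeta> x) *\<^sub>R y)))"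
proof -
  obtain cd :: "real^3 \<Rightarrow> real^3" where cd: "linear cd" "\<forall>x. x = cd x $ 1 *\<^sub>R u + cd x $ 2 *\<^sub>R v + cd x $ 3 *\<^sub>R y"
    "cd u $ 1 = 1" "cd u $ 2 = 0" "cd u $ 3 = 0" "cd v $ 1 = 0" "cd v $ 2 = 1" "cd v $ 3 = 0"
    by (rule indep3_coordinates[OF assms])
  define D where "D x = cd (fst x) $ 1 * cd (snd x) $ 2 - cd (fst x) $ 2 * cd (snd x) $ 1" for x
  \<comment> \<open>The slopes solve, for both basis vectors, the equation that expresses the third
    coordinate by the first two; this is Cramer's rule, and positivity of the determinant
    \<open>D\<close> means matching orientation.\<close>
  define A where "A x = (cd (snd x) $ 2 * cd (fst x) $ 3 - cd (fst x) $ 2 * cd (snd x) $ 3) / D x" for x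
  define B where "B x = (cd (fst x) $ 1 * cd (snd x) $ 3 - cd (snd x) $ 1 * cd (fst x) $ 3) / D x" for x
  define \<zeta> where "\<zeta> x = complex_of_real (A x) + \<i> * complex_of_real (B x)" for x
  have cont: "isCont (\<lambda>x. cd (fst x) $ i) p" "isCont (\<lambda>x. cd (snd x) $ i) p" for i p
  proof -
    have "isCont cd z" for z
      using linear_conv_bounded_linear[THEN iffD1, OF cd(1)] by (rule linear_continuous_at)
    moreover have "isCont fst p" "isCont snd p" by (intro continuous_intros)+
    ultimately show "isCont (\<lambda>x. cd (fst x) $ i) p" "isCont (\<lambda>x. cd (snd x) $ i) p"
      using isCont_o2[of p fst cd] isCont_o2[of p snd cd] isCont_vec_nth by blast+
  qed
  have contD: "isCont D p" for p unfolding D_def by (intro continuous_intros cont)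
  have D1: "D (u, v) = 1" by (simp add: D_def cd)
  have "isCont A (u, v)" "isCont B (u, v)" unfolding A_def B_def
    by (intro continuous_intros cont contD; simp add: D1)+
  then have "isCont \<zeta> (u, v)" unfolding \<zeta>_def by (intro continuous_intros)
  moreover have "\<zeta> (u, v) = 0" by (simp add: \<zeta>_def A_def B_def cd)
  moreover have "\<forall>\<^sub>F x in nhds (u, v). D x > 0"
  proof -
    have "(D \<longlongrightarrow> 1) (nhds (u, v))"
      using contD[of "(u, v)"] tendsto_at_iff_tendsto_nhds[of D "(u, v)"] by (simp add: isCont_def D1)
    then show ?thesis by (rule order_tendstoD) simp
  qed
  then have "\<forall>\<^sub>F x in nhds (u, v). \<exists>a b c d. a * d - b * c > 0 \<and>
      x = (a *\<^sub>R (u + Re (\<zeta> x) *\<^sub>R y) + b *\<^sub>R (v + Im (\<zeta> x) *\<^sub>R y), c *\<^sub>R (u + Re (\<zeta> x) *\<^sub>R y) + d *\<^sub>R (v + Im (\<zeta> x) *\<^sub>R y))"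
  proof eventually_elim
    case (elim x)
    have "cd (fst x) $ 1 * A x + cd (fst x) $ 2 * B x = cd (fst x) $ 3 * (D x / D x)"
      unfolding A_def B_def by (simp add: D_def field_simps flip: add_divide_distrib diff_divide_distrib)
    moreover have "cd (snd x) $ 1 * A x + cd (snd x) $ 2 * B x = cd (snd x) $ 3 * (D x / D x)"
      unfolding A_def B_def by (simp add: D_def field_simps flip: add_divide_distrib diff_divide_distrib)
    ultimately have e: "cd (fst x) $ 1 * A x + cd (fst x) $ 2 * B x = cd (fst x) $ 3"
      "cd (snd x) $ 1 * A x + cd (snd x) $ 2 * B x = cd (snd x) $ 3" using elim by simp_all
    have "cd z $ 1 *\<^sub>R (u + A x *\<^sub>R y) + cd z $ 2 *\<^sub>R (v + B x *\<^sub>R y) = z" if "cd z $ 1 * A x + cd z $ 2 * B x = cd z $ 3" for z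
      by (subst (5) cd(2)[rule_format]) (simp add: that[symmetric] algebra_simps)
    from this[OF e(1)] this[OF e(2)] show ?case using elim
      by (intro exI[of _ "cd (fst x) $ 1"] exI[of _ "cd (fst x) $ 2"] exI[of _ "cd (snd x) $ 1"] exI[of _ "cd (snd x) $ 2"])
        (simp add: D_def \<zeta>_def)
  qed
  ultimately show ?thesis by blast
qed

text \<open>\<open>F\<close> is holomorphic in the characteristic coordinate \<open>s\<close>, which
  is linked to the graph coordinate \<open>z\<close> only by continuity at 0 and by covering a disc:
  what continuity of \<open>F\<close> and the maximum principle need.\<close>

definition holo_chart :: "((real^3) \<times> (real^3) \<Rightarrow> complex) \<Rightarrow> real^3 \<Rightarrow> real^3 \<Rightarrow> bool" where
  "holo_chart F u v \<longleftrightarrow> (\<exists>y r H s U. indep3 u v y \<and> r > 0 \<and> H holomorphic_on ball 0 r \<and> open U \<and> 0 \<in> U \<and>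
     isCont s 0 \<and> s 0 = 0 \<and>
     (\<forall>z\<in>U. indep2 (u + Re z *\<^sub>R y) (v + Im z *\<^sub>R y) \<and> s z \<in> ball 0 r \<and> F (u + Re z *\<^sub>R y, v + Im z *\<^sub>R y) = H (s z)) \<and>
     (\<forall>w\<in>ball 0 r. \<exists>z\<in>U. s z = w))"

text \<open>The two pointwise hypotheses of \<open>plane_invariant_constant\<close> in one
  predicate, so that they can be transported together along a change of basis.\<close>

definition max_regular :: "((real^3) \<times> (real^3) \<Rightarrow> complex) \<Rightarrow> (real^3) \<times> (real^3) \<Rightarrow> bool" where
  "max_regular F x \<longleftrightarrow> isCont F x \<and> ((\<forall>u' v'. indep2 u' v' \<longrightarrow> cmod (F (u', v')) \<le> cmod (F x)) \<longrightarrow>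
     (\<forall>\<^sub>F x' in nhds x. F x' = F x))"

lemma isCont_tendsto_nhds: "isCont f a \<longleftrightarrow> (f \<longlongrightarrow> f a) (nhds a)"
  using tendsto_at_iff_tendsto_nhds[of f a] by (simp add: isCont_def)

text \<open>As \<open>s\<close> covers the disc, a global maximum of \<open>F\<close> at
  \<open>(u, v)\<close> is an interior maximum of the modulus of \<open>H\<close> at 0, so
  \<open>H\<close> is constant; \<open>nearby_planes\<close> brings every neighbouring basis into
  the chart.\<close>

lemma holo_chart_max_regular:
  assumes inv: "plane_invariant F" and "holo_chart F u v"
  shows "max_regular F (u, v)"
proof -
  obtain y r H s U where y: "indep3 u v y" and r: "r > 0" and H: "H holomorphic_on ball 0 r" and U: "open U" "0 \<in> U"
    and s: "isCont s 0" "s 0 = 0"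
    and F: "\<forall>z\<in>U. indep2 (u + Re z *\<^sub>R y) (v + Im z *\<^sub>R y) \<and> s z \<in> ball 0 r \<and> F (u + Re z *\<^sub>R y, v + Im z *\<^sub>R y) = H (s z)"
    and surj: "\<forall>w\<in>ball 0 r. \<exists>z\<in>U. s z = w"
    using assms(2) unfolding holo_chart_def by (elim exE conjE)
  obtain \<zeta> where \<zeta>: "isCont \<zeta> (u, v)" "\<zeta> (u, v) = 0" and near: "\<forall>\<^sub>F x in nhds (u, v). \<exists>a b c d. a * d - b * c > 0 \<and>
      x = (a *\<^sub>R (u + Re (\<zeta> x) *\<^sub>R y) + b *\<^sub>R (v + Im (\<zeta> x) *\<^sub>R y), c *\<^sub>R (u + Re (\<zeta> x) *\<^sub>R y) + d *\<^sub>R (v + Im (\<zeta> x) *\<^sub>R y))"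
    using nearby_planes[OF y] by (elim exE conjE)
  have F0: "F (u, v) = H 0" using F U(2) s(2) by force
  have "(\<zeta> \<longlongrightarrow> 0) (nhds (u, v))" using \<zeta> isCont_tendsto_nhds[where f="\<zeta>" and a="(u, v)"] by simp
  then have "\<forall>\<^sub>F x in nhds (u, v). \<zeta> x \<in> U" using U by (rule topological_tendstoD)
  with near have ev: "\<forall>\<^sub>F x in nhds (u, v). F x = H (s (\<zeta> x)) \<and> s (\<zeta> x) \<in> ball 0 r"
  proof eventually_elim
    case (elim x)
    then obtain a b c d where abcd: "a * d - b * c > 0" 
      "x = (a *\<^sub>R (u + Re (\<zeta> x) *\<^sub>R y) + b *\<^sub>R (v + Im (\<zeta> x) *\<^sub>R y), c *\<^sub>R (u + Re (\<zeta> x) *\<^sub>R y) + d *\<^sub>R (v + Im (\<zeta> x) *\<^sub>R y))"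
      by blast
    have i: "indep2 (u + Re (\<zeta> x) *\<^sub>R y) (v + Im (\<zeta> x) *\<^sub>R y)" using F elim by blast
    have "F x = F (u + Re (\<zeta> x) *\<^sub>R y, v + Im (\<zeta> x) *\<^sub>R y)"
      using plane_invariantD[OF inv i abcd(1)] abcd(2) by metis
    then show ?case using F elim by simp
  qed
  have cH: "isCont H 0" using holomorphic_on_imp_continuous_on[OF H] r
    by (simp add: continuous_on_eq_continuous_at)
  have "isCont s (\<zeta> (u, v))" using s(1) \<zeta>(2) by simp
  then have c: "isCont (\<lambda>x. s (\<zeta> x)) (u, v)" by (rule isCont_o2[OF \<zeta>(1)])
  have "isCont H (s (\<zeta> (u, v)))" using cH s(2) \<zeta>(2) by simp
  then have "isCont (\<lambda>x. H (s (\<zeta> x))) (u, v)" by (rule isCont_o2[OF c])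
  then have "((\<lambda>x. H (s (\<zeta> x))) \<longlongrightarrow> F (u, v)) (nhds (u, v))"
    using isCont_tendsto_nhds[where f="\<lambda>x. H (s (\<zeta> x))" and a="(u, v)"] F0 s(2) \<zeta>(2) by simp
  then have "(F \<longlongrightarrow> F (u, v)) (nhds (u, v))"
    by (rule Lim_transform_eventually) (use ev in \<open>auto elim: eventually_mono\<close>)
  then have "isCont F (u, v)" by (simp add: isCont_tendsto_nhds)
  moreover have "\<forall>\<^sub>F x in nhds (u, v). F x = F (u, v)"
    if max: "\<forall>u' v'. indep2 u' v' \<longrightarrow> cmod (F (u', v')) \<le> cmod (F (u, v))"
  proof -
    have "cmod (H w) \<le> cmod (H 0)" if "w \<in> ball 0 r" for w
    proof -
      obtain z where "z \<in> U" "s z = w" using surj \<open>w \<in> ball 0 r\<close> by blast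
      then show ?thesis using F max F0 by metis
    qed
    then have "H constant_on ball 0 r"
      using r by (intro maximum_modulus_principle[OF H open_ball connected_ball open_ball order_refl, of 0]) auto
    then have "H w = H 0" if "w \<in> ball 0 r" for w using that r unfolding constant_on_def by force
    then show ?thesis using ev F0 by (auto elim: eventually_mono)
  qed
  ultimately show ?thesis unfolding max_regular_def by blast
qed

text \<open>At the poles a chart is constructed for one basis only; the inverse base change
  \<open>B\<close>, a continuous map, carries the property to all positive bases of the same
  plane.\<close>

lemma max_regular_plane:
  assumes inv: "plane_invariant F" and i: "indep2 u v" and D: "a * d - b * c > 0" and reg: "max_regular F (u, v)"
  shows "max_regular F (a *\<^sub>R u + b *\<^sub>R v, c *\<^sub>R u + d *\<^sub>R v)"
proof -
  define D where "D = a * d - b * c"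
  have Dp: "D > 0" using D by (simp add: D_def)
  let ?x = "(a *\<^sub>R u + b *\<^sub>R v, c *\<^sub>R u + d *\<^sub>R v)"
  define B where "B x = ((d / D) *\<^sub>R fst x + (- b / D) *\<^sub>R snd x, (- c / D) *\<^sub>R fst x + (a / D) *\<^sub>R snd x)" for x :: "(real^3) \<times> (real^3)"
  have detB: "(d / D) * (a / D) - (- b / D) * (- c / D) > 0"
  proof -
    have "(d / D) * (a / D) - (- b / D) * (- c / D) = D / (D * D)"
      by (simp add: D_def diff_divide_distrib algebra_simps)
    then show ?thesis using Dp by simp
  qed
  have "(d / D) *\<^sub>R (a *\<^sub>R u + b *\<^sub>R v) + (- b / D) *\<^sub>R (c *\<^sub>R u + d *\<^sub>R v) = ((a * d - b * c) / D) *\<^sub>R u + ((d * b - b * d) / D) *\<^sub>R v"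
    by (simp add: algebra_simps diff_divide_distrib)
  moreover have "(- c / D) *\<^sub>R (a *\<^sub>R u + b *\<^sub>R v) + (a / D) *\<^sub>R (c *\<^sub>R u + d *\<^sub>R v) = ((a * c - a * c) / D) *\<^sub>R u + ((a * d - b * c) / D) *\<^sub>R v"
    by (simp add: algebra_simps diff_divide_distrib)
  ultimately have Bx: "B ?x = (u, v)" using Dp by (simp add: B_def D_def)
  have ix: "indep2 (fst ?x) (snd ?x)" using indep2_combine[OF i, of a d b c] D by simp
  have FB: "F x = F (B x)" if "indep2 (fst x) (snd x)" for x
    using plane_invariantD[OF inv that detB] by (simp add: B_def)
  have "open {x :: (real^3) \<times> (real^3). indep2 (fst x) (snd x)}" using open_indep2 by (simp add: case_prod_beta')
  then have ev: "\<forall>\<^sub>F x in nhds ?x. F x = F (B x)"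
    unfolding eventually_nhds using ix FB by blast
  have cB: "isCont B ?x" unfolding B_def by (intro continuous_intros)
  have "isCont F (B ?x)" using reg Bx unfolding max_regular_def by simp
  then have "isCont (\<lambda>x. F (B x)) ?x" by (rule isCont_o2[OF cB])
  then have "((\<lambda>x. F (B x)) \<longlongrightarrow> F ?x) (nhds ?x)"
    using isCont_tendsto_nhds[where f="\<lambda>x. F (B x)" and a="?x"] FB[OF ix] by simp
  then have "(F \<longlongrightarrow> F ?x) (nhds ?x)"
    by (rule Lim_transform_eventually) (use ev in \<open>auto elim: eventually_mono\<close>)
  then have "isCont F ?x" using isCont_tendsto_nhds by blast
  moreover have "\<forall>\<^sub>F x in nhds ?x. F x = F ?x" if max: "\<forall>u' v'. indep2 u' v' \<longrightarrow> cmod (F (u', v')) \<le> cmod (F ?x)"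
  proof -
    have e: "F ?x = F (u, v)" using FB[OF ix] Bx by simp
    then have "\<forall>\<^sub>F x' in nhds (u, v). F x' = F (u, v)" using max reg unfolding max_regular_def by metis
    moreover have "(B \<longlongrightarrow> (u, v)) (nhds ?x)" using cB isCont_tendsto_nhds[where f=B and a="?x"] Bx by simp
    ultimately have "\<forall>\<^sub>F x in nhds ?x. F (B x) = F (u, v)" unfolding filterlim_iff by blast
    with ev show ?thesis unfolding e by eventually_elim simp
  qed
  ultimately show ?thesis unfolding max_regular_def by blast
qed

text \<open>Removable singularities, applied once for the zero of \<open>h\<close> and once for the
  zero of its difference quotient.\<close>

lemma double_zero_quotient:
  assumes h: "h holomorphic_on ball 0 r" "r > 0" "h 0 = 0" "(h has_field_derivative 0) (at 0)"
  shows "\<exists>H. H holomorphic_on ball 0 r \<and> (\<forall>s\<in>ball 0 r. h s = s\<^sup>2 * H s)"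
proof -
  define h1 where "h1 s = (if s = 0 then deriv h 0 else (h s - h 0) / (s - 0))" for s
  define h2 where "h2 s = (if s = 0 then deriv h1 0 else (h1 s - h1 0) / (s - 0))" for s
  have "h1 holomorphic_on ball 0 r" unfolding h1_def[abs_def] using h by (intro pole_lemma) auto
  then have "h2 holomorphic_on ball 0 r" unfolding h2_def[abs_def] using h by (intro pole_lemma) auto
  moreover have "h s = s\<^sup>2 * h2 s" for s
    using h(3) DERIV_imp_deriv[OF h(4)] by (simp add: h2_def h1_def power2_eq_square)
  ultimately show ?thesis by blast
qed

section \<open>Three-dimensional real subspaces\<close>

text \<open>An axiomatic copy of \<open>tau\<close> on \<open>real^3\<close>, where coordinates are
  concrete; \<open>plane_field3_restrict\<close> obtains instances by pulling back along injective
  linear maps.\<close>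

locale plane_field3 =
  fixes t :: "real^3 \<Rightarrow> real^3 \<Rightarrow> complex"
  assumes Im_t: "indep2 u v \<Longrightarrow> Im (t u v) > 0"
    and t_base: "indep2 u v \<Longrightarrow> a * d - b * c > 0 \<Longrightarrow>
      (of_real a + t (a *\<^sub>R u + b *\<^sub>R v) (c *\<^sub>R u + d *\<^sub>R v) * of_real c) * t u v
       = of_real b + t (a *\<^sub>R u + b *\<^sub>R v) (c *\<^sub>R u + d *\<^sub>R v) * of_real d"
    and isCont_t: "indep2 u v \<Longrightarrow> isCont (\<lambda>x. t (fst x) (snd x)) (u, v)"
    and t_burgers: "indep2 u v \<Longrightarrow> \<exists>U p. open U \<and> 0 \<in> U \<and> continuous_on U p \<and>
      (\<forall>z\<in>U. indep2 (u + Re z *\<^sub>R y) (v + Im z *\<^sub>R y)) \<and>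
      (\<forall>z\<in>U. ((\<lambda>z. t (u + Re z *\<^sub>R y) (v + Im z *\<^sub>R y)) has_derivative
         (\<lambda>h. p z * (of_real (Re h) + t (u + Re z *\<^sub>R y) (v + Im z *\<^sub>R y) * of_real (Im h)))) (at z))"
begin

definition w :: "real^3 \<Rightarrow> real^3 \<Rightarrow> complex^3" where
  "w u v = cvec_of_real u + t u v *s cvec_of_real v"

lemma w_base:
  assumes "indep2 u v" "a * d - b * c > 0"
  obtains k where "k \<noteq> 0" "w (a *\<^sub>R u + b *\<^sub>R v) (c *\<^sub>R u + d *\<^sub>R v) = k *s w u v"
proof -
  let ?t = "t (a *\<^sub>R u + b *\<^sub>R v) (c *\<^sub>R u + d *\<^sub>R v)"
  define k where "k = of_real a + ?t * of_real c"
  have i: "indep2 (a *\<^sub>R u + b *\<^sub>R v) (c *\<^sub>R u + d *\<^sub>R v)" using indep2_combine[OF assms(1)] assms(2) by simp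
  have "k \<noteq> 0"
  proof
    assume "k = 0"
    then have "Im ?t * c = 0" "a + Re ?t * c = 0" by (simp_all add: k_def complex_eq_iff)
    then show False using Im_t[OF i] assms(2) by auto
  qed
  moreover have "w (a *\<^sub>R u + b *\<^sub>R v) (c *\<^sub>R u + d *\<^sub>R v) = k *s cvec_of_real u + (of_real b + ?t * of_real d) *s cvec_of_real v"
    unfolding w_def k_def by (simp add: vec_eq_iff algebra_simps)
  then have "w (a *\<^sub>R u + b *\<^sub>R v) (c *\<^sub>R u + d *\<^sub>R v) = k *s w u v"
    using t_base[OF assms] unfolding w_def k_def by (simp add: vec.scale_right_distrib)
  ultimately show ?thesis using that by blast
qed

text \<open>Expanding \<open>w (u + Re z *\<^sub>R y) (v + Im z *\<^sub>R y)\<close> shows that its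
  coefficient of \<open>y\<close> is exactly the characteristic coordinate \<open>f z\<close>, so
  \<open>burgers_chart\<close> presents the image as a holomorphic graph.\<close>

lemma graph:
  fixes u v y :: "real^3"
  assumes uv: "indep2 u v"
  defines "f \<equiv> \<lambda>z. of_real (Re z) + t (u + Re z *\<^sub>R y) (v + Im z *\<^sub>R y) * of_real (Im z)"
  shows "\<exists>r T. r > (0::real) \<and> T holomorphic_on ball 0 r \<and> T 0 = t u v \<and> isCont f 0 \<and> f 0 = 0 \<and>
    (\<forall>\<rho>. 0 < \<rho> \<longrightarrow> \<rho> \<le> r \<longrightarrow> (\<exists>U. open U \<and> 0 \<in> U \<and>
       (\<forall>z\<in>U. indep2 (u + Re z *\<^sub>R y) (v + Im z *\<^sub>R y) \<and> f z \<in> ball 0 \<rho> \<and>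
          w (u + Re z *\<^sub>R y) (v + Im z *\<^sub>R y) = cvec_of_real u + T (f z) *s cvec_of_real v + f z *s cvec_of_real y) \<and>
       (\<forall>s\<in>ball (0::complex) \<rho>. \<exists>z\<in>U. f z = s)))"
proof -
  obtain U p where U: "open U" "0 \<in> U" "continuous_on U p"
    and ind: "\<forall>z\<in>U. indep2 (u + Re z *\<^sub>R y) (v + Im z *\<^sub>R y)"
    and der: "\<forall>z\<in>U. ((\<lambda>z. t (u + Re z *\<^sub>R y) (v + Im z *\<^sub>R y)) has_derivative
         (\<lambda>h. p z * (of_real (Re h) + t (u + Re z *\<^sub>R y) (v + Im z *\<^sub>R y) * of_real (Im h)))) (at z)"
    using t_burgers[OF uv, of y] by (elim exE conjE)
  have "\<exists>r T. r > (0::real) \<and> T holomorphic_on ball (0::complex) r \<and>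
     (\<forall>\<rho>. 0 < \<rho> \<longrightarrow> \<rho> \<le> r \<longrightarrow> (\<exists>U'. open U' \<and> 0 \<in> U' \<and> U' \<subseteq> U \<and>
       (\<forall>z\<in>U'. f z \<in> ball 0 \<rho> \<and> T (f z) = t (u + Re z *\<^sub>R y) (v + Im z *\<^sub>R y)) \<and> (\<forall>s\<in>ball (0::complex) \<rho>. \<exists>z\<in>U'. f z = s)))"
    unfolding f_def by (rule burgers_chart[OF U]) (use ind Im_t der in auto)
  then obtain r T where r: "r > (0::real)" and T: "T holomorphic_on ball (0::complex) r"
    and ch: "\<forall>\<rho>. 0 < \<rho> \<longrightarrow> \<rho> \<le> r \<longrightarrow> (\<exists>U'. open U' \<and> 0 \<in> U' \<and> U' \<subseteq> U \<and>
       (\<forall>z\<in>U'. f z \<in> ball 0 \<rho> \<and> T (f z) = t (u + Re z *\<^sub>R y) (v + Im z *\<^sub>R y)) \<and> (\<forall>s\<in>ball (0::complex) \<rho>. \<exists>z\<in>U'. f z = s))"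
    by (elim exE conjE)
  have wf: "w (u + Re z *\<^sub>R y) (v + Im z *\<^sub>R y) = cvec_of_real u + t (u + Re z *\<^sub>R y) (v + Im z *\<^sub>R y) *s cvec_of_real v + f z *s cvec_of_real y" for z
    unfolding w_def f_def by (simp add: vec_eq_iff algebra_simps)
  have f0: "f 0 = 0" by (simp add: f_def)
  have T0: "T 0 = t u v"
  proof -
    from ch[rule_format, OF r order_refl] obtain U' where "0 \<in> U'" "\<forall>z\<in>U'. f z \<in> ball 0 r \<and> T (f z) = t (u + Re z *\<^sub>R y) (v + Im z *\<^sub>R y)"
      by blast
    then show ?thesis using f0 by force
  qed
  have "isCont (\<lambda>z. t (u + Re z *\<^sub>R y) (v + Im z *\<^sub>R y)) 0" using der U(2) has_derivative_continuous by blast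
  then have cf: "isCont f 0" unfolding f_def
    by (intro continuous_intros linear_continuous_at[OF bounded_linear_Re] linear_continuous_at[OF bounded_linear_Im])
  have "\<exists>U. open U \<and> 0 \<in> U \<and>
       (\<forall>z\<in>U. indep2 (u + Re z *\<^sub>R y) (v + Im z *\<^sub>R y) \<and> f z \<in> ball 0 \<rho> \<and>
          w (u + Re z *\<^sub>R y) (v + Im z *\<^sub>R y) = cvec_of_real u + T (f z) *s cvec_of_real v + f z *s cvec_of_real y) \<and>
       (\<forall>s\<in>ball (0::complex) \<rho>. \<exists>z\<in>U. f z = s)" if \<rho>: "0 < \<rho>" "\<rho> \<le> r" for \<rho>
  proof -
    from ch[rule_format, OF \<rho>] obtain U' where U': "open U'" "0 \<in> U'" "U' \<subseteq> U"
      "\<forall>z\<in>U'. f z \<in> ball 0 \<rho> \<and> T (f z) = t (u + Re z *\<^sub>R y) (v + Im z *\<^sub>R y)" "\<forall>s\<in>ball (0::complex) \<rho>. \<exists>z\<in>U'. f z = s"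
      by (elim exE conjE)
    have "\<forall>z\<in>U'. indep2 (u + Re z *\<^sub>R y) (v + Im z *\<^sub>R y) \<and> f z \<in> ball 0 \<rho> \<and>
          w (u + Re z *\<^sub>R y) (v + Im z *\<^sub>R y) = cvec_of_real u + T (f z) *s cvec_of_real v + f z *s cvec_of_real y"
    proof
      fix z assume z: "z \<in> U'"
      then have "T (f z) = t (u + Re z *\<^sub>R y) (v + Im z *\<^sub>R y)" "f z \<in> ball 0 \<rho>" "z \<in> U" using U' by blast+
      then show "indep2 (u + Re z *\<^sub>R y) (v + Im z *\<^sub>R y) \<and> f z \<in> ball 0 \<rho> \<and>
          w (u + Re z *\<^sub>R y) (v + Im z *\<^sub>R y) = cvec_of_real u + T (f z) *s cvec_of_real v + f z *s cvec_of_real y"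
        using ind wf[of z] by simp
    qed
    then show ?thesis using U' by (intro exI[of _ U']) simp
  qed
  then show ?thesis using r T T0 cf f0 by (intro exI[of _ r] exI[of _ T]) simp
qed

abbreviation e :: "3 \<Rightarrow> real^3" where "e i \<equiv> axis i 1"

lemma e_nth: "e i $ j = (if i = j then 1 else 0)" by (simp add: axis_def)

lemma e_indep3: "indep3 (e 1) (e 2) (e 3)" "indep3 (e 1) (- e 2) (e 3)"
  unfolding indep3_def by (auto simp: vec_eq_iff forall_3 e_nth)

text \<open>A quadric through all points of the field over planes in 3-space: the numerator num, divided by
  the square of the third coordinate, has at most double poles, at the two orientations of the plane spanned by
  e 1 and e 2. The coefficients k1 and k2 are chosen to cancel both polar parts, so the quotient is constant.\<close>
theorem quadric_exists:
  "\<exists>c11 c12 c13 c23 c33. \<forall>u v. indep2 u v \<longrightarrow>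
     (w u v $ 2)\<^sup>2 + c12 * w u v $ 1 * w u v $ 2 + c11 * (w u v $ 1)\<^sup>2 + c13 * w u v $ 1 * w u v $ 3
      + c23 * w u v $ 2 * w u v $ 3 + c33 * (w u v $ 3)\<^sup>2 = 0"
proof -
  have i1: "indep2 (e 1) (e 2)" and i2: "indep2 (e 1) (- e 2)" using e_indep3 indep3_indep2 by blast+
  define t0 where "t0 = t (e 1) (e 2)"
  \<comment> \<open>\<open>t0\<close> and \<open>t0'\<close> are the second coordinates of the
    points over the two orientations, with first coordinate 1; the sign accounts for
    \<open>- e 2\<close>. Their imaginary parts have opposite signs, so they differ.\<close>
  define t0' where "t0' = - t (e 1) (- e 2)"
  have t0: "t0 \<noteq> t0'" using Im_t[OF i1] Im_t[OF i2] by (auto simp: t0_def t0'_def)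
  define f1 where "f1 = (\<lambda>z. of_real (Re z) + t (e 1 + Re z *\<^sub>R e 3) (e 2 + Im z *\<^sub>R e 3) * of_real (Im z))"
  define f2 where "f2 = (\<lambda>z. of_real (Re z) + t (e 1 + Re z *\<^sub>R e 3) (- e 2 + Im z *\<^sub>R e 3) * of_real (Im z))"
  obtain r1 T1 where r1: "r1 > (0::real)" and T1: "T1 holomorphic_on ball 0 r1" "T1 0 = t0" and f1: "isCont f1 0" "f1 0 = 0"
    and g1: "\<forall>\<rho>. 0 < \<rho> \<longrightarrow> \<rho> \<le> r1 \<longrightarrow> (\<exists>U. open U \<and> 0 \<in> U \<and>
       (\<forall>z\<in>U. indep2 (e 1 + Re z *\<^sub>R e 3) (e 2 + Im z *\<^sub>R e 3) \<and> f1 z \<in> ball 0 \<rho> \<and>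
          w (e 1 + Re z *\<^sub>R e 3) (e 2 + Im z *\<^sub>R e 3) = cvec_of_real (e 1) + T1 (f1 z) *s cvec_of_real (e 2) + f1 z *s cvec_of_real (e 3)) \<and>
       (\<forall>s\<in>ball (0::complex) \<rho>. \<exists>z\<in>U. f1 z = s))"
    using graph[OF i1, of "e 3"] unfolding f1_def t0_def by (elim exE conjE)
  obtain r2 T2 where r2: "r2 > (0::real)" and T2: "T2 holomorphic_on ball 0 r2" "T2 0 = - t0'" and f2: "isCont f2 0" "f2 0 = 0"
    and g2: "\<forall>\<rho>. 0 < \<rho> \<longrightarrow> \<rho> \<le> r2 \<longrightarrow> (\<exists>U. open U \<and> 0 \<in> U \<and>
       (\<forall>z\<in>U. indep2 (e 1 + Re z *\<^sub>R e 3) (- e 2 + Im z *\<^sub>R e 3) \<and> f2 z \<in> ball 0 \<rho> \<and>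
          w (e 1 + Re z *\<^sub>R e 3) (- e 2 + Im z *\<^sub>R e 3) = cvec_of_real (e 1) + T2 (f2 z) *s cvec_of_real (- e 2) + f2 z *s cvec_of_real (e 3)) \<and>
       (\<forall>s\<in>ball (0::complex) \<rho>. \<exists>z\<in>U. f2 z = s))"
    using graph[OF i2, of "e 3"] unfolding f2_def t0'_def minus_minus by (elim exE conjE)
  \<comment> \<open>The values that \<open>k1 + k2 * t\<close> must take at \<open>t0\<close> and
    \<open>t0'\<close> for the linear terms of \<open>num\<close> along the two graphs to vanish;
    \<open>k1\<close> and \<open>k2\<close> come from linear interpolation.\<close>
  define A1 where "A1 = - (t0 - t0') * deriv T1 0"
  define A2 where "A2 = deriv T2 0 * (t0' - t0)"
  define k2 where "k2 = (A1 - A2) / (t0 - t0')"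
  define k1 where "k1 = A1 - k2 * t0"
  have k: "k1 + k2 * t0 = A1" "k1 + k2 * t0' = A2"
  proof -
    show "k1 + k2 * t0 = A1" by (simp add: k1_def)
    have "k2 * (t0 - t0') = A1 - A2" using t0 by (simp add: k2_def)
    then show "k1 + k2 * t0' = A2" by (simp add: k1_def algebra_simps)
  qed
  define num where "num z = (z $ 2 - t0 * z $ 1) * (z $ 2 - t0' * z $ 1) + z $ 3 * (k1 * z $ 1 + k2 * z $ 2)" for z :: "complex^3"
  have num_scale: "num (k *s z) = k\<^sup>2 * num z" for k z by (simp add: num_def power2_eq_square algebra_simps)
  have dT1: "(T1 has_field_derivative deriv T1 0) (at 0)" and dT2: "(T2 has_field_derivative deriv T2 0) (at 0)"
    using T1(1) T2(1) r1 r2 holomorphic_derivI[OF _ open_ball] by (metis centre_in_ball)+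
  \<comment> \<open>\<open>h1\<close> and \<open>h2\<close> are \<open>num\<close> along the two
    graphs, at the points with coordinates (1, T1 s, s) and (1, - T2 s, s).\<close>
  define h1 where "h1 s = (T1 s - t0) * (T1 s - t0') + s * (k1 + k2 * T1 s)" for s
  define h2 where "h2 s = (- T2 s - t0) * (- T2 s - t0') + s * (k1 + k2 * - T2 s)" for s
  have "\<exists>H. H holomorphic_on ball 0 r1 \<and> (\<forall>s\<in>ball 0 r1. h1 s = s\<^sup>2 * H s)"
  proof (rule double_zero_quotient)
    show "h1 holomorphic_on ball 0 r1" unfolding h1_def by (intro holomorphic_intros T1)
    have "(h1 has_field_derivative (deriv T1 0 * (T1 0 - t0') + deriv T1 0 * (T1 0 - t0) + (0 * (k2 * deriv T1 0) + (k1 + k2 * T1 0)))) (at 0)"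
      unfolding h1_def by (auto intro!: derivative_eq_intros dT1)
    moreover have "deriv T1 0 * (T1 0 - t0') + deriv T1 0 * (T1 0 - t0) + (0 * (k2 * deriv T1 0) + (k1 + k2 * T1 0)) = 0"
      unfolding T1(2) k(1) A1_def by (simp add: algebra_simps)
    ultimately show "(h1 has_field_derivative 0) (at 0)" by simp
  qed (use r1 T1 in \<open>auto simp: h1_def\<close>)
  then obtain H1 where H1: "H1 holomorphic_on ball 0 r1" "\<And>s. s \<in> ball 0 r1 \<Longrightarrow> h1 s = s\<^sup>2 * H1 s" by blast
  have "\<exists>H. H holomorphic_on ball 0 r2 \<and> (\<forall>s\<in>ball 0 r2. h2 s = s\<^sup>2 * H s)"
  proof (rule double_zero_quotient)
    show "h2 holomorphic_on ball 0 r2" unfolding h2_def by (intro holomorphic_intros T2)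
    have "(h2 has_field_derivative (- deriv T2 0 * (- T2 0 - t0') + - deriv T2 0 * (- T2 0 - t0) + (0 * (k2 * - deriv T2 0) + (k1 + k2 * - T2 0)))) (at 0)"
      unfolding h2_def by (auto intro!: derivative_eq_intros dT2)
    moreover have "- deriv T2 0 * (- T2 0 - t0') + - deriv T2 0 * (- T2 0 - t0) + (0 * (k2 * - deriv T2 0) + (k1 + k2 * - T2 0)) = 0"
      unfolding T2(2) minus_minus k(2) A2_def by (simp add: algebra_simps)
    ultimately show "(h2 has_field_derivative 0) (at 0)" by simp
  qed (use r2 T2 in \<open>auto simp: h2_def\<close>)
  then obtain H2 where H2: "H2 holomorphic_on ball 0 r2" "\<And>s. s \<in> ball 0 r2 \<Longrightarrow> h2 s = s\<^sup>2 * H2 s" by blast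
  \<comment> \<open>At the poles the quotient is completed by its limits, and the sign of the minor
    of the first two coordinates tells which orientation is meant.\<close>
  define F where "F x = (let z = w (fst x) (snd x) in if z $ 3 \<noteq> 0 then num z / (z $ 3)\<^sup>2
     else if fst x $ 1 * snd x $ 2 - fst x $ 2 * snd x $ 1 > 0 then H1 0 else H2 0)" for x
  have w3: "w u v $ 3 = 0 \<longleftrightarrow> u $ 3 = 0 \<and> v $ 3 = 0" if "indep2 u v" for u v
    using Im_t[OF that] by (auto simp: w_def complex_eq_iff)
  have inv: "plane_invariant F" unfolding plane_invariant_def
  proof (intro allI impI)
    fix u v :: "real^3" and a b c d :: real assume i: "indep2 u v" and D: "a * d - b * c > 0"
    let ?u = "a *\<^sub>R u + b *\<^sub>R v" and ?v = "c *\<^sub>R u + d *\<^sub>R v"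
    obtain k where k: "k \<noteq> 0" "w ?u ?v = k *s w u v" by (rule w_base[OF i D])
    have "?u $ 1 * ?v $ 2 - ?u $ 2 * ?v $ 1 = (a * d - b * c) * (u $ 1 * v $ 2 - u $ 2 * v $ 1)"
      by (simp add: algebra_simps)
    then have "?u $ 1 * ?v $ 2 - ?u $ 2 * ?v $ 1 > 0 \<longleftrightarrow> u $ 1 * v $ 2 - u $ 2 * v $ 1 > 0"
      using D by (simp add: zero_less_mult_iff)
    then show "F (?u, ?v) = F (u, v)"
      unfolding F_def Let_def fst_conv snd_conv k(2) num_scale using k(1) by (simp add: power_mult_distrib)
  qed
  have chart1: "holo_chart F (e 1) (e 2)"
  proof -
    from g1[rule_format, OF r1 order_refl] obtain U where U: "open U" "0 \<in> U"
      "\<forall>z\<in>U. indep2 (e 1 + Re z *\<^sub>R e 3) (e 2 + Im z *\<^sub>R e 3) \<and> f1 z \<in> ball 0 r1 \<and>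
          w (e 1 + Re z *\<^sub>R e 3) (e 2 + Im z *\<^sub>R e 3) = cvec_of_real (e 1) + T1 (f1 z) *s cvec_of_real (e 2) + f1 z *s cvec_of_real (e 3)"
      "\<forall>s\<in>ball (0::complex) r1. \<exists>z\<in>U. f1 z = s" by (elim exE conjE)
    have "F (e 1 + Re z *\<^sub>R e 3, e 2 + Im z *\<^sub>R e 3) = H1 (f1 z)" if "z \<in> U" for z
    proof -
      have wz: "w (e 1 + Re z *\<^sub>R e 3) (e 2 + Im z *\<^sub>R e 3) = cvec_of_real (e 1) + T1 (f1 z) *s cvec_of_real (e 2) + f1 z *s cvec_of_real (e 3)" and b: "f1 z \<in> ball 0 r1"
        using U(3) that by blast+
      have c: "(cvec_of_real (e 1) + T1 (f1 z) *s cvec_of_real (e 2) + f1 z *s cvec_of_real (e 3)) $ 1 = 1"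
        "(cvec_of_real (e 1) + T1 (f1 z) *s cvec_of_real (e 2) + f1 z *s cvec_of_real (e 3)) $ 2 = T1 (f1 z)"
        "(cvec_of_real (e 1) + T1 (f1 z) *s cvec_of_real (e 2) + f1 z *s cvec_of_real (e 3)) $ 3 = f1 z"
        by (simp_all add: e_nth)
      show ?thesis
        unfolding F_def Let_def fst_conv snd_conv wz num_def c using H1(2)[OF b] by (simp add: e_nth h1_def)
    qed
    then show ?thesis unfolding holo_chart_def
      using e_indep3(1) r1 H1(1) U f1 by (intro exI[of _ "e 3"] exI[of _ r1] exI[of _ H1] exI[of _ f1] exI[of _ U]) simp
  qed
  have chart2: "holo_chart F (e 1) (- e 2)"
  proof -
    from g2[rule_format, OF r2 order_refl] obtain U where U: "open U" "0 \<in> U"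
      "\<forall>z\<in>U. indep2 (e 1 + Re z *\<^sub>R e 3) (- e 2 + Im z *\<^sub>R e 3) \<and> f2 z \<in> ball 0 r2 \<and>
          w (e 1 + Re z *\<^sub>R e 3) (- e 2 + Im z *\<^sub>R e 3) = cvec_of_real (e 1) + T2 (f2 z) *s cvec_of_real (- e 2) + f2 z *s cvec_of_real (e 3)"
      "\<forall>s\<in>ball (0::complex) r2. \<exists>z\<in>U. f2 z = s" by (elim exE conjE)
    have "F (e 1 + Re z *\<^sub>R e 3, - e 2 + Im z *\<^sub>R e 3) = H2 (f2 z)" if "z \<in> U" for z
    proof -
      have wz: "w (e 1 + Re z *\<^sub>R e 3) (- e 2 + Im z *\<^sub>R e 3) = cvec_of_real (e 1) + T2 (f2 z) *s cvec_of_real (- e 2) + f2 z *s cvec_of_real (e 3)" and b: "f2 z \<in> ball 0 r2"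
        using U(3) that by blast+
      have c: "(cvec_of_real (e 1) + T2 (f2 z) *s cvec_of_real (- e 2) + f2 z *s cvec_of_real (e 3)) $ 1 = 1"
        "(cvec_of_real (e 1) + T2 (f2 z) *s cvec_of_real (- e 2) + f2 z *s cvec_of_real (e 3)) $ 2 = - T2 (f2 z)"
        "(cvec_of_real (e 1) + T2 (f2 z) *s cvec_of_real (- e 2) + f2 z *s cvec_of_real (e 3)) $ 3 = f2 z"
        by (simp_all add: e_nth)
      show ?thesis
        unfolding F_def Let_def fst_conv snd_conv wz num_def c using H2(2)[OF b] by (simp add: e_nth h2_def)
    qed
    then show ?thesis unfolding holo_chart_def
      using e_indep3(2) r2 H2(1) U f2 by (intro exI[of _ "e 3"] exI[of _ r2] exI[of _ H2] exI[of _ f2] exI[of _ U]) simp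
  qed
  \<comment> \<open>A vanishing third coordinate of \<open>w u v\<close> leaves just one plane;
    every basis of it is a positive base change of \<open>e 1\<close> with either \<open>e 2\<close>
    or \<open>- e 2\<close>.\<close>
  have pole_planes: "(\<exists>a b c d. a * d - b * c > 0 \<and> u = a *\<^sub>R e 1 + b *\<^sub>R e 2 \<and> v = c *\<^sub>R e 1 + d *\<^sub>R e 2) \<or>
      (\<exists>a b c d. a * d - b * c > 0 \<and> u = a *\<^sub>R e 1 + b *\<^sub>R (- e 2) \<and> v = c *\<^sub>R e 1 + d *\<^sub>R (- e 2))"
    if i: "indep2 u v" and z: "u $ 3 = 0" "v $ 3 = 0" for u v
  proof -
    have u: "u = u $ 1 *\<^sub>R e 1 + u $ 2 *\<^sub>R e 2" "v = v $ 1 *\<^sub>R e 1 + v $ 2 *\<^sub>R e 2"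
      using z by (simp_all add: vec_eq_iff forall_3 e_nth)
    have "u $ 1 * v $ 2 - u $ 2 * v $ 1 \<noteq> 0"
    proof
      assume D: "u $ 1 * v $ 2 - u $ 2 * v $ 1 = 0"
      have "v $ 2 *\<^sub>R u + (- (u $ 2)) *\<^sub>R v = 0" "v $ 1 *\<^sub>R u + (- (u $ 1)) *\<^sub>R v = 0"
        using D z by (simp_all add: vec_eq_iff forall_3 algebra_simps)
      then have "u $ 1 = 0" "u $ 2 = 0" using indep2D[OF i] by fastforce+
      then show False using indep2_nz[OF i] z by (simp add: vec_eq_iff forall_3)
    qed
    then consider "u $ 1 * v $ 2 - u $ 2 * v $ 1 > 0" | "u $ 1 * (- v $ 2) - (- u $ 2) * v $ 1 > 0" by fastforce
    then show ?thesis
    proof cases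
      case 1 then show ?thesis using u by blast
    next
      case 2
      have "u = u $ 1 *\<^sub>R e 1 + (- u $ 2) *\<^sub>R (- e 2)" "v = v $ 1 *\<^sub>R e 1 + (- v $ 2) *\<^sub>R (- e 2)" using u by simp_all
      then show ?thesis using 2 by blast
    qed
  qed
  have reg: "max_regular F (u, v)" if i: "indep2 u v" for u v
  proof (cases "w u v $ 3 = 0")
    case True
    then have "u $ 3 = 0" "v $ 3 = 0" using w3[OF i] by auto
    from pole_planes[OF i this] show ?thesis
      using max_regular_plane[OF inv i1 _ holo_chart_max_regular[OF inv chart1]]
        max_regular_plane[OF inv i2 _ holo_chart_max_regular[OF inv chart2]] by blast
  next
    case False
    obtain y where y: "indep3 u v y" using exists_indep3[OF _ i] by auto
    define f where "f = (\<lambda>z. of_real (Re z) + t (u + Re z *\<^sub>R y) (v + Im z *\<^sub>R y) * of_real (Im z))"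
    obtain r T where r: "r > (0::real)" and T: "T holomorphic_on ball 0 r" "T 0 = t u v" and f: "isCont f 0" "f 0 = 0"
      and g: "\<forall>\<rho>. 0 < \<rho> \<longrightarrow> \<rho> \<le> r \<longrightarrow> (\<exists>U. open U \<and> 0 \<in> U \<and>
       (\<forall>z\<in>U. indep2 (u + Re z *\<^sub>R y) (v + Im z *\<^sub>R y) \<and> f z \<in> ball 0 \<rho> \<and>
          w (u + Re z *\<^sub>R y) (v + Im z *\<^sub>R y) = cvec_of_real u + T (f z) *s cvec_of_real v + f z *s cvec_of_real y) \<and>
       (\<forall>s\<in>ball (0::complex) \<rho>. \<exists>z\<in>U. f z = s))"
      using graph[OF i, of y] unfolding f_def by (elim exE conjE)
    define W where "W s = cvec_of_real u + T s *s cvec_of_real v + s *s cvec_of_real y" for s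
    have holW: "(\<lambda>s. W s $ j) holomorphic_on ball 0 r" for j
      unfolding W_def by (simp, intro holomorphic_intros T)
    have "W 0 $ 3 \<noteq> 0" using False T(2) by (simp add: W_def w_def)
    moreover have "isCont (\<lambda>s. W s $ 3) 0" using holomorphic_on_imp_continuous_on[OF holW] r
      by (simp add: continuous_on_eq_continuous_at)
    ultimately have "\<forall>\<^sub>F s in nhds 0. W s $ 3 \<noteq> 0"
      using isCont_tendsto_nhds[where f="\<lambda>s. W s $ 3" and a=0] tendsto_imp_eventually_ne by blast
    then obtain \<delta> where \<delta>: "\<delta> > 0" "\<And>s. dist s 0 < \<delta> \<Longrightarrow> W s $ 3 \<noteq> 0" unfolding eventually_nhds_metric by blast
    \<comment> \<open>The disc is shrunk until the third coordinate has no zero on it, so that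
      \<open>num\<close> over its square is holomorphic there.\<close>
    define \<rho> where "\<rho> = min \<delta> r"
    have \<rho>: "0 < \<rho>" "\<rho> \<le> r" using \<delta> r by (auto simp: \<rho>_def)
    have nz: "W s $ 3 \<noteq> 0" if "s \<in> ball 0 \<rho>" for s using that \<delta>(2)[of s] by (simp add: \<rho>_def dist_commute)
    from g[rule_format, OF \<rho>] obtain U where U: "open U" "0 \<in> U"
      "\<forall>z\<in>U. indep2 (u + Re z *\<^sub>R y) (v + Im z *\<^sub>R y) \<and> f z \<in> ball 0 \<rho> \<and>
          w (u + Re z *\<^sub>R y) (v + Im z *\<^sub>R y) = W (f z)"
      "\<forall>s\<in>ball (0::complex) \<rho>. \<exists>z\<in>U. f z = s" unfolding W_def by (elim exE conjE)
    define H where "H s = num (W s) / (W s $ 3)\<^sup>2" for s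
    have sub: "ball 0 \<rho> \<subseteq> ball (0::complex) r" using \<rho> by (simp add: subset_ball)
    have "H holomorphic_on ball 0 \<rho>" unfolding H_def num_def
      using nz by (intro holomorphic_intros holomorphic_on_subset[OF holW sub]) auto
    moreover have "F (u + Re z *\<^sub>R y, v + Im z *\<^sub>R y) = H (f z)" if "z \<in> U" for z
      using U(3) that nz[of "f z"] unfolding F_def Let_def H_def by simp
    ultimately have "holo_chart F u v" unfolding holo_chart_def
      using y \<rho>(1) U f by (intro exI[of _ y] exI[of _ \<rho>] exI[of _ H] exI[of _ f] exI[of _ U]) simp
    then show ?thesis using holo_chart_max_regular[OF inv] by blast
  qed
  have "\<exists>C. \<forall>u v. indep2 u v \<longrightarrow> F (u, v) = C"
    by (rule plane_invariant_constant[OF _ inv _ _ i1]) (use reg in \<open>auto simp: max_regular_def\<close>)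
  then obtain C where C: "\<And>u v. indep2 u v \<Longrightarrow> F (u, v) = C" by blast
  have fin: "num (w u v) - C * (w u v $ 3)\<^sup>2 = 0" if i: "indep2 u v" for u v
  proof (cases "w u v $ 3 = 0")
    case False
    then have "num (w u v) / (w u v $ 3)\<^sup>2 = C" using C[OF i] by (simp add: F_def Let_def)
    then show ?thesis using False by (simp add: field_simps)
  next
    case True
    \<comment> \<open>Constancy of \<open>F\<close> says nothing about \<open>num\<close> at the
      poles; there \<open>num\<close> vanishes by the choice of its roots, and homogeneity extends
      this to other bases.\<close>
    have "num (w (e 1) (e 2)) = 0" "num (w (e 1) (- e 2)) = 0"
      by (simp_all add: num_def w_def e_nth t0_def t0'_def)
    moreover have "u $ 3 = 0" "v $ 3 = 0" using w3[OF i] True by auto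
    from pole_planes[OF i this] have "\<exists>k. w u v = k *s w (e 1) (e 2) \<or> w u v = k *s w (e 1) (- e 2)"
      using w_base[OF i1] w_base[OF i2] by metis
    ultimately have "num (w u v) = 0" by (auto simp: num_scale)
    then show ?thesis using True by simp
  qed
  show ?thesis
  proof (rule exI[of _ "t0 * t0'"], rule exI[of _ "- t0 - t0'"], rule exI[of _ k1], rule exI[of _ k2], rule exI[of _ "- C"], intro allI impI)
    fix u v :: "real^3" assume "indep2 u v"
    from fin[OF this] show "(w u v $ 2)\<^sup>2 + (- t0 - t0') * w u v $ 1 * w u v $ 2 + t0 * t0' * (w u v $ 1)\<^sup>2 + k1 * w u v $ 1 * w u v $ 3
      + k2 * w u v $ 2 * w u v $ 3 + - C * (w u v $ 3)\<^sup>2 = 0"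
      by (simp add: num_def power2_eq_square algebra_simps)
  qed
qed

end

section \<open>The quadric of a section\<close>

lemma indep2_spanI:
  assumes "v \<noteq> 0" "u \<notin> span {v}" shows "indep2 u v"
  unfolding indep2_def
proof (intro allI impI)
  fix a b assume e: "a *\<^sub>R u + b *\<^sub>R v = 0"
  have "a = 0"
  proof (rule ccontr)
    assume "a \<noteq> 0"
    have "a *\<^sub>R u = (- b) *\<^sub>R v" using e by (simp add: add_eq_0_iff)
    then have "a *\<^sub>R u \<in> span {v}" using span_scale[OF span_base[of v "{v}"], of "- b"] by simp
    then have "(1 / a) *\<^sub>R (a *\<^sub>R u) \<in> span {v}" by (rule span_scale)
    then show False using assms(2) \<open>a \<noteq> 0\<close> by simp
  qed
  then show "a = 0 \<and> b = 0" using e assms(1) by simp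
qed

text \<open>The vectors \<open>x\<close>, \<open>y\<close>, \<open>v\<close> may be dependent, so
  the basis of a 3-space around them is completed as needed, keeping \<open>v\<close> as a basis
  vector.\<close>

lemma exists_indep3_containing:
  fixes v x y :: "real^'n"
  assumes n: "CARD('n) \<ge> 3" and v: "v \<noteq> 0"
  obtains e1 e3 where "indep3 e1 v e3" "x \<in> span {e1, v}" "\<exists>a b c. y = a *\<^sub>R e1 + b *\<^sub>R v + c *\<^sub>R e3"
proof -
  obtain e1 where e1: "indep2 e1 v" "x \<in> span {e1, v}"
  proof (cases "x \<in> span {v}")
    case False
    then show ?thesis using that[of x] indep2_spanI[OF v] span_base[of x "{x, v}"] by simp
  next
    case True
    have "dim (span {v}) \<le> card {v}" by (simp add: dim_le_card')
    then have "dim (span {v}) < DIM(real^'n)" using n by simp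
    then have "span {v} \<noteq> UNIV" by (metis dim_UNIV dim_span less_irrefl)
    then obtain e1 where "e1 \<notin> span {v}" by blast
    then show ?thesis using that[of e1] indep2_spanI[OF v] True span_mono[of "{v}" "{e1, v}"] by blast
  qed
  show ?thesis
  proof (cases "y \<in> span {e1, v}")
    case True
    then obtain a b where "y = a *\<^sub>R e1 + b *\<^sub>R v" using span2 by blast
    moreover obtain e3 where "indep3 e1 v e3" using exists_indep3[OF n e1(1)] by blast
    ultimately show ?thesis using that[of e1 e3] e1(2) by (metis add.right_neutral scaleR_zero_left)
  next
    case False
    have "y = 0 *\<^sub>R e1 + 0 *\<^sub>R v + 1 *\<^sub>R y" by simp
    then show ?thesis using that[OF indep3I[OF e1(1) False] e1(2)] by blast
  qed
qed

lemma monic_quadratic_roots: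
  fixes t s b c :: "'a::field"
  assumes "t\<^sup>2 + b * t + c = 0" "s\<^sup>2 + b * s + c = 0" "t \<noteq> s"
  shows "b = - (t + s)" "c = t * s"
proof -
  have "(t - s) * (t + s + b) = (t\<^sup>2 + b * t + c) - (s\<^sup>2 + b * s + c)" by (simp add: power2_eq_square algebra_simps)
  then have "t + s + b = 0" using assms by simp
  then show b: "b = - (t + s)" by (simp add: eq_neg_iff_add_eq_0 algebra_simps)
  show "c = t * s" using assms(1) unfolding b by (simp add: power2_eq_square algebra_simps)
qed

context holomorphic_section
begin

lemma plane_field3_restrict:
  fixes L :: "real^3 \<Rightarrow> real^'n"
  assumes L: "linear L" "inj L"
  shows "plane_field3 (\<lambda>x y. tau (L x) (L y))"
proof -
  interpret L: linear L by fact
  have ind: "indep2 (L x) (L y) \<longleftrightarrow> indep2 x y" for x y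
  proof -
    have "a *\<^sub>R L x + b *\<^sub>R L y = 0 \<longleftrightarrow> a *\<^sub>R x + b *\<^sub>R y = 0" for a b
      using linear_injective_0[OF L(1)] L(2) by (metis L.add L.scale L.zero)
    then show ?thesis unfolding indep2_def by simp
  qed
  show ?thesis
  proof
    fix u v :: "real^3" assume i: "indep2 u v"
    then show "Im (tau (L u) (L v)) > 0" using tau(1) ind by blast
    show "(of_real a + tau (L (a *\<^sub>R u + b *\<^sub>R v)) (L (c *\<^sub>R u + d *\<^sub>R v)) * of_real c) * tau (L u) (L v)
       = of_real b + tau (L (a *\<^sub>R u + b *\<^sub>R v)) (L (c *\<^sub>R u + d *\<^sub>R v)) * of_real d" if "a * d - b * c > 0" for a b c d
      using tau_base[of "L u" "L v" a d b c] ind i that by (simp add: L.add L.scale)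
    have cL: "isCont L x" for x using L(1) by (simp add: linear_conv_bounded_linear linear_continuous_at)
    have "isCont (\<lambda>x. (L (fst x), L (snd x))) (u, v)"
      using isCont_o2[of "(u, v)" fst L] isCont_o2[of "(u, v)" snd L] cL by (intro continuous_intros) auto
    moreover have "isCont (\<lambda>x. tau (fst x) (snd x)) (L (fst (u, v)), L (snd (u, v)))" using isCont_tau ind i by simp
    ultimately show "isCont (\<lambda>x. tau (L (fst x)) (L (snd x))) (u, v)"
      using isCont_o2[where g="\<lambda>x. tau (fst x) (snd x)" and f="\<lambda>x. (L (fst x), L (snd x))"] by simp
    fix y :: "real^3"
    have Le: "L (u + r *\<^sub>R y) = L u + r *\<^sub>R L y" "L (v + r *\<^sub>R y) = L v + r *\<^sub>R L y" for r by (simp_all add: L.add L.scale)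
    show "\<exists>U p. open U \<and> 0 \<in> U \<and> continuous_on U p \<and>
      (\<forall>z\<in>U. indep2 (u + Re z *\<^sub>R y) (v + Im z *\<^sub>R y)) \<and>
      (\<forall>z\<in>U. ((\<lambda>z. tau (L (u + Re z *\<^sub>R y)) (L (v + Im z *\<^sub>R y))) has_derivative
         (\<lambda>h. p z * (of_real (Re h) + tau (L (u + Re z *\<^sub>R y)) (L (v + Im z *\<^sub>R y)) * of_real (Im h)))) (at z))"
      unfolding ind[symmetric] unfolding Le by (rule local_tau) (use i ind in simp)
  qed
qed

end

section \<open>From the conics of the 3-spaces to one quadratic form\<close>

locale normalized_section = holomorphic_section \<sigma>
  for \<sigma> :: "((real^'n) \<times> (real^'n)) set \<Rightarrow> (complex^'n) set" +
  fixes v0 :: "real^'n"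
  assumes card: "CARD('n) \<ge> 3" and v0: "v0 \<noteq> 0"
begin

text \<open>The product of the two roots of the quadratic form along the line through x in direction v0,
  normalized to take the value 1 at v0.\<close>
definition q :: "real^'n \<Rightarrow> complex" where
  "q x = (if indep2 x v0 then - (tau x v0 * tau x (- v0)) else (of_real ((x \<bullet> v0) / (v0 \<bullet> v0)))\<^sup>2)"

lemma not_indep2_v0:
  assumes "\<not> indep2 x v0"
  obtains c where "x = c *\<^sub>R v0"
proof -
  obtain a b where ab: "a *\<^sub>R x + b *\<^sub>R v0 = 0" "a \<noteq> 0 \<or> b \<noteq> 0" using assms unfolding indep2_def by blast
  then have "a \<noteq> 0" using v0 by auto
  have "a *\<^sub>R (x + (b / a) *\<^sub>R v0) = 0" using ab(1) \<open>a \<noteq> 0\<close> by (simp add: scaleR_add_right)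
  then have "x = (- b / a) *\<^sub>R v0" using \<open>a \<noteq> 0\<close> by (simp add: eq_neg_iff_add_eq_0)
  then show ?thesis using that by blast
qed

lemma q_nz: "x \<noteq> 0 \<Longrightarrow> q x \<noteq> 0"
proof (cases "indep2 x v0")
  case True
  then show ?thesis using tau(1)[OF True] tau(1)[OF indep2_minus[OF True]] by (auto simp: q_def)
next
  case False
  assume "x \<noteq> 0"
  moreover obtain c where "x = c *\<^sub>R v0" by (rule not_indep2_v0[OF False])
  ultimately show ?thesis using False v0 by (simp add: q_def)
qed

text \<open>In a 3-space that contains \<open>x\<close>, \<open>y\<close> and \<open>v0\<close> as
  second basis vector, \<open>quadric_exists\<close> gives a conic with coefficient 1 at the square
  of the \<open>v0\<close> coordinate. Vieta identifies its values on real vectors with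
  \<open>q\<close>, whatever 3-space was taken.\<close>

lemma q_quadratic_on_planes:
  "\<exists>B. (\<forall>a b. q (a *\<^sub>R x + b *\<^sub>R y) = of_real (a\<^sup>2) * q x + of_real (2 * a * b) * B + of_real (b\<^sup>2) * q y) \<and>
     (indep2 x y \<longrightarrow> q x + 2 * tau x y * B + (tau x y)\<^sup>2 * q y = 0)"
proof -
  obtain e1 e3 where ind: "indep3 e1 v0 e3" and x: "x \<in> span {e1, v0}" and y: "\<exists>a b c. y = a *\<^sub>R e1 + b *\<^sub>R v0 + c *\<^sub>R e3"
    by (rule exists_indep3_containing[OF card v0])
  define L where "L x = x $ 1 *\<^sub>R e1 + x $ 2 *\<^sub>R v0 + x $ 3 *\<^sub>R e3" for x :: "real^3"
  have lin: "linear L" unfolding L_def by (rule linearI) (auto simp: algebra_simps)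
  interpret L: linear L by (rule lin)
  have inj: "inj L"
  proof (subst linear_injective_0[OF lin], intro allI impI)
    fix c assume "L c = 0"
    then have "c $ 1 = 0" "c $ 2 = 0" "c $ 3 = 0" using indep3D[OF ind] unfolding L_def by blast+
    then show "c = 0" by (simp add: vec_eq_iff forall_3)
  qed
  interpret pf: plane_field3 "\<lambda>x y. tau (L x) (L y)" by (rule plane_field3_restrict[OF lin inj])
  obtain c11 c12 c13 c23 c33 where Q: "\<And>u v. indep2 u v \<Longrightarrow>
     (pf.w u v $ 2)\<^sup>2 + c12 * pf.w u v $ 1 * pf.w u v $ 2 + c11 * (pf.w u v $ 1)\<^sup>2 + c13 * pf.w u v $ 1 * pf.w u v $ 3
      + c23 * pf.w u v $ 2 * pf.w u v $ 3 + c33 * (pf.w u v $ 3)\<^sup>2 = 0"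
    using pf.quadric_exists by blast
  \<comment> \<open>Twice the polarization of the conic, which avoids fractions; this is why its
    value at \<open>e2\<close> is 2 and \<open>q\<close> is half of it.\<close>
  define P where "P u v = 2 * (u $ 2 * v $ 2) + c12 * (u $ 1 * v $ 2 + v $ 1 * u $ 2) + 2 * c11 * (u $ 1 * v $ 1)
     + c13 * (u $ 1 * v $ 3 + v $ 1 * u $ 3) + c23 * (u $ 2 * v $ 3 + v $ 2 * u $ 3) + 2 * c33 * (u $ 3 * v $ 3)" for u v :: "complex^3"
  let ?c = "cvec_of_real :: real^3 \<Rightarrow> complex^3"
  have Pt: "P (?c u) (?c u) + 2 * t * P (?c u) (?c v) + t\<^sup>2 * P (?c v) (?c v) = 0"
    if "indep2 u v" "t = tau (L u) (L v)" for u v t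
  proof -
    have "P (?c u) (?c u) + 2 * t * P (?c u) (?c v) + t\<^sup>2 * P (?c v) (?c v) = P (?c u + t *s ?c v) (?c u + t *s ?c v)"
      by (simp add: P_def power2_eq_square algebra_simps)
    also have "?c u + t *s ?c v = pf.w u v" by (simp add: pf.w_def that(2))
    also have "P (pf.w u v) (pf.w u v) = 2 * 0"
      unfolding Q[OF that(1), symmetric] by (simp add: P_def power2_eq_square algebra_simps)
    finally show ?thesis by simp
  qed
  define e2 where "e2 = (axis 2 1 :: real^3)"
  have Le2: "L e2 = v0" by (simp add: L_def e2_def axis_def)
  have P2: "P (?c e2) (?c e2) = 2" by (simp add: P_def e2_def axis_def)
  have indL: "indep2 (L u) (L v) \<longleftrightarrow> indep2 u v" for u v
  proof -
    have "a *\<^sub>R L u + b *\<^sub>R L v = 0 \<longleftrightarrow> a *\<^sub>R u + b *\<^sub>R v = 0" for a b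
      using linear_injective_0[OF lin] inj by (metis L.add L.scale L.zero)
    then show ?thesis unfolding indep2_def by simp
  qed
  have qL: "q (L u) = P (?c u) (?c u) / 2" for u
  proof (cases "indep2 u e2")
    case True
    let ?t = "tau (L u) v0" and ?s = "- tau (L u) (- v0)"
    have iL: "indep2 (L u) v0" using True indL[of u e2] Le2 by simp
    have a: "P (?c u) (?c u) + 2 * ?t * P (?c u) (?c e2) + ?t\<^sup>2 * 2 = 0"
      using Pt[OF True refl] P2 Le2 by simp
    \<comment> \<open>Reversing \<open>v0\<close> only flips the sign of the middle term, so
      \<open>- tau (L u) (- v0)\<close> is a root of the same quadratic; it lies in the lower half
      plane and is therefore the other root.\<close>
    have "P (?c u) (- ?c e2) = - P (?c u) (?c e2)" "P (- ?c e2) (- ?c e2) = P (?c e2) (?c e2)"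
      by (simp_all add: P_def algebra_simps)
    then have b: "P (?c u) (?c u) + 2 * ?s * P (?c u) (?c e2) + ?s\<^sup>2 * 2 = 0"
      using Pt[OF indep2_minus[OF True] refl] P2 Le2 by (simp add: cv_minus L.neg)
    have ne: "?t \<noteq> ?s" using tau(1)[OF iL] tau(1)[OF indep2_minus[OF iL]] by (auto simp: complex_eq_iff)
    have "P (?c u) (?c u) / 2 = ?t * ?s"
      by (rule monic_quadratic_roots(2)[OF _ _ ne, of "P (?c u) (?c e2)"]) (use a b in \<open>simp_all add: field_simps\<close>)
    then show ?thesis using iL by (simp add: q_def)
  next
    case False
    then have niL: "\<not> indep2 (L u) v0" using indL[of u e2] Le2 by simp
    obtain c where c: "L u = c *\<^sub>R v0" by (rule not_indep2_v0[OF niL])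
    then have "L u = L (c *\<^sub>R e2)" by (simp add: L.scale Le2)
    then have u: "u = c *\<^sub>R e2" using inj by (metis injD)
    \<comment> \<open>On multiples of \<open>v0\<close> there is no line to take roots on; the
      second branch of \<open>q\<close> is the square of the factor, which is the value of the
      normalized conic.\<close>
    show ?thesis using niL v0 unfolding q_def c
      by (simp add: u P_def e2_def axis_def power2_eq_square)
  qed
  obtain a1 a2 where "x = a1 *\<^sub>R e1 + a2 *\<^sub>R v0" using x span2 by blast
  then have xL: "x = L (vector [a1, a2, 0])" by (simp add: L_def)
  obtain b1 b2 b3 where "y = b1 *\<^sub>R e1 + b2 *\<^sub>R v0 + b3 *\<^sub>R e3" using y by blast
  then have yL: "y = L (vector [b1, b2, b3])" by (simp add: L_def)
  define x' y' where "x' = (vector [a1, a2, 0] :: real^3)" and "y' = (vector [b1, b2, b3] :: real^3)"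
  have xy: "x = L x'" "y = L y'" using xL yL by (simp_all add: x'_def y'_def)
  define B where "B = P (?c x') (?c y') / 2"
  show ?thesis
  proof (intro exI[of _ B] conjI allI impI)
    fix a b :: real
    have "q (a *\<^sub>R x + b *\<^sub>R y) = q (L (a *\<^sub>R x' + b *\<^sub>R y'))" by (simp add: xy L.add L.scale)
    also have "\<dots> = P (of_real a *s ?c x' + of_real b *s ?c y') (of_real a *s ?c x' + of_real b *s ?c y') / 2"
      unfolding qL cv_add cv_scaleR ..
    also have "\<dots> = of_real (a\<^sup>2) * (P (?c x') (?c x') / 2) + of_real (2 * a * b) * B + of_real (b\<^sup>2) * (P (?c y') (?c y') / 2)"
      unfolding B_def P_def by (simp add: power2_eq_square field_simps)
    finally show "q (a *\<^sub>R x + b *\<^sub>R y) = of_real (a\<^sup>2) * q x + of_real (2 * a * b) * B + of_real (b\<^sup>2) * q y"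
      by (simp add: xy qL)
  next
    assume "indep2 x y"
    then have "indep2 x' y'" using indL xy by simp
    from Pt[OF this refl] show "q x + 2 * tau x y * B + (tau x y)\<^sup>2 * q y = 0"
      unfolding xy qL B_def by (simp add: field_simps)
  qed
qed

definition "B x y = (q (x + y) - q (x - y)) / 4"

lemma q_combine: "q (a *\<^sub>R x + b *\<^sub>R y) = of_real (a\<^sup>2) * q x + of_real (2 * a * b) * B x y + of_real (b\<^sup>2) * q y"
  and q_tau: "indep2 x y \<Longrightarrow> q x + 2 * tau x y * B x y + (tau x y)\<^sup>2 * q y = 0"
proof -
  obtain B' where B': "\<And>a b. q (a *\<^sub>R x + b *\<^sub>R y) = of_real (a\<^sup>2) * q x + of_real (2 * a * b) * B' + of_real (b\<^sup>2) * q y"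
    "indep2 x y \<longrightarrow> q x + 2 * tau x y * B' + (tau x y)\<^sup>2 * q y = 0"
    using q_quadratic_on_planes[of x y] by blast
  have "B x y = B'" unfolding B_def using B'(1)[of 1 1] B'(1)[of 1 "-1"] by simp
  then show "q (a *\<^sub>R x + b *\<^sub>R y) = of_real (a\<^sup>2) * q x + of_real (2 * a * b) * B x y + of_real (b\<^sup>2) * q y"
    "indep2 x y \<Longrightarrow> q x + 2 * tau x y * B x y + (tau x y)\<^sup>2 * q y = 0" using B' by auto
qed

lemma parallelogram: "q (x + y) + q (x - y) = 2 * q x + 2 * q y"
  using q_combine[of 1 x 1 y] q_combine[of 1 x "-1" y] by simp

lemma q_scale: "q (c *\<^sub>R x) = of_real (c\<^sup>2) * q x"
  using q_combine[of c x 0 x] by simp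

lemma q_minus: "q (- x) = q x"
  using q_scale[of "-1" x] by simp

lemma B_sym: "B x y = B y x"
  unfolding B_def using q_minus[of "x - y"] by (simp add: add.commute)

lemma B_self: "B x x = q x"
  unfolding B_def using q_scale[of 2 x] q_scale[of 0 x] by (simp flip: scaleR_2)

lemma B_scale: "B (c *\<^sub>R x) y = of_real c * B x y"
  using q_combine[of c x 1 y] q_combine[of c x "-1" y] by (simp add: B_def[of "c *\<^sub>R x"])

text \<open>The Jordan-von Neumann argument: the parallelogram law yields \<open>jvn\<close>, and
  applying it to half the sum and half the difference of the two vectors, together with
  \<open>B_scale\<close>, gives additivity.\<close>

lemma B_add: "B (x + x') y = B x y + B x' y"
proof -
  have jvn: "B (a + b) y + B (a - b) y = 2 * B a y" for a b
  proof -
    have h1: "q (a + b + y) + q (a - b + y) = 2 * q (a + y) + 2 * q b" using parallelogram[of "a + y" b] by (simp add: algebra_simps)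
    have h2: "q (a + b - y) + q (a - b - y) = 2 * q (a - y) + 2 * q b" using parallelogram[of "a - y" b] by (simp add: algebra_simps)
    have "B (a + b) y + B (a - b) y = ((q (a + b + y) + q (a - b + y)) - (q (a + b - y) + q (a - b - y))) / 4"
      unfolding B_def by (simp add: diff_divide_distrib add_divide_distrib)
    also have "\<dots> = 2 * B a y" unfolding h1 h2 B_def by (simp add: diff_divide_distrib add_divide_distrib)
    finally show ?thesis .
  qed
  let ?a = "(1/2) *\<^sub>R (x + x')" and ?b = "(1/2) *\<^sub>R (x - x')"
  have "?a + ?b = x" "?a - ?b = x'" by (simp_all add: algebra_simps flip: scaleR_add_left)
  then have "B x y + B x' y = 2 * B ?a y" using jvn[of ?a ?b] by simp
  also have "\<dots> = B (x + x') y" by (simp add: B_scale)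
  finally show ?thesis by simp
qed

definition "A = (\<chi> i j. B (axis i 1) (axis j 1))"

lemma A_sym: "transpose A = A"
  by (simp add: A_def transpose_def vec_eq_iff B_sym)

lemma qb_A: "qb A (cvec_of_real x) (cvec_of_real y) = B x y"
proof -
  have lin: "linear (\<lambda>x. B x y)" for y
    by (rule linearI) (simp_all add: B_add B_scale scaleR_conv_of_real[where 'a=complex])
  have exp: "B x y = (\<Sum>i\<in>UNIV. of_real (x $ i) * B (axis i 1) y)" for x y
  proof -
    have "B x y = B (\<Sum>i\<in>UNIV. x $ i *\<^sub>R axis i 1) y"
      using basis_expansion[of x] by (simp add: scalar_mult_eq_scaleR)
    also have "\<dots> = (\<Sum>i\<in>UNIV. of_real (x $ i) * B (axis i 1) y)"
      by (simp add: linear_sum[OF lin] B_scale)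
    finally show ?thesis .
  qed
  have e2: "B (axis i 1) y = (\<Sum>j\<in>UNIV. of_real (y $ j) * B (axis j 1) (axis i 1))" for i
    using exp[of y "axis i 1"] B_sym[of y "axis i 1"] by simp
  have "B x y = (\<Sum>i\<in>UNIV. of_real (x $ i) * (\<Sum>j\<in>UNIV. of_real (y $ j) * B (axis j 1) (axis i 1)))"
    using exp[of x y] e2 by simp
  also have "\<dots> = qb A (cvec_of_real x) (cvec_of_real y)"
    unfolding qb_def A_def by (intro sum.cong refl) (simp add: sum_distrib_left B_sym mult_ac)
  finally show ?thesis by simp
qed

text \<open>Applying \<open>q_tau\<close> to \<open>y\<close> and to \<open>- y\<close> produces one
  root in each half plane, hence a complete factorization.\<close>

lemma form_roots:
  assumes "indep2 x y"
  shows "q x + 2 * s * B x y + s\<^sup>2 * q y = q y * (s - tau x y) * (s + tau x (- y))"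
    "B x y = - q y * (tau x y - tau x (- y)) / 2"
proof -
  let ?t = "tau x y" and ?s = "- tau x (- y)"
  have qy: "q y \<noteq> 0" using q_nz indep2_nz[OF assms] by blast
  have "B x (- y) = - B x y" using B_scale[of "-1" y x] by (simp add: B_sym[of x])
  then have "q x + 2 * ?s * B x y + ?s\<^sup>2 * q y = 0" using q_tau[OF indep2_minus[OF assms]] by (simp add: q_minus)
  then have b: "?s\<^sup>2 + (2 * B x y / q y) * ?s + q x / q y = 0" using qy by (simp add: field_simps)
  have a: "?t\<^sup>2 + (2 * B x y / q y) * ?t + q x / q y = 0" using q_tau[OF assms] qy by (simp add: field_simps)
  have ne: "?t \<noteq> ?s" using tau(1)[OF assms] tau(1)[OF indep2_minus[OF assms]] by (auto simp: complex_eq_iff)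
  note r = monic_quadratic_roots[OF a b ne]
  have 1: "2 * B x y = - q y * (?t + ?s)" using r(1) qy by (simp add: field_simps)
  have 2: "q x = q y * (?t * ?s)" using r(2) qy by (simp add: field_simps)
  have "q x + s * (2 * B x y) + s\<^sup>2 * q y = q y * (s - tau x y) * (s + tau x (- y))"
    unfolding 1 unfolding 2 by (simp add: power2_eq_square algebra_simps)
  then show "q x + 2 * s * B x y + s\<^sup>2 * q y = q y * (s - tau x y) * (s + tau x (- y))" by (simp add: mult_ac)
  show "B x y = - q y * (tau x y - tau x (- y)) / 2"
  proof -
    have "B x y = (2 * B x y) / 2" by simp
    then show ?thesis unfolding 1 by simp
  qed
qed

lemma qb_A_complex: "qb A z z = q (vRe z) + 2 * \<i> * B (vRe z) (vIm z) - q (vIm z)"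
proof -
  have "qb A z z = qb A (cvec_of_real (vRe z) + \<i> *s cvec_of_real (vIm z)) (cvec_of_real (vRe z) + \<i> *s cvec_of_real (vIm z))"
    using cvec_decompose[of z] by simp
  then show ?thesis unfolding qb_expand[OF A_sym] qb_A B_self by simp
qed

text \<open>This is the factorization at s = i; the second factor cannot vanish since its imaginary
  part exceeds 1.\<close>

lemma zero_iff_tau:
  assumes "indep2 (vRe z) (vIm z)"
  shows "qb A z z = 0 \<longleftrightarrow> tau (vRe z) (vIm z) = \<i>"
proof -
  have "qb A z z = q (vIm z) * (\<i> - tau (vRe z) (vIm z)) * (\<i> + tau (vRe z) (- vIm z))"
    using form_roots(1)[OF assms, of \<i>] qb_A_complex[of z] by simp
  moreover have "q (vIm z) \<noteq> 0" using q_nz indep2_nz[OF assms] by blast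
  moreover have "\<i> + tau (vRe z) (- vIm z) \<noteq> 0" using tau(1)[OF indep2_minus[OF assms]] by (auto simp: complex_eq_iff)
  ultimately show ?thesis by auto
qed

text \<open>At a nonreal point both sides say that \<open>tau\<close> at its real and imaginary
  parts is i; a real point lies neither in the cone nor on the quadric, by
  \<open>q_nz\<close>.\<close>

lemma M_iff: "z \<noteq> 0 \<Longrightarrow> z \<in> M \<longleftrightarrow> qb A z z = 0"
proof (cases "indep2 (vRe z) (vIm z)")
  case True
  have z: "z = cvec_of_real (vRe z) + \<i> *s cvec_of_real (vIm z)" by (rule cvec_decompose)
  have "z \<in> M \<longleftrightarrow> tau (vRe z) (vIm z) = \<i>"
    using tau(3)[OF True] tau_unique[OF True, of \<i>] z by (metis imaginary_unit.sel(2) zero_less_one)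
  then show ?thesis using zero_iff_tau[OF True] by simp
next
  case False
  assume nz: "z \<noteq> 0"
  then have RP: "proj_point z \<in> RP" using False proj_point_RP_iff by blast
  then have "z \<notin> M" using in_M_iff[OF nz] section_point by force
  moreover have "qb A z z \<noteq> 0"
  proof -
    obtain c x where cx: "c \<noteq> 0" "x \<noteq> 0" "proj_point z = proj_point (c *s cvec_of_real x)" using RP unfolding RP_def by blast
    then obtain d where d: "d \<noteq> 0" "z = d *s (c *s cvec_of_real x)" using proj_point_eq_iff by metis
    show ?thesis using q_nz[OF cx(2)] cx(1) d(1) unfolding d(2) by (simp add: qb_linear qb_A B_self)
  qed
  ultimately show ?thesis by blast
qed

text \<open>A kernel vector is a zero of the form, hence nonreal with \<open>tau\<close> equal to i.
  Pairing it with its imaginary part says that the derivative of the quadratic along that line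
  vanishes at i, so i would be a double root, but the roots lie in opposite half planes.\<close>

lemma det_A: "det A \<noteq> 0"
proof
  assume "det A = 0"
  then obtain z where z: "z \<noteq> 0" "A *v z = 0"
    by (metis invertible_det_nz invertible_left_inverse matrix_left_invertible_ker)
  have rad: "qb A w z = 0" for w
  proof -
    have "qb A w z = (\<Sum>i\<in>UNIV. w $ i * (A *v z) $ i)"
      unfolding qb_def matrix_vector_mult_def by (simp add: sum_distrib_left mult_ac)
    then show ?thesis using z(2) by simp
  qed
  let ?x = "vRe z" and ?y = "vIm z"
  have "z \<in> M" using M_iff[OF z(1)] rad by blast
  then have "proj_point z \<notin> RP" using in_M_iff[OF z(1)] section_point by force
  then have i: "indep2 ?x ?y" using proj_point_RP_iff[OF z(1)] by blast
  have ti: "tau ?x ?y = \<i>" using zero_iff_tau[OF i] rad by blast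
  have "qb A (cvec_of_real ?y) (cvec_of_real ?x + \<i> *s cvec_of_real ?y) = 0"
    using rad cvec_decompose[of z] by metis
  then have "B ?x ?y + \<i> * q ?y = 0" by (simp add: qb_add_right qb_scale_right qb_A B_self B_sym[of ?x])
  then have "q ?y * (\<i> + tau ?x (- ?y)) = 0" using form_roots(2)[OF i] ti by (simp add: field_simps)
  moreover have "q ?y \<noteq> 0" using q_nz indep2_nz[OF i] by blast
  moreover have "\<i> + tau ?x (- ?y) \<noteq> 0" using tau(1)[OF indep2_minus[OF i]] by (auto simp: complex_eq_iff)
  ultimately show False by simp
qed

lemma smooth_quadric_image: "smooth_quadric (\<sigma> ` Gr2)"
proof -
  have "\<sigma> ` Gr2 = {proj_point z | z. z \<noteq> 0 \<and> qb A z z = 0}"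
  proof (intro equalityI subsetI)
    fix p assume p: "p \<in> \<sigma> ` Gr2"
    then obtain z where z: "z \<noteq> 0" "p = proj_point z" using section_point unfolding CP_def by blast
    then show "p \<in> {proj_point z | z. z \<noteq> 0 \<and> qb A z z = 0}" using M_iff[OF z(1)] in_M_iff[OF z(1)] p by blast
  next
    fix p assume "p \<in> {proj_point z | z. z \<noteq> 0 \<and> qb A z z = 0}"
    then show "p \<in> \<sigma> ` Gr2" using M_iff in_M_iff by blast
  qed
  then show ?thesis unfolding smooth_quadric_def qb_def[symmetric] using A_sym det_A by blast
qed

end

lemma hol_section_image:
  fixes \<sigma> :: "((real^'n) \<times> (real^'n)) set \<Rightarrow> (complex^'n) set"
  assumes "hol_section \<sigma>" "CARD('n) \<ge> 3"
  shows "smooth_quadric (\<sigma> ` Gr2)" "\<sigma> ` Gr2 \<inter> RP = {}"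
proof -
  \<comment> \<open>Any nonzero vector can serve as \<open>v0\<close>; a coordinate vector is
    taken.\<close>
  interpret normalized_section \<sigma> "axis undefined 1"
    by standard (use assms in \<open>auto simp: axis_eq_0_iff\<close>)
  show "smooth_quadric (\<sigma> ` Gr2)" by (rule smooth_quadric_image)
  show "\<sigma> ` Gr2 \<inter> RP = {}" using section_point by blast
qed

text \<open>\<open>CARD('n)\<close> plays the part of n + 2. Uniqueness is asserted on
  \<open>Gr2\<close>, since HOL functions are total and \<open>hol_section\<close> does not
  constrain their values elsewhere.\<close>

theorem mainTheorem15:
  assumes "CARD('n::finite) \<ge> 4"
  shows "(\<forall>Q :: (complex^'n) set set.
            (\<exists>\<sigma>. hol_section \<sigma> \<and> \<sigma> ` Gr2 = Q) \<longleftrightarrow> (smooth_quadric Q \<and> Q \<inter> RP = {})) \<and>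
         (\<forall>Q :: (complex^'n) set set. smooth_quadric Q \<and> Q \<inter> RP = {} \<longrightarrow>
            (\<exists>\<sigma>. hol_section \<sigma> \<and> \<sigma> ` Gr2 = Q \<and>
               (\<forall>\<tau>. hol_section \<tau> \<and> \<tau> ` Gr2 = Q \<longrightarrow> (\<forall>P\<in>Gr2. \<tau> P = \<sigma> P))))"
proof -
  have n: "CARD('n) \<ge> 3" using assms by simp
  have exists: "\<exists>\<sigma>. hol_section \<sigma> \<and> \<sigma> ` Gr2 = Q"
    if "smooth_quadric Q \<and> Q \<inter> RP = {}" for Q :: "(complex^'n) set set"
    using hol_section_exists[of Q] that n by simp
  show ?thesis
  proof (intro conjI allI iffI impI)
    fix Q :: "(complex^'n) set set"
    assume "\<exists>\<sigma>. hol_section \<sigma> \<and> \<sigma> ` Gr2 = Q"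
    then show "smooth_quadric Q" "Q \<inter> RP = {}" using hol_section_image n by blast+
  next
    fix Q :: "(complex^'n) set set"
    assume Q: "smooth_quadric Q \<and> Q \<inter> RP = {}"
    then show "\<exists>\<sigma>. hol_section \<sigma> \<and> \<sigma> ` Gr2 = Q" by (rule exists)
    then obtain \<sigma> where \<sigma>: "hol_section \<sigma>" "\<sigma> ` Gr2 = Q" by (elim exE conjE)
    show "\<exists>\<sigma>. hol_section \<sigma> \<and> \<sigma> ` Gr2 = Q \<and> (\<forall>\<tau>. hol_section \<tau> \<and> \<tau> ` Gr2 = Q \<longrightarrow> (\<forall>P\<in>Gr2. \<tau> P = \<sigma> P))"
    proof (intro exI[of _ \<sigma>] conjI allI impI ballI \<sigma>)
      fix \<tau> and P :: "((real^'n) \<times> (real^'n)) set" assume "hol_section \<tau> \<and> \<tau> ` Gr2 = Q" "P \<in> Gr2"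
      then show "\<tau> P = \<sigma> P" using hol_section_determined_by_image[OF \<sigma>(1), of \<tau> P] \<sigma>(2) by simp
    qed
  qed
qed

end
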